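(* Let $n\ge 2$ and let $\Omega\subset\mathbb{R}^n$ be a bounded $W^{1,1}$-extension domain. Then the set of points $x\in\partial\Omega$ with $\overline{D}(\Omega,x)>\frac12$ is purely $(n-1)$-unrectifiable.
   Context: A domain is a connected open set. For an open set $U\subset\mathbb{R}^n$, $W^{1,1}(U)=\{u\in L^1(U): \nabla u\in L^1(U;\mathbb{R}^n)\}$ with norm $\|u\|_{W^{1,1}(U)}=\|u\|_{L^1(U)}+\|\nabla u\|_{L^1(U)}$. A domain $\Omega$ is a $W^{1,1}$-extension domain if there exist a (not necessarily linear) operator $T\colon W^{1,1}(\Omega)\to W^{1,1}(\mathbb{R}^n)$ and a constant $C>0$ with $Tu|_\Omega=u$ and $\|Tu\|_{W^{1,1}(\mathbb{R}^n)}\le C\|u\|_{W^{1,1}(\Omega)}$ for all $u\in W^{1,1}(\Omega)$. The upper density is $\overline{D}(E,x)=\limsup_{r\searrow 0}|E\cap B(x,r)|/|B(x,r)|$. A set $H\subset\mathbb{R}^n$ is purely $m$-unrectifiable if $\mathcal{H}^m(H\cap f(\mathbb{R}^m))=0$ for every Lipschitz map $f\colon\mathbb{R}^m\to\mathbb{R}^n$, where $\mathcal{H}^m$ is the $m$-dimensional Hausdorff measure. *)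

theory Defs
  imports "HOL-Analysis.Analysis"
begin

definition partial_deriv :: "'n::finite \<Rightarrow> (real^'n \<Rightarrow> real) \<Rightarrow> real^'n \<Rightarrow> real" where
  "partial_deriv i f x = frechet_derivative f (at x) (axis i 1)"

fun Ck :: "nat \<Rightarrow> (real^'n::finite \<Rightarrow> real) \<Rightarrow> bool" where
  "Ck 0 f \<longleftrightarrow> continuous_on UNIV f"
| "Ck (Suc k) f \<longleftrightarrow> f differentiable_on UNIV \<and> (\<forall>i. Ck k (partial_deriv i f))"

text \<open>The space of smooth functions with compact support in \<open>U\<close>; its elements are
  extended by zero to the whole space.\<close>

definition test_functions :: "(real^'n::finite) set \<Rightarrow> (real^'n \<Rightarrow> real) set" where
  "test_functions U = {\<phi>. (\<forall>k. Ck k \<phi>) \<and> compact (closure {x. \<phi> x \<noteq> 0})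
                          \<and> closure {x. \<phi> x \<noteq> 0} \<subseteq> U}"

text \<open>\<open>g\<close> is a distributional gradient of \<open>u\<close> on \<open>U\<close> and belongs to \<open>L\<^sup>1(U)\<close>.\<close>

definition has_L1_gradient ::
    "(real^'n::finite) set \<Rightarrow> (real^'n \<Rightarrow> real) \<Rightarrow> (real^'n \<Rightarrow> real^'n) \<Rightarrow> bool" where
  "has_L1_gradient U u g \<longleftrightarrow>
     integrable (lebesgue_on U) g \<and>
     (\<forall>\<phi>\<in>test_functions U. \<forall>i.
        (\<integral>x. u x * partial_deriv i \<phi> x \<partial>lebesgue_on U) = - (\<integral>x. g x $ i * \<phi> x \<partial>lebesgue_on U))"

text \<open>Elements of \<open>W\<^sup>1\<^sup>,\<^sup>1(U)\<close> are represented by functions on the whole space, of which only the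
  values on \<open>U\<close>, up to null sets, matter.\<close>

definition W11 :: "(real^'n::finite) set \<Rightarrow> (real^'n \<Rightarrow> real) set" where
  "W11 U = {u. integrable (lebesgue_on U) u \<and> (\<exists>g. has_L1_gradient U u g)}"

text \<open>The weak gradient is unique up to null sets, so the norm below does not depend on the choice.\<close>

definition weak_gradient :: "(real^'n::finite) set \<Rightarrow> (real^'n \<Rightarrow> real) \<Rightarrow> real^'n \<Rightarrow> real^'n" where
  "weak_gradient U u = (SOME g. has_L1_gradient U u g)"

definition W11_norm :: "(real^'n::finite) set \<Rightarrow> (real^'n \<Rightarrow> real) \<Rightarrow> real" where
  "W11_norm U u = (\<integral>x. \<bar>u x\<bar> \<partial>lebesgue_on U) + (\<integral>x. norm (weak_gradient U u x) \<partial>lebesgue_on U)"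

text \<open>The second conjunct on \<open>T\<close> makes it a well-defined operator on classes of functions
  modulo equality almost everywhere.\<close>

definition W11_extension_domain :: "(real^'n::finite) set \<Rightarrow> bool" where
  "W11_extension_domain \<Omega> \<longleftrightarrow>
     open \<Omega> \<and> connected \<Omega> \<and>
     (\<exists>(T :: (real^'n \<Rightarrow> real) \<Rightarrow> real^'n \<Rightarrow> real) C. C > 0 \<and>
        (\<forall>u\<in>W11 \<Omega>. T u \<in> W11 UNIV) \<and>
        (\<forall>u\<in>W11 \<Omega>. \<forall>v\<in>W11 \<Omega>. (AE x in lebesgue_on \<Omega>. u x = v x)
           \<longrightarrow> (AE x in lebesgue. T u x = T v x)) \<and>
        (\<forall>u\<in>W11 \<Omega>. (AE x in lebesgue_on \<Omega>. T u x = u x) \<and>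
                    W11_norm UNIV (T u) \<le> C * W11_norm \<Omega> u))"

definition upper_density :: "'a::euclidean_space set \<Rightarrow> 'a \<Rightarrow> ereal" where
  "upper_density E x =
     Limsup (at_right 0) (\<lambda>r. ereal (measure lebesgue (E \<inter> ball x r) / measure lebesgue (ball x r)))"

text \<open>Coverings are required to consist of bounded sets since \<^const>\<open>diameter\<close> is only
  meaningful for those. Empty covering sets contribute nothing; for nonempty sets and \<open>m = 0\<close>
  the convention \<open>0\<^sup>0 = 1\<close> gives the counting measure.\<close>

definition hausdorff_premeasure :: "nat \<Rightarrow> real \<Rightarrow> 'a::metric_space set \<Rightarrow> ennreal" where
  "hausdorff_premeasure m \<delta> A =
     (INF C \<in> {C :: nat \<Rightarrow> 'a set. A \<subseteq> (\<Union>i. C i) \<and> (\<forall>i. bounded (C i) \<and> diameter (C i) \<le> \<delta>)}.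
        \<Sum>i. if C i = {} then 0 else ennreal (unit_ball_vol (real m) * (diameter (C i) / 2) ^ m))"

definition hausdorff_measure :: "nat \<Rightarrow> 'a::metric_space set \<Rightarrow> ennreal" where
  "hausdorff_measure m A = (SUP \<delta>\<in>{0<..}. hausdorff_premeasure m \<delta> A)"

text \<open>The dimension \<open>m\<close> is the cardinality of the index type \<open>'m\<close>.\<close>

definition purely_unrectifiable :: "'m::finite itself \<Rightarrow> (real^'n::finite) set \<Rightarrow> bool" where
  "purely_unrectifiable _ H \<longleftrightarrow>
     (\<forall>f :: real^'m \<Rightarrow> real^'n. (\<exists>L. L-lipschitz_on UNIV f)
        \<longrightarrow> hausdorff_measure CARD('m) (H \<inter> range f) = 0)"

end

theory Submission
  imports Defs
begin

text \<open>Suppose that a Lipschitz image of \<open>\<real>\<^sup>m\<close>, \<open>m = n - 1\<close>, meets the set of boundary points of density larger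
than \<open>1/2\<close> in a set of positive \<open>\<H>\<^sup>m\<close>-measure. Such an image has a tangent hyperplane almost
everywhere. Near a point \<open>p\<close> of the intersection each side of this hyperplane fills half of a small
ball, while \<open>\<Omega>\<close> fills more than half of it at arbitrarily small scales; hence \<open>\<Omega>\<close> fills a fixed
proportion of the ball on both sides. A function that equals \<open>1\<close> above the surface and \<open>-1\<close> below it
therefore jumps at \<open>p\<close> as far as one can see from \<open>\<Omega>\<close>. The surface may also run through \<open>\<Omega>\<close> itself,
so the jump is spread over a layer of width \<open>\<epsilon> = c d\<^sup>2\<close>, where \<open>d\<close> is the distance to the
complement of \<open>\<Omega>\<close>. The gradient is then of order \<open>1/\<epsilon>\<close> on a layer of thickness of order \<open>\<epsilon>\<close>, so that
the function belongs to \<open>W\<^sup>1\<^sup>,\<^sup>1(\<Omega>)\<close> (\<open>layer_function_in_W11\<close>), and since \<open>\<epsilon>\<close> is of smaller order than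
the distance to \<open>p\<close>, the jump at \<open>p\<close> survives.

A function in \<open>W\<^sup>1\<^sup>,\<^sup>1(\<real>\<^sup>n)\<close> cannot jump on a set of positive \<open>\<H>\<^sup>m\<close>-measure. If it takes values at least
\<open>1\<close> and at most \<open>-1\<close> on fixed proportions of \<open>B(p,r)\<close>, then its gradient has integral at least
\<open>const r\<^sup>m\<close> over \<open>B(p,r)\<close> by a Poincare inequality (\<open>poincare_two_sets\<close>). A Vitali covering by
such balls (\<open>hausdorff_premeasure_image_le_integral\<close>) bounds the Hausdorff measure of the set of these
points by the integral of the gradient over an arbitrarily small neighbourhood of the surface, and
the surface has Lebesgue measure zero. This is \<open>hausdorff_null_dense_points_on_cone_flat\<close>.

Only approximate tangency is used. For any \<open>\<eta> > 0\<close> a Lipschitz image is covered, up to an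
\<open>\<H>\<^sup>m\<close>-null set, by countably many pieces on which \<open>\<bar>\<nu> \<bullet> (x - y)\<bar> \<le> \<eta> \<bar>x - y\<bar>\<close> for a unit vector \<open>\<nu>\<close>
(\<open>lipschitz_range_decomposition\<close>), that is, by pieces of Lipschitz graphs of slope about \<open>\<eta>\<close>. The
points where the map is not differentiable, or where its derivative is not injective, have null
image; the first of these facts rests on Rademacher's theorem, which also gives the derivative of the
transition layer. The threshold \<open>1/2\<close> enters through a strict inequality: a density larger than
\<open>1/2 + \<delta>\<close> tolerates an \<open>\<eta>\<close> that is small in comparison with \<open>\<delta>\<close>.

Fubini's theorem is applied throughout in one form: by translation invariance an integral over the
whole space is an integral of averages over segments in a fixed direction
(\<open>nn_integral_average_along_line\<close>). Thus no direction needs to be rotated to a coordinate axis.\<close>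

section \<open>Differentiation of measures\<close>

lemma ball_subset_ball_of_mem:
  fixes x :: "'a::metric_space"
  assumes "x \<in> ball a r" "r < e / 2"
  shows "ball a r \<subseteq> ball x e"
proof
  fix y assume "y \<in> ball a r"
  then show "y \<in> ball x e" using assms dist_triangle[of x y a] by (simp add: dist_commute)
qed

text \<open>A set that leaves a fixed proportion of arbitrarily small balls uncovered is null. Choose an open
set whose measure exceeds the outer measure of \<open>P\<close> by little; by the Vitali covering theorem disjoint
balls inside it cover almost all of \<open>P\<close>, so the outer measure of \<open>P\<close> is at most \<open>c\<close> times itself.
Measurability is asked of the sets \<open>D\<close> instead of \<open>P\<close>, because exceptional sets of points are rarely
seen to be measurable.\<close>

lemma negligible_if_proportion:
  fixes P :: "'a::euclidean_space set"
  assumes c: "c < 1"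
    and P: "\<And>z d. z \<in> P \<Longrightarrow> d > 0 \<Longrightarrow> \<exists>a r D. z \<in> ball a r \<and> r < d \<and> P \<inter> ball a r \<subseteq> D \<and> D \<in> sets lebesgue
              \<and> emeasure lebesgue D \<le> ennreal c * emeasure lebesgue (ball a r)"
  shows "negligible P"
proof -
  have bdd: "negligible Q" if Q: "Q \<subseteq> P" "bounded Q" for Q
  proof -
    obtain G where G: "G \<in> sets lebesgue" "Q \<subseteq> G" "outer_measure_of lebesgue Q = emeasure lebesgue G"
      using outer_measure_of_attain[of Q lebesgue] by auto
    obtain R where R: "Q \<subseteq> ball 0 R" using Q(2) bounded_subset_ballD by blast
    have "emeasure lebesgue G \<le> emeasure lebesgue (ball (0::'a) R)"
      unfolding G(3)[symmetric] outer_measure_of_def by (rule INF_lower) (use R in auto)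
    also have "\<dots> < \<infinity>" using emeasure_lborel_ball_finite[of "0::'a" R] by simp
    finally have fin: "emeasure lebesgue G < \<infinity>" .
    then have Gl: "G \<in> lmeasurable" using G(1) by (simp add: fmeasurable_def)
    have key: "measure lebesgue G \<le> max c 0 * (measure lebesgue G + t)" if t: "t > 0" for t
    proof -
      obtain V where V: "open V" "G \<subseteq> V" "V \<in> lmeasurable" "measure lebesgue V < measure lebesgue G + t"
      proof -
        obtain V where V: "open V" "G \<subseteq> V" "(V - G) \<in> lmeasurable" "emeasure lebesgue (V - G) < ennreal t"
          using sets_lebesgue_outer_open[OF G(1) t] by auto
        have eq: "V = G \<union> (V - G)" using V by auto
        have Vl: "V \<in> lmeasurable" by (subst eq, rule fmeasurable.Un[OF Gl V(3)])
        have "measure lebesgue V = measure lebesgue G + measure lebesgue (V - G)"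
          by (subst eq, rule measure_Union) (use Gl V(3) in \<open>auto simp: fmeasurable_def\<close>)
        moreover have "measure lebesgue (V - G) < t"
          using V(4) V(3) t by (simp add: emeasure_eq_measure2 ennreal_less_iff)
        ultimately show ?thesis using that V Vl by auto
      qed
      define K where "K = {(a,r). ball a r \<subseteq> V \<and> (\<exists>D. P \<inter> ball a r \<subseteq> D \<and> D \<in> sets lebesgue
              \<and> emeasure lebesgue D \<le> ennreal c * emeasure lebesgue (ball a r))}"
      have "\<exists>i. i \<in> K \<and> x \<in> ball (fst i) (snd i) \<and> snd i < d" if x: "x \<in> Q" and d: "d > 0" for x d
      proof -
        obtain e where e: "e > 0" "ball x e \<subseteq> V" using V x G(2) open_contains_ball by blast
        have "x \<in> P" "0 < min d (e/2)" using x Q(1) d e by auto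
        from P[OF this] obtain a r D where ar: "x \<in> ball a r" "r < min d (e/2)"
          and D: "P \<inter> ball a r \<subseteq> D" "D \<in> sets lebesgue"
            "emeasure lebesgue D \<le> ennreal c * emeasure lebesgue (ball a r)" by blast
        have "ball a r \<subseteq> ball x e" by (rule ball_subset_ball_of_mem[OF ar(1)]) (use ar in simp)
        then have "ball a r \<subseteq> V" using e by (rule_tac subset_trans)
        then have "(a, r) \<in> K" unfolding K_def mem_Collect_eq prod.case
          by (intro conjI exI[of _ D] D)
        moreover have "x \<in> ball a r" "r < d" using ar by auto
        ultimately show ?thesis by force
      qed
      then obtain C where C: "countable C" "C \<subseteq> K"
         "pairwise (\<lambda>i j. disjnt (ball (fst i) (snd i)) (ball (fst j) (snd j))) C"
         "negligible(Q - (\<Union>i \<in> C. ball (fst i) (snd i)))"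
        by (rule Vitali_covering_theorem_balls) blast
      have "\<forall>i\<in>C. \<exists>D. P \<inter> ball (fst i) (snd i) \<subseteq> D \<and> D \<in> sets lebesgue
              \<and> emeasure lebesgue D \<le> ennreal c * emeasure lebesgue (ball (fst i) (snd i))"
        using C(2) unfolding K_def by auto
      then obtain D where D: "\<And>i. i \<in> C \<Longrightarrow> P \<inter> ball (fst i) (snd i) \<subseteq> D i" "\<And>i. i \<in> C \<Longrightarrow> D i \<in> sets lebesgue"
          "\<And>i. i \<in> C \<Longrightarrow> emeasure lebesgue (D i) \<le> ennreal c * emeasure lebesgue (ball (fst i) (snd i))" by metis
      define E where "E i = D i \<inter> ball (fst i) (snd i)" for i
      have CV: "ball (fst i) (snd i) \<subseteq> V" if "i \<in> C" for i
        using subsetD[OF C(2) that] unfolding K_def case_prod_beta mem_Collect_eq by (rule conjunct1)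
      have Em: "E i \<in> sets lebesgue" if "i \<in> C" for i
        unfolding E_def by (rule sets.Int[OF D(2)[OF that]]) auto
      have djE: "disjoint_family_on E C" using C(3) unfolding disjoint_family_on_def pairwise_def disjnt_def E_def by fast
      have djB: "disjoint_family_on (\<lambda>i. ball (fst i) (snd i)) C" using C(3) unfolding disjoint_family_on_def pairwise_def disjnt_def by fast
      have Elt: "emeasure lebesgue (E i) \<le> ennreal c * emeasure lebesgue (ball (fst i) (snd i))" if "i \<in> C" for i
        using D(3)[OF that] emeasure_mono[of "E i" "D i" lebesgue] D(2)[OF that] unfolding E_def by (metis inf_le1 order_trans)
      have "emeasure lebesgue (\<Union>i\<in>C. E i) = (\<integral>\<^sup>+i. emeasure lebesgue (E i) \<partial>count_space C)"
        by (rule emeasure_UN_countable) (use Em C djE in auto)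
      also have "\<dots> \<le> (\<integral>\<^sup>+i. ennreal c * emeasure lebesgue (ball (fst i) (snd i)) \<partial>count_space C)"
        by (rule nn_integral_mono) (use Elt in auto)
      also have "\<dots> = ennreal c * (\<integral>\<^sup>+i. emeasure lebesgue (ball (fst i) (snd i)) \<partial>count_space C)"
        by (rule nn_integral_cmult) auto
      also have "\<dots> = ennreal c * emeasure lebesgue (\<Union>i\<in>C. ball (fst i) (snd i))"
        by (subst emeasure_UN_countable) (use C djB in auto)
      also have "\<dots> \<le> ennreal c * emeasure lebesgue V"
        by (intro mult_left_mono emeasure_mono UN_least CV) (use V in auto)
      finally have 1: "emeasure lebesgue (\<Union>i\<in>C. E i) \<le> ennreal c * emeasure lebesgue V" .
      let ?N = "Q - (\<Union>i \<in> C. ball (fst i) (snd i))"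
      have N: "?N \<in> null_sets lebesgue" using C(4) negligible_iff_null_sets by blast
      have UE: "(\<Union>i\<in>C. E i) \<in> sets lebesgue" using Em C by (intro sets.countable_UN'') auto
      have sub: "Q \<subseteq> (\<Union>i\<in>C. E i) \<union> ?N" using D(1) Q(1) unfolding E_def by blast
      have "emeasure lebesgue G \<le> emeasure lebesgue ((\<Union>i\<in>C. E i) \<union> ?N)"
        unfolding G(3)[symmetric] outer_measure_of_def by (rule INF_lower) (use sub UE N in auto)
      also have "\<dots> = emeasure lebesgue (\<Union>i\<in>C. E i)" by (rule emeasure_Un_null_set) (use UE N in auto)
      also have "\<dots> \<le> ennreal c * ennreal (measure lebesgue V)"
        using 1 V(3) by (simp add: emeasure_eq_measure2)
      moreover have cc: "ennreal c = ennreal (max c 0)" by (cases "c \<ge> 0") (auto simp: ennreal_neg max_def)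
      ultimately have "ennreal (measure lebesgue G) \<le> ennreal (max c 0 * measure lebesgue V)"
        using Gl cc by (simp add: emeasure_eq_measure2 ennreal_mult)
      then have "measure lebesgue G \<le> max c 0 * measure lebesgue V" by (subst (asm) ennreal_le_iff) auto
      also have "\<dots> \<le> max c 0 * (measure lebesgue G + t)" using V by (intro mult_left_mono) auto
      finally show ?thesis .
    qed
    define k where "k = max c 0"
    have k: "0 \<le> k" "k < 1" using c by (auto simp: k_def)
    \<comment> \<open>let \<open>t\<close> tend to zero\<close>
    have "measure lebesgue G \<le> k * measure lebesgue G"
    proof (rule field_le_epsilon)
      fix t :: real assume "t > 0"
      then have "measure lebesgue G \<le> k * (measure lebesgue G + t)" using key unfolding k_def by blast
      also have "\<dots> \<le> k * measure lebesgue G + t" using k \<open>t > 0\<close> by (simp add: algebra_simps mult_left_le)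
      finally show "measure lebesgue G \<le> k * measure lebesgue G + t" .
    qed
    then have "(1 - k) * measure lebesgue G \<le> 0" by (simp add: algebra_simps)
    then have "measure lebesgue G = 0" using k by (metis diff_gt_0_iff_gt measure_nonneg mult_le_0_iff not_le order_antisym)
    then have "negligible G" using Gl negligible_iff_measure by blast
    then show ?thesis using G(2) negligible_subset by blast
  qed
  have "P = (\<Union>n::nat. P \<inter> ball 0 (real n))"
    by (auto simp: reals_Archimedean2)
  moreover have "negligible (\<Union>n::nat. P \<inter> ball 0 (real n))"
    by (rule negligible_countable_Union) (auto intro!: bdd bounded_subset[OF bounded_ball])
  ultimately show ?thesis by simp
qed

text \<open>Differentiation of a measure, in the form that at almost every point the upper and lower derivates
agree. Inside a ball \<open>B\<close> of low density, disjoint balls of high density cover almost all of \<open>P\<close>; their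
total measure is at most \<open>\<alpha>/\<beta>\<close> times that of \<open>B\<close>, so \<open>P\<close> leaves a proportion of \<open>B\<close> free.\<close>

lemma negligible_distinct_derivates:
  fixes P :: "'a::euclidean_space set" and \<mu> :: "'a measure"
  assumes sets: "sets \<mu> = sets borel" and ab: "0 \<le> \<alpha>" "\<alpha> < \<beta>"
    and low: "\<And>z d. z \<in> P \<Longrightarrow> d > 0 \<Longrightarrow> \<exists>a r. z \<in> ball a r \<and> r < d \<and> emeasure \<mu> (ball a r) \<le> ennreal \<alpha> * emeasure lborel (ball a r)"
    and upp: "\<And>z d. z \<in> P \<Longrightarrow> d > 0 \<Longrightarrow> \<exists>a r. z \<in> ball a r \<and> r < d \<and> ennreal \<beta> * emeasure lborel (ball a r) \<le> emeasure \<mu> (ball a r)"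
  shows "negligible P"
proof (rule negligible_if_proportion[of "\<alpha> / \<beta>"])
  show "\<alpha> / \<beta> < 1" using ab by auto
  fix z d assume z: "z \<in> P" and d: "d > (0::real)"
  obtain a r where ar: "z \<in> ball a r" "r < d" "emeasure \<mu> (ball a r) \<le> ennreal \<alpha> * emeasure lborel (ball a r)"
    using low[OF z d] by auto
  define K where "K = {(b,s). ball b s \<subseteq> ball a r \<and> ennreal \<beta> * emeasure lborel (ball b s) \<le> emeasure \<mu> (ball b s)}"
  have "\<exists>i. i \<in> K \<and> x \<in> ball (fst i) (snd i) \<and> snd i < d" if x: "x \<in> P \<inter> ball a r" and d: "d > 0" for x d
  proof -
    obtain e where e: "e > 0" "ball x e \<subseteq> ball a r" using x open_contains_ball by blast
    obtain b s where "x \<in> ball b s" "s < min d (e/2)" "ennreal \<beta> * emeasure lborel (ball b s) \<le> emeasure \<mu> (ball b s)"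
      using upp[of x "min d (e/2)"] x d e by (metis half_gt_zero min_less_iff_conj IntD1)
    moreover from this have "ball b s \<subseteq> ball x e"
      by (intro ball_subset_ball_of_mem) auto
    ultimately have "(b, s) \<in> K" "x \<in> ball b s" "s < d" using e unfolding K_def by auto
    then show ?thesis by force
  qed
  then obtain C where C: "countable C" "C \<subseteq> K"
     "pairwise (\<lambda>i j. disjnt (ball (fst i) (snd i)) (ball (fst j) (snd j))) C"
     "negligible((P \<inter> ball a r) - (\<Union>i \<in> C. ball (fst i) (snd i)))"
    by (rule Vitali_covering_theorem_balls) blast
  let ?U = "\<Union>i\<in>C. ball (fst i) (snd i)"
  let ?N = "(P \<inter> ball a r) - ?U"
  have djB: "disjoint_family_on (\<lambda>i. ball (fst i) (snd i)) C" using C(3) unfolding disjoint_family_on_def pairwise_def disjnt_def by fast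
  have N: "?N \<in> null_sets lebesgue" using C(4) negligible_iff_null_sets by blast
  have oU: "open ?U" by auto
  have CU: "ball (fst i) (snd i) \<subseteq> ball a r" if "i \<in> C" for i
    using subsetD[OF C(2) that] unfolding K_def case_prod_beta mem_Collect_eq by (rule conjunct1)
  have "ennreal \<beta> * emeasure lborel ?U = ennreal \<beta> * (\<integral>\<^sup>+i. emeasure lborel (ball (fst i) (snd i)) \<partial>count_space C)"
    by (subst emeasure_UN_countable) (use C djB in auto)
  also have "\<dots> = (\<integral>\<^sup>+i. ennreal \<beta> * emeasure lborel (ball (fst i) (snd i)) \<partial>count_space C)"
    by (rule nn_integral_cmult[symmetric]) auto
  also have "\<dots> \<le> (\<integral>\<^sup>+i. emeasure \<mu> (ball (fst i) (snd i)) \<partial>count_space C)"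
    by (rule nn_integral_mono) (use C in \<open>auto simp: K_def\<close>)
  also have "\<dots> = emeasure \<mu> ?U"
    by (subst emeasure_UN_countable) (use C djB sets in auto)
  also have "\<dots> \<le> emeasure \<mu> (ball a r)"
    by (rule emeasure_mono) (use CU sets in auto)
  also have "\<dots> \<le> ennreal \<alpha> * emeasure lborel (ball a r)" by (rule ar)
  finally have *: "ennreal \<beta> * emeasure lborel ?U \<le> ennreal \<alpha> * emeasure lborel (ball a r)" .
  have "emeasure lborel ?U = ennreal (1/\<beta>) * (ennreal \<beta> * emeasure lborel ?U)"
    using ab by (simp add: mult.assoc[symmetric] ennreal_mult''[symmetric])
  also have "\<dots> \<le> ennreal (1/\<beta>) * (ennreal \<alpha> * emeasure lborel (ball a r))" by (intro mult_left_mono *) auto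
  also have "\<dots> = ennreal (\<alpha> / \<beta>) * emeasure lborel (ball a r)"
    using ab by (simp add: mult.assoc[symmetric] ennreal_mult''[symmetric])
  finally have **: "emeasure lborel ?U \<le> ennreal (\<alpha> / \<beta>) * emeasure lborel (ball a r)" .
  have "emeasure lebesgue (?U \<union> ?N) = emeasure lebesgue ?U" by (rule emeasure_Un_null_set) (use oU N in auto)
  also have "\<dots> \<le> ennreal (\<alpha> / \<beta>) * emeasure lebesgue (ball a r)" using ** oU by simp
  finally have NU: "emeasure lebesgue (?U \<union> ?N) \<le> ennreal (\<alpha> / \<beta>) * emeasure lebesgue (ball a r)" .
  have NU2: "?U \<union> ?N \<in> sets lebesgue" by (rule sets.Un) (use N oU in auto)
  show "\<exists>a r D. z \<in> ball a r \<and> r < d \<and> P \<inter> ball a r \<subseteq> D \<and> D \<in> sets lebesgue \<and> emeasure lebesgue D \<le> ennreal (\<alpha> / \<beta>) * emeasure lebesgue (ball a r)"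
    using ar by (intro exI[of _ a] exI[of _ r] exI[of _ "?U \<union> ?N"] conjI NU NU2) auto
qed

text \<open>A hole of radius \<open>e \<bar>w - z\<bar>\<close> around \<open>w\<close> occupies the proportion \<open>(e/2)\<^sup>n\<close> of the ball of radius
\<open>2 \<bar>w - z\<bar>\<close> around \<open>z\<close>. This replaces the density theorem: almost every point of \<open>E\<close> has points of \<open>E\<close>
close to everything nearby, relative to the distance.\<close>

lemma negligible_porous:
  fixes E :: "'a::euclidean_space set"
  assumes e: "0 < e" "e \<le> 1"
  shows "negligible {z\<in>E. \<forall>d>0. \<exists>w. 0 < dist w z \<and> dist w z < d \<and> ball w (e * dist w z) \<inter> E = {}}" (is "negligible ?P")
proof (rule negligible_if_proportion[of "1 - (e/2) ^ DIM('a)"])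
  show "1 - (e / 2) ^ DIM('a) < 1" using e by auto
  fix z d assume z: "z \<in> ?P" and d: "d > (0::real)"
  then have "\<exists>w. 0 < dist w z \<and> dist w z < d/2 \<and> ball w (e * dist w z) \<inter> E = {}" using half_gt_zero by blast
  then obtain w where w: "0 < dist w z" "dist w z < d/2" "ball w (e * dist w z) \<inter> E = {}" by auto
  define r where "r = 2 * dist w z"
  have sub: "ball w (e * dist w z) \<subseteq> ball z r"
  proof
    fix x assume "x \<in> ball w (e * dist w z)"
    then have "dist w x < e * dist w z" by auto
    also have "\<dots> \<le> dist w z" using e w by (simp add: mult_left_le_one_le)
    finally show "x \<in> ball z r" unfolding r_def using dist_triangle[of z x w] by (auto simp: dist_commute)
  qed
  have r: "r > 0" using w by (auto simp: r_def)
  let ?D = "ball z r - ball w (e * dist w z)"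
  have e2: "(e/2)^DIM('a) \<le> 1" using e by (auto intro!: power_le_one)
  have mb: "measure lebesgue (ball w (e * dist w z)) = (e/2)^DIM('a) * measure lebesgue (ball z r)"
    using content_ball_conv_unit_ball[of r z] content_ball_conv_unit_ball[of "e * dist w z" w] e w r
    by (simp add: r_def power_mult_distrib power_divide)
  have "measure lebesgue ?D = measure lebesgue (ball z r) - measure lebesgue (ball w (e * dist w z))"
    by (rule measure_Diff) (use sub emeasure_lborel_ball_finite[of z r] in auto)
  then have m: "measure lebesgue ?D = (1 - (e/2)^DIM('a)) * measure lebesgue (ball z r)"
    using mb by (simp add: algebra_simps)
  have "emeasure lebesgue ?D = ennreal (measure lebesgue ?D)"
    by (rule emeasure_eq_measure2) (auto intro: fmeasurable_Diff)
  also have "\<dots> = ennreal (1 - (e/2)^DIM('a)) * ennreal (measure lebesgue (ball z r))"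
    unfolding m using e2 by (intro ennreal_mult) auto
  also have "ennreal (measure lebesgue (ball z r)) = emeasure lebesgue (ball z r)"
    by (rule emeasure_eq_measure2[symmetric]) auto
  finally have "emeasure lebesgue ?D = ennreal (1 - (e/2)^DIM('a)) * emeasure lebesgue (ball z r)" .
  then show "\<exists>a r D. z \<in> ball a r \<and> r < d \<and> ?P \<inter> ball a r \<subseteq> D \<and> D \<in> sets lebesgue
              \<and> emeasure lebesgue D \<le> ennreal (1 - (e / 2) ^ DIM('a)) * emeasure lebesgue (ball a r)"
    using w r by (intro exI[of _ z] exI[of _ r] exI[of _ ?D]) (auto simp: r_def)
qed


text \<open>A bounded \<open>q\<close> without a limit at zero has such a gap for some rational \<open>\<alpha> < \<beta>\<close>, so it is enough to
treat one pair \<open>\<alpha>\<close>, \<open>\<beta>\<close> at a time.\<close>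

definition slope_gap :: "(real \<Rightarrow> real) \<Rightarrow> real \<Rightarrow> real \<Rightarrow> bool" where
  "slope_gap q \<alpha> \<beta> \<longleftrightarrow>
     (\<forall>d>0. (\<exists>t. 0 < \<bar>t\<bar> \<and> \<bar>t\<bar> < d \<and> q t < \<alpha>) \<and> (\<exists>t. 0 < \<bar>t\<bar> \<and> \<bar>t\<bar> < d \<and> q t > \<beta>))"

text \<open>The slopes of a monotone function are densities of its Stieltjes measure on intervals, which are the
balls of the line.\<close>

lemma negligible_distinct_slopes_mono:
  fixes k :: "real \<Rightarrow> real"
  assumes mono: "mono k" and cont: "continuous_on UNIV k" and ab: "0 \<le> \<alpha>" "\<alpha> < \<beta>"
  shows "negligible {z. slope_gap (\<lambda>t. (k (z + t) - k z) / t) \<alpha> \<beta>}" (is "negligible ?P")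
proof -
  define \<mu> where "\<mu> = interval_measure k"
  have kc: "isCont k x" for x using cont continuous_on_eq_continuous_at by blast
  have km: "x \<le> y \<Longrightarrow> k x \<le> k y" for x y using mono by (auto simp: mono_def)
  have Icc: "emeasure \<mu> {a..b} = ennreal (k b - k a)" if "a \<le> b" for a b
    unfolding \<mu>_def by (rule emeasure_interval_measure_Icc) (use that km cont continuous_on_subset in auto)
  have sets: "sets \<mu> = sets borel" by (simp add: \<mu>_def)
  have sing: "emeasure \<mu> {a} = 0" for a using Icc[of a a] by simp
  have Ioo: "emeasure \<mu> {a<..<b} = ennreal (k b - k a)" if "a < b" for a b
  proof -
    have "{a..b} = {a<..<b} \<union> {a, b}" using that by auto
    moreover have "{a, b} \<in> null_sets \<mu>"
      by (rule null_setsI) (use sing sets emeasure_subadditive[of "{a}" \<mu> "{b}"] in \<open>auto simp: insert_commute\<close>)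
    ultimately have "emeasure \<mu> {a..b} = emeasure \<mu> {a<..<b}"
      using sets emeasure_Un_null_set[of "{a<..<b}" \<mu> "{a, b}"] by (metis borel_open open_greaterThanLessThan)
    then show ?thesis using Icc that by simp
  qed
  have ballint: "{x<..<y} = ball ((x+y)/2) ((y-x)/2)" for x y :: real
    by (auto simp: dist_real_def abs_if field_simps split: if_splits)
  have bmu: "emeasure \<mu> (ball ((x+y)/2) ((y-x)/2)) = ennreal (k y - k x)" if "x < y" for x y
    using Ioo[OF that] ballint[of x y] by simp
  have bl: "emeasure lborel (ball ((x+y)/2) ((y-x)/2)) = ennreal (y - x)" if "x < y" for x y :: real
    using that ballint[of x y, symmetric] by simp
  \<comment> \<open>A difference quotient from \<open>z\<close> is an increment over an interval with endpoint \<open>z\<close>; by continuity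
    the interval can be enlarged slightly so as to contain \<open>z\<close> in its interior.\<close>
  have enl: "\<exists>x y. x < z \<and> z < y \<and> y - x < 2*d \<and> P ((k y - k x) / (y - x))"
    if t: "0 < \<bar>t\<bar>" "\<bar>t\<bar> < d" "P ((k (z + t) - k z) / t)" and oP: "open (Collect P)" for z t d P
  proof (cases "t > 0")
    case True
    have "((\<lambda>s. (k (z + t) - k s) / (z + t - s)) \<longlongrightarrow> (k (z + t) - k z) / (z + t - z)) (at_left z)"
      using True kc[of z] by (intro tendsto_intros) (auto simp: isCont_def intro: tendsto_mono at_le)
    then have "eventually (\<lambda>s. (k (z + t) - k s) / (z + t - s) \<in> Collect P) (at_left z)"
      using oP t by (intro topological_tendstoD) auto
    moreover have "eventually (\<lambda>s. s \<in> {z - d<..<z}) (at_left z)" using t by (intro eventually_at_leftI[of "z-d"]) auto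
    ultimately have "eventually (\<lambda>s. (k (z + t) - k s) / (z + t - s) \<in> Collect P \<and> s \<in> {z - d<..<z}) (at_left z)"
      by (rule eventually_conj)
    then obtain s where "P ((k (z + t) - k s) / (z + t - s))" "s \<in> {z - d<..<z}"
      using eventually_happens'[of "at_left z"] trivial_limit_at_left_real by auto
    then show ?thesis using True t by (intro exI[of _ s] exI[of _ "z+t"]) auto
  next
    case False
    then have tn: "t < 0" using t by auto
    have "((\<lambda>s. (k s - k (z + t)) / (s - (z + t))) \<longlongrightarrow> (k z - k (z + t)) / (z - (z + t))) (at_right z)"
      using tn kc[of z] by (intro tendsto_intros) (auto simp: isCont_def intro: tendsto_mono at_le)
    moreover have "(k z - k (z + t)) / (z - (z + t)) = (k (z + t) - k z) / t" using tn by (simp add: field_simps)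
    ultimately have "eventually (\<lambda>s. (k s - k (z + t)) / (s - (z + t)) \<in> Collect P) (at_right z)"
      using oP t by (intro topological_tendstoD) auto
    moreover have "eventually (\<lambda>s. s \<in> {z<..<z + d}) (at_right z)" using t by (intro eventually_at_rightI[of _ "z+d"]) auto
    ultimately have "eventually (\<lambda>s. (k s - k (z + t)) / (s - (z + t)) \<in> Collect P \<and> s \<in> {z<..<z+d}) (at_right z)"
      by (rule eventually_conj)
    then obtain s where "P ((k s - k (z + t)) / (s - (z + t)))" "s \<in> {z<..<z+d}"
      using eventually_happens'[of "at_right z"] trivial_limit_at_right_real by auto
    then show ?thesis using tn t by (intro exI[of _ "z+t"] exI[of _ s]) auto
  qed
  show ?thesis
  proof (rule negligible_distinct_derivates[OF sets ab])
    fix z d assume z: "z \<in> ?P" and d: "d > (0::real)"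
    obtain t where "0 < \<bar>t\<bar>" "\<bar>t\<bar> < d" "(k (z + t) - k z) / t < \<alpha>"
      using z d unfolding slope_gap_def by blast
    from enl[of t d "\<lambda>q. q < \<alpha>", OF this] obtain x y where xy: "x < z" "z < y" "y - x < 2*d" "(k y - k x) / (y - x) < \<alpha>"
      by (auto simp: open_Collect_less)
    have "k y - k x \<le> \<alpha> * (y - x)" using xy by (simp add: divide_less_eq)
    then have "ennreal (k y - k x) \<le> ennreal \<alpha> * ennreal (y - x)"
      using ab xy by (simp add: ennreal_mult[symmetric] ennreal_leI)
    then show "\<exists>a r. z \<in> ball a r \<and> r < d \<and> emeasure \<mu> (ball a r) \<le> ennreal \<alpha> * emeasure lborel (ball a r)"
      using xy bmu[of x y] bl[of x y] ballint[of x y]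
      by (rule_tac exI[of _ "(x+y)/2"], rule_tac exI[of _ "(y-x)/2"]) auto
  next
    fix z d assume z: "z \<in> ?P" and d: "d > (0::real)"
    obtain t where "0 < \<bar>t\<bar>" "\<bar>t\<bar> < d" "(k (z + t) - k z) / t > \<beta>"
      using z d unfolding slope_gap_def by blast
    from enl[of t d "\<lambda>q. q > \<beta>", OF this] obtain x y where xy: "x < z" "z < y" "y - x < 2*d" "(k y - k x) / (y - x) > \<beta>"
      by (auto simp: open_Collect_less)
    have "\<beta> * (y - x) \<le> k y - k x" using xy by (simp add: less_divide_eq)
    then have "ennreal \<beta> * ennreal (y - x) \<le> ennreal (k y - k x)"
      using ab xy by (simp add: ennreal_mult[symmetric] ennreal_leI)
    then show "\<exists>a r. z \<in> ball a r \<and> r < d \<and> ennreal \<beta> * emeasure lborel (ball a r) \<le> emeasure \<mu> (ball a r)"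
      using xy bmu[of x y] bl[of x y] ballint[of x y]
      by (rule_tac exI[of _ "(x+y)/2"], rule_tac exI[of _ "(y-x)/2"]) auto
  qed
qed

text \<open>A large multiple of the identity turns a Lipschitz function into a monotone one and shifts all slopes
by the same amount.\<close>

lemma negligible_distinct_slopes:
  fixes h :: "real \<Rightarrow> real"
  assumes lip: "L-lipschitz_on UNIV h" and ab: "\<alpha> < \<beta>"
  shows "negligible {z. slope_gap (\<lambda>t. (h (z + t) - h z) / t) \<alpha> \<beta>}"
proof -
  define M where "M = L + \<bar>\<alpha>\<bar>"
  define k where "k t = h t + M * t" for t
  have hl: "\<bar>h x - h y\<bar> \<le> L * \<bar>x - y\<bar>" for x y
    using lipschitz_onD[OF lip, of x y] by (simp add: dist_real_def)
  have L: "L \<ge> 0" using lip by (simp add: lipschitz_on_def)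
  have "mono k"
  proof (rule monoI)
    fix x y :: real assume "x \<le> y"
    then have "L * (y - x) \<le> M * (y - x)" by (intro mult_right_mono) (auto simp: M_def)
    then show "k x \<le> k y" using hl[of y x] \<open>x \<le> y\<close> unfolding k_def by (simp add: algebra_simps abs_if split: if_splits)
  qed
  moreover have "continuous_on UNIV k" unfolding k_def
    by (intro continuous_intros lipschitz_on_continuous_on[OF lip])
  ultimately have "negligible {z. slope_gap (\<lambda>t. (k (z + t) - k z) / t) (\<alpha> + M) (\<beta> + M)}"
    by (rule negligible_distinct_slopes_mono) (use ab L in \<open>auto simp: M_def\<close>)
  moreover have eq: "(k (z + t) - k z) / t = (h (z + t) - h z) / t + M" if "0 < \<bar>t\<bar>" for z t
    using that by (simp add: k_def field_simps)
  have "(k (z + t) - k z) / t < \<alpha> + M \<longleftrightarrow> (h (z + t) - h z) / t < \<alpha>"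
       "(k (z + t) - k z) / t > \<beta> + M \<longleftrightarrow> (h (z + t) - h z) / t > \<beta>" if "0 < \<bar>t\<bar>" for z t
    using eq[OF that, of z] by auto
  ultimately show ?thesis by (simp add: slope_gap_def cong: conj_cong)
qed

lemma nn_integral_lborel_translate:
  fixes F :: "'a::euclidean_space \<Rightarrow> ennreal"
  assumes [measurable]: "F \<in> borel_measurable borel"
  shows "(\<integral>\<^sup>+x. F (x + c) \<partial>lborel) = (\<integral>\<^sup>+x. F x \<partial>lborel)"
proof -
  have "(\<integral>\<^sup>+x. F x \<partial>lborel) = (\<integral>\<^sup>+x. F x \<partial>distr lborel borel ((+) c))" by (simp add: lborel_distr_plus)
  also have "\<dots> = (\<integral>\<^sup>+x. F (c + x) \<partial>lborel)" by (rule nn_integral_distr) auto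
  finally show ?thesis by (simp add: add.commute)
qed

text \<open>Each translate has the same integral, so the integral is also the average over \<open>t \<in> [0,1]\<close> of the
integrals of the translates by \<open>t e\<close>; then the order of integration is exchanged.\<close>

lemma nn_integral_average_along_line:
  fixes F :: "'a::euclidean_space \<Rightarrow> ennreal"
  assumes [measurable]: "F \<in> borel_measurable borel"
  shows "(\<integral>\<^sup>+x. F x \<partial>lborel) = (\<integral>\<^sup>+x. \<integral>\<^sup>+t. F (x + t *\<^sub>R e) * indicator {0..1} t \<partial>lborel \<partial>lborel)"
proof -
  have tr: "(\<integral>\<^sup>+x. F (x + c) \<partial>lborel) = (\<integral>\<^sup>+x. F x \<partial>lborel)" for c
    by (rule nn_integral_lborel_translate) simp
  have "(\<integral>\<^sup>+x. \<integral>\<^sup>+t. F (x + t *\<^sub>R e) * indicator {0..1} t \<partial>lborel \<partial>lborel)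
      = (\<integral>\<^sup>+t. \<integral>\<^sup>+x. F (x + t *\<^sub>R e) * indicator {0..1} t \<partial>lborel \<partial>lborel)"
    by (rule lborel_pair.Fubini'[symmetric]) measurable
  also have "\<dots> = (\<integral>\<^sup>+t. (\<integral>\<^sup>+x. F x \<partial>lborel) * indicator {0..1} (t::real) \<partial>lborel)"
    by (intro nn_integral_cong) (auto simp: nn_integral_multc tr)
  also have "\<dots> = (\<integral>\<^sup>+x. F x \<partial>lborel)" by (simp add: nn_integral_cmult)
  finally show ?thesis by simp
qed

lemma negligible_if_null_on_lines:
  fixes A :: "'a::euclidean_space set"
  assumes [measurable]: "A \<in> sets borel" and null: "\<And>x. negligible {t. x + t *\<^sub>R e \<in> A}"
  shows "negligible A"
proof -
  have "(\<integral>\<^sup>+t. indicator A (x + t *\<^sub>R e) * indicator {0..1} t \<partial>lborel) = 0" for x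
  proof -
    have "{t. x + t *\<^sub>R e \<in> A} \<in> sets lborel" by measurable
    moreover have "{t. x + t *\<^sub>R e \<in> A} \<in> null_sets lebesgue" using null[of x] negligible_iff_null_sets by blast
    ultimately have "AE t in lborel. t \<notin> {t. x + t *\<^sub>R e \<in> A}"
      by (intro AE_not_in) (simp add: null_sets_completion_iff)
    then have "AE t in lborel. indicator A (x + t *\<^sub>R e) * indicator {0..1} t = (0::ennreal)" by eventually_elim auto
    then show ?thesis by (subst nn_integral_0_iff_AE) auto
  qed
  then have "(\<integral>\<^sup>+x. indicator A x \<partial>lborel) = 0"
    by (subst nn_integral_average_along_line[of _ e]) auto
  then have "A \<in> null_sets lborel" by (intro null_setsI) auto
  then show ?thesis using negligible_iff_null_sets null_sets_completionI by blast
qed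

section \<open>Rademacher's theorem\<close>

text \<open>The set meets every line of direction \<open>e\<close> in a null set. It is Borel, because for fixed \<open>d\<close> each of
the two conditions holds on a union of open sets, indexed by \<open>t\<close>, and the values \<open>d = 1/(n+1)\<close>
suffice.\<close>

lemma negligible_distinct_slopes_along:
  fixes f :: "'a::euclidean_space \<Rightarrow> real"
  assumes lip: "L-lipschitz_on UNIV f" and ab: "\<alpha> < \<beta>"
  shows "negligible {x. slope_gap (\<lambda>t. (f (x + t *\<^sub>R e) - f x) / t) \<alpha> \<beta>}" (is "negligible ?A")
proof (rule negligible_if_null_on_lines[of _ e])
  have cont: "continuous_on UNIV (\<lambda>x. (f (x + t *\<^sub>R e) - f x) / t)" if "0 < \<bar>t\<bar>" for t
  proof -
    have f: "continuous_on UNIV f" by (rule lipschitz_on_continuous_on[OF lip])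
    show ?thesis using that
      by (intro continuous_intros continuous_on_compose2[OF f] f) auto
  qed
  define U where "U d = (\<Union>t\<in>{t. 0 < \<bar>t\<bar> \<and> \<bar>t\<bar> < d}. {x. (f (x + t *\<^sub>R e) - f x) / t < \<alpha>})" for d :: real
  define V where "V d = (\<Union>t\<in>{t. 0 < \<bar>t\<bar> \<and> \<bar>t\<bar> < d}. {x. (f (x + t *\<^sub>R e) - f x) / t > \<beta>})" for d :: real
  have oU: "open (U d)" for d unfolding U_def
    by (intro open_UN ballI open_Collect_less cont continuous_intros) auto
  have oV: "open (V d)" for d unfolding V_def
    by (intro open_UN ballI open_Collect_less cont continuous_intros) auto
  have monoU: "U d \<subseteq> U d'" "V d \<subseteq> V d'" if "d \<le> d'" for d d' unfolding U_def V_def using that by force+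
  have A1: "?A = {x. \<forall>d>0. x \<in> U d \<inter> V d}" unfolding U_def V_def slope_gap_def by auto
  have "?A = (\<Inter>n::nat. U (1 / Suc n) \<inter> V (1 / Suc n))"
  proof -
    have "x \<in> U d \<inter> V d" if x: "\<forall>n::nat. x \<in> U (1 / Suc n) \<inter> V (1 / Suc n)" and d: "d > 0" for x d
    proof -
      obtain n where "1 / Suc n < d" using nat_approx_posE[OF d] by auto
      then show ?thesis using x[rule_format, of n] monoU[of "1 / Suc n" d] by auto
    qed
    moreover have "1 / real (Suc n) > 0" for n by simp
    ultimately show ?thesis unfolding A1 by (intro set_eqI iffI INT_I CollectI allI impI) blast+
  qed
  moreover have "U (1 / Suc n) \<inter> V (1 / Suc n) \<in> sets borel" for n :: nat by (intro borel_open open_Int oU oV)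
  ultimately show "?A \<in> sets borel" by (simp only:) (rule sets.countable_INT'', auto)
  fix x
  have lip': "(L * norm e)-lipschitz_on UNIV (\<lambda>s. f (x + s *\<^sub>R e))"
  proof (rule lipschitz_onI)
    fix s t :: real
    have "dist (f (x + s *\<^sub>R e)) (f (x + t *\<^sub>R e)) \<le> L * dist (x + s *\<^sub>R e) (x + t *\<^sub>R e)"
      by (rule lipschitz_onD[OF lip]) auto
    also have "dist (x + s *\<^sub>R e) (x + t *\<^sub>R e) = norm e * dist s t"
      by (simp add: dist_norm scaleR_diff_left[symmetric])
    finally show "dist (f (x + s *\<^sub>R e)) (f (x + t *\<^sub>R e)) \<le> L * norm e * dist s t" by simp
  qed (use lip in \<open>auto simp: lipschitz_on_def\<close>)
  show "negligible {s. x + s *\<^sub>R e \<in> ?A}"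
    using negligible_distinct_slopes[OF lip' ab] by (simp add: scaleR_add_left add.assoc)
qed

text \<open>The limit is the lower limit of \<open>q\<close>, the supremum of the eventual lower bounds; if the upper limit
were larger, two rationals in between would be crossed at all scales.\<close>

lemma convergent_if_no_gap:
  fixes q :: "real \<Rightarrow> real"
  assumes bd: "\<And>t. \<bar>q t\<bar> \<le> B"
    and gap: "\<And>\<alpha> \<beta>. \<alpha> \<in> \<rat> \<Longrightarrow> \<beta> \<in> \<rat> \<Longrightarrow> \<alpha> < \<beta> \<Longrightarrow> \<not> slope_gap q \<alpha> \<beta>"
  shows "\<exists>l. (q \<longlongrightarrow> l) (at 0)"
proof -
  define S where "S = {x. \<exists>d>0. \<forall>t. 0 < \<bar>t\<bar> \<and> \<bar>t\<bar> < d \<longrightarrow> x \<le> q t}"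
  have b1: "- B \<in> S" unfolding S_def using bd by (auto intro!: exI[of _ 1] simp: abs_le_iff minus_le_iff)
  have b2: "x \<le> B" if x: "x \<in> S" for x
  proof -
    obtain d where "d > 0" "\<forall>t. 0 < \<bar>t\<bar> \<and> \<bar>t\<bar> < d \<longrightarrow> x \<le> q t" using x unfolding S_def by auto
    then have "x \<le> q (d/2)" by auto
    then show ?thesis using bd[of "d/2"] by auto
  qed
  have bdd: "bdd_above S" using b2 by (auto intro!: bdd_aboveI)
  define l where "l = Sup S"
  have "(q \<longlongrightarrow> l) (at 0)"
    unfolding LIM_eq
  proof (intro allI impI)
    fix r :: real assume r: "0 < r"
    obtain x where x: "x \<in> S" "l - r < x" using less_cSup_iff[of S "l - r"] b1 bdd r unfolding l_def by auto
    obtain d1 where d1: "d1 > 0" "\<And>t. 0 < \<bar>t\<bar> \<and> \<bar>t\<bar> < d1 \<Longrightarrow> x \<le> q t" using x unfolding S_def by auto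
    obtain \<alpha> where a: "\<alpha> \<in> \<rat>" "l < \<alpha>" "\<alpha> < l + r" using Rats_dense_in_real[of l "l + r"] r by auto
    obtain \<beta> where b: "\<beta> \<in> \<rat>" "\<alpha> < \<beta>" "\<beta> < l + r" using Rats_dense_in_real[of \<alpha> "l + r"] a by auto
    obtain d2 where d2: "d2 > 0" "\<not> ((\<exists>t. 0 < \<bar>t\<bar> \<and> \<bar>t\<bar> < d2 \<and> q t < \<alpha>) \<and> (\<exists>t. 0 < \<bar>t\<bar> \<and> \<bar>t\<bar> < d2 \<and> q t > \<beta>))"
      using gap[OF a(1) b(1,2)] unfolding slope_gap_def by auto
    have "\<alpha> \<notin> S" using cSup_upper[OF _ bdd, of \<alpha>] a unfolding l_def by auto
    then have "\<exists>t. 0 < \<bar>t\<bar> \<and> \<bar>t\<bar> < d2 \<and> q t < \<alpha>" using d2(1) unfolding S_def by (auto simp: not_le)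
    then have up: "q t \<le> \<beta>" if "0 < \<bar>t\<bar> \<and> \<bar>t\<bar> < d2" for t using d2(2) that not_le by blast
    show "\<exists>s>0. \<forall>t. t \<noteq> 0 \<and> norm (t - 0) < s \<longrightarrow> norm (q t - l) < r"
    proof (intro exI[of _ "min d1 d2"] conjI allI impI)
      fix t :: real assume "t \<noteq> 0 \<and> norm (t - 0) < min d1 d2"
      then have "0 < \<bar>t\<bar> \<and> \<bar>t\<bar> < d1" "0 < \<bar>t\<bar> \<and> \<bar>t\<bar> < d2" by auto
      from d1(2)[OF this(1)] up[OF this(2)] show "norm (q t - l) < r" using x b by auto
    qed (use d1 d2 in auto)
  qed
  then show ?thesis by blast
qed

lemma negligible_no_directional_derivative:
  fixes f :: "'a::euclidean_space \<Rightarrow> real"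
  assumes lip: "L-lipschitz_on UNIV f"
  shows "negligible {x. \<not> (\<exists>l. ((\<lambda>t. (f (x + t *\<^sub>R e) - f x) / t) \<longlongrightarrow> l) (at 0))}"
proof -
  define A where "A = (\<lambda>(\<alpha>,\<beta>). {x. slope_gap (\<lambda>t. (f (x + t *\<^sub>R e) - f x) / t) \<alpha> \<beta>})"
  define I where "I = {(\<alpha>,\<beta>). \<alpha> \<in> \<rat> \<and> \<beta> \<in> \<rat> \<and> \<alpha> < (\<beta>::real)}"
  have "countable I" by (rule countable_subset[of _ "\<rat> \<times> \<rat>"]) (auto simp: I_def countable_rat)
  moreover have "negligible (A i)" if "i \<in> I" for i
    using that negligible_distinct_slopes_along[OF lip] unfolding A_def I_def by auto
  ultimately have "negligible (\<Union>i\<in>I. A i)" by (intro negligible_countable_Union) auto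
  moreover have "{x. \<not> (\<exists>l. ((\<lambda>t. (f (x + t *\<^sub>R e) - f x) / t) \<longlongrightarrow> l) (at 0))} \<subseteq> (\<Union>i\<in>I. A i)"
  proof (rule subsetI, rule ccontr)
    fix x assume x: "x \<in> {x. \<not> (\<exists>l. ((\<lambda>t. (f (x + t *\<^sub>R e) - f x) / t) \<longlongrightarrow> l) (at 0))}" and nx: "x \<notin> (\<Union>i\<in>I. A i)"
    have "\<exists>l. ((\<lambda>t. (f (x + t *\<^sub>R e) - f x) / t) \<longlongrightarrow> l) (at 0)"
    proof (rule convergent_if_no_gap[of _ "L * norm e"])
      fix t :: real
      have "\<bar>f (x + t *\<^sub>R e) - f x\<bar> \<le> L * (\<bar>t\<bar> * norm e)"
        using lipschitz_onD[OF lip, of "x + t *\<^sub>R e" x] by (simp add: dist_norm)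
      then show "\<bar>(f (x + t *\<^sub>R e) - f x) / t\<bar> \<le> L * norm e"
        using lip by (cases "t = 0") (auto simp: field_simps lipschitz_on_def)
    next
      fix \<alpha> \<beta> :: real assume "\<alpha> \<in> \<rat>" "\<beta> \<in> \<rat>" "\<alpha> < \<beta>"
      then have "(\<alpha>,\<beta>) \<in> I" by (auto simp: I_def)
      then have "x \<notin> A (\<alpha>,\<beta>)" using nx by blast
      then show "\<not> slope_gap (\<lambda>t. (f (x + t *\<^sub>R e) - f x) / t) \<alpha> \<beta>"
        unfolding A_def by auto
    qed
    with x show False by blast
  qed
  ultimately show ?thesis by (rule negligible_subset)
qed

text \<open>Off a null set all partial derivatives exist at \<open>z\<close>. The points where they are uniformly close to a
fixed vector \<open>q\<close> on a fixed scale form one of countably many sets \<open>E\<close>, and almost every point of \<open>E\<close>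
is not porous for \<open>E\<close>. At such a point go from \<open>z\<close> to \<open>z + h\<close> along the coordinate directions: each
corner of the path is close to a point of \<open>E\<close>, where the next coordinate step is controlled by \<open>q\<close>, and
the Lipschitz bound pays for replacing the corner by that point.\<close>

lemma negligible_not_approx_affine:
  fixes f :: "'a::euclidean_space \<Rightarrow> real"
  assumes lip: "L-lipschitz_on UNIV f" and tau: "\<tau> > 0"
  shows "negligible {z. \<not> (\<exists>A. \<exists>d>0. \<forall>h. norm h < d \<longrightarrow> \<bar>f (z + h) - f z - A \<bullet> h\<bar> \<le> \<tau> * norm h)}" (is "negligible ?Z")
proof -
  have L: "L \<ge> 0" using lip by (simp add: lipschitz_on_def)
  have fl: "\<bar>f x - f y\<bar> \<le> L * norm (x - y)" for x y using lipschitz_onD[OF lip, of x y] by (simp add: dist_norm)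
  \<comment> \<open>each of the \<open>DIM('a)\<close> coordinate steps contributes an error of \<open>(1 + 2 L) \<epsilon> \<bar>h\<bar>\<close>\<close>
  define \<epsilon> where "\<epsilon> = min 1 (\<tau> / (DIM('a) * (1 + 2 * L)))"
  have e: "0 < \<epsilon>" "\<epsilon> \<le> 1" unfolding \<epsilon>_def using tau L by (auto intro!: divide_pos_pos mult_pos_pos)
  have e2: "DIM('a) * ((1 + 2 * L) * \<epsilon>) \<le> \<tau>"
  proof -
    have "DIM('a) * (1 + 2 * L) > 0" using L by (intro mult_pos_pos) auto
    moreover have "\<epsilon> \<le> \<tau> / (DIM('a) * (1 + 2 * L))" by (simp add: \<epsilon>_def)
    ultimately show ?thesis by (simp add: pos_le_divide_eq mult_ac)
  qed
  define N where "N b = {x. \<not> (\<exists>l. ((\<lambda>t. (f (x + t *\<^sub>R b) - f x) / t) \<longlongrightarrow> l) (at 0))}" for b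
  obtain D :: "'a set" where D: "countable D" "\<And>X. open X \<Longrightarrow> X \<noteq> {} \<Longrightarrow> \<exists>d\<in>D. d \<in> X"
    using countable_dense_exists by blast
  define E where "E = (\<lambda>(q, k::nat). {z. \<forall>b\<in>Basis. \<forall>t. \<bar>t\<bar> < 1 / Suc k \<longrightarrow> \<bar>f (z + t *\<^sub>R b) - f z - (q \<bullet> b) * t\<bar> \<le> \<epsilon> * \<bar>t\<bar>})"
  define P where "P i = {z\<in>E i. \<forall>d>0. \<exists>w. 0 < dist w z \<and> dist w z < d \<and> ball w (\<epsilon> * dist w z) \<inter> E i = {}}" for i
  let ?I = "D \<times> (UNIV::nat set)"
  have "negligible ((\<Union>b\<in>Basis. N b) \<union> (\<Union>i\<in>?I. P i))"
  proof (rule negligible_Un)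
    show "negligible (\<Union>b\<in>Basis. N b)"
      unfolding N_def using negligible_no_directional_derivative[OF lip]
      by (intro negligible_countable_Union) (blast intro: countable_finite finite_imageI finite_Basis)+
    show "negligible (\<Union>i\<in>?I. P i)"
    proof (rule negligible_countable_Union)
      have "negligible (P i)" for i unfolding P_def by (rule negligible_porous[OF e])
      then show "negligible S" if "S \<in> P ` ?I" for S using that by blast
    qed (use D in auto)
  qed
  moreover have "?Z \<subseteq> (\<Union>b\<in>Basis. N b) \<union> (\<Union>i\<in>?I. P i)"
  proof (rule subsetI, rule ccontr)
    fix z assume z: "z \<in> ?Z" and nz: "z \<notin> (\<Union>b\<in>Basis. N b) \<union> (\<Union>i\<in>?I. P i)"
    have "\<forall>b\<in>Basis. \<exists>l. ((\<lambda>t. (f (z + t *\<^sub>R b) - f z) / t) \<longlongrightarrow> l) (at 0)" using nz unfolding N_def by blast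
    from bchoice[OF this] obtain l where l: "\<And>b. b \<in> Basis \<Longrightarrow> ((\<lambda>t. (f (z + t *\<^sub>R b) - f z) / t) \<longlongrightarrow> l b) (at 0)" by blast
    define v where "v = (\<Sum>b\<in>Basis. l b *\<^sub>R b)"
    have vb: "v \<bullet> b = l b" if "b \<in> Basis" for b using that by (simp add: v_def)
    obtain q where q: "q \<in> D" "q \<in> ball v (\<epsilon> / 2)" using D(2)[of "ball v (\<epsilon>/2)"] e by auto
    have qb: "\<bar>q \<bullet> b - l b\<bar> < \<epsilon> / 2" if "b \<in> Basis" for b
    proof -
      have "\<bar>(q - v) \<bullet> b\<bar> \<le> norm (q - v)" using that by (rule Basis_le_norm)
      then show ?thesis using q vb[OF that] by (simp add: inner_diff_left dist_norm norm_minus_commute)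
    qed
    have "\<forall>b\<in>Basis. \<exists>d>0. \<forall>t. t \<noteq> 0 \<and> \<bar>t\<bar> < d \<longrightarrow> \<bar>(f (z + t *\<^sub>R b) - f z) / t - l b\<bar> < \<epsilon> / 2"
      using l e unfolding LIM_eq real_norm_def diff_zero by (meson half_gt_zero)
    then obtain d where d: "\<And>b. b \<in> Basis \<Longrightarrow> d b > 0"
       "\<And>b t. b \<in> Basis \<Longrightarrow> t \<noteq> 0 \<Longrightarrow> \<bar>t\<bar> < d b \<Longrightarrow> \<bar>(f (z + t *\<^sub>R b) - f z) / t - l b\<bar> < \<epsilon> / 2" by metis
    have "Min (d ` Basis) > 0" using d by (subst Min_gr_iff) auto
    then obtain k where k: "1 / Suc k < Min (d ` Basis)" using nat_approx_posE by blast
    have kd: "1 / Suc k < d b" if "b \<in> Basis" for b using k that by (subst (asm) Min_gr_iff) auto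
    have zE: "z \<in> E (q, k)"
      unfolding E_def
    proof (clarsimp)
      fix b :: 'a and t :: real assume b: "b \<in> Basis" and t: "\<bar>t\<bar> < 1 / (1 + real k)"
      show "\<bar>f (z + t *\<^sub>R b) - f z - (q \<bullet> b) * t\<bar> \<le> \<epsilon> * \<bar>t\<bar>"
      proof (cases "t = 0")
        case False
        have "\<bar>(f (z + t *\<^sub>R b) - f z) / t - q \<bullet> b\<bar> \<le> \<epsilon>"
        proof -
          have "\<bar>t\<bar> < d b" using t kd[OF b] by simp
          from d(2)[OF b False this] qb[OF b] show ?thesis by linarith
        qed
        then have "\<bar>(f (z + t *\<^sub>R b) - f z) / t - q \<bullet> b\<bar> * \<bar>t\<bar> \<le> \<epsilon> * \<bar>t\<bar>" by (rule mult_right_mono) auto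
        moreover have "((f (z + t *\<^sub>R b) - f z) / t - q \<bullet> b) * t = f (z + t *\<^sub>R b) - f z - (q \<bullet> b) * t"
          using False by (subst left_diff_distrib) simp
        ultimately show ?thesis by (simp only: abs_mult[symmetric])
      qed simp
    qed
    have "z \<notin> P (q, k)" using nz q by blast
    then obtain r where r: "r > 0" "\<And>w. 0 < dist w z \<Longrightarrow> dist w z < r \<Longrightarrow> ball w (\<epsilon> * dist w z) \<inter> E (q, k) \<noteq> {}"
      using zE unfolding P_def by blast
    have "\<bar>f (z + h) - f z - q \<bullet> h\<bar> \<le> \<tau> * norm h" if h: "norm h < min r (1 / Suc k)" for h
    proof -
      \<comment> \<open>the path that runs through the coordinate directions in \<open>S\<close>, for growing \<open>S\<close>\<close>
      have main: "\<bar>f (z + (\<Sum>b\<in>S. (h \<bullet> b) *\<^sub>R b)) - f z - (\<Sum>b\<in>S. (q \<bullet> b) * (h \<bullet> b))\<bar> \<le> card S * ((1 + 2 * L) * \<epsilon> * norm h)"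
        if "S \<subseteq> Basis" for S
        using finite_subset[OF that finite_Basis] that
      proof (induction S rule: finite_induct)
        case (insert b S)
        define w where "w = z + (\<Sum>b\<in>S. (h \<bullet> b) *\<^sub>R b)"
        define t where "t = h \<bullet> b"
        have b: "b \<in> Basis" using insert by auto
        have tn: "\<bar>t\<bar> \<le> norm h" unfolding t_def by (rule Basis_le_norm[OF b])
        have wz: "norm (w - z) \<le> norm h"
        proof (rule norm_le_componentwise)
          fix c :: 'a assume c: "c \<in> Basis"
          have "(w - z) \<bullet> c = (\<Sum>b\<in>S. if b = c then h \<bullet> b else 0)"
            unfolding w_def using insert.prems c by (auto simp: inner_sum_left inner_Basis intro!: sum.cong)
          also have "\<dots> = (if c \<in> S then h \<bullet> c else 0)" using insert.hyps by (simp add: sum.delta)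
          finally show "\<bar>(w - z) \<bullet> c\<bar> \<le> \<bar>h \<bullet> c\<bar>" by auto
        qed
        \<comment> \<open>at the start \<open>w = z\<close>, where the absence of pores says nothing but \<open>z\<close> itself lies in \<open>E\<close>\<close>
        obtain w' where w': "w' \<in> E (q, k)" "norm (w - w') \<le> \<epsilon> * norm h"
        proof (cases "w = z")
          case True
          then show ?thesis using that[of z] zE e by auto
        next
          case False
          then have "ball w (\<epsilon> * dist w z) \<inter> E (q, k) \<noteq> {}" using wz h r(2)[of w] by (auto simp: dist_norm)
          then obtain w' where "w' \<in> E (q,k)" "dist w w' < \<epsilon> * dist w z" by auto
          moreover have "\<epsilon> * dist w z \<le> \<epsilon> * norm h" using wz e by (simp add: dist_norm)
          ultimately show ?thesis using that[of w'] by (simp add: dist_norm)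
        qed
        have "\<bar>t\<bar> < 1 / Suc k" using tn h by auto
        then have 1: "\<bar>f (w' + t *\<^sub>R b) - f w' - (q \<bullet> b) * t\<bar> \<le> \<epsilon> * \<bar>t\<bar>"
          using w'(1) b unfolding E_def by auto
        have "\<epsilon> * \<bar>t\<bar> \<le> \<epsilon> * norm h" using tn e by simp
        with 1 have 1: "\<bar>f (w' + t *\<^sub>R b) - f w' - (q \<bullet> b) * t\<bar> \<le> \<epsilon> * norm h" by linarith
        have Lw: "L * norm (w - w') \<le> L * (\<epsilon> * norm h)" using w'(2) L by (rule mult_left_mono)
        have 2: "\<bar>f w - f w'\<bar> \<le> L * (\<epsilon> * norm h)" using fl[of w w'] Lw by linarith
        have "\<bar>f (w + t *\<^sub>R b) - f (w' + t *\<^sub>R b)\<bar> \<le> L * norm (w - w')"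
          using fl[of "w + t *\<^sub>R b" "w' + t *\<^sub>R b"] by simp
        then have 3: "\<bar>f (w + t *\<^sub>R b) - f (w' + t *\<^sub>R b)\<bar> \<le> L * (\<epsilon> * norm h)" using Lw by linarith
        have IH: "\<bar>f w - f z - (\<Sum>b\<in>S. (q \<bullet> b) * (h \<bullet> b))\<bar> \<le> card S * ((1 + 2 * L) * \<epsilon> * norm h)"
          unfolding w_def using insert.IH insert.prems by auto
        have e1: "z + (\<Sum>b\<in>insert b S. (h \<bullet> b) *\<^sub>R b) = w + t *\<^sub>R b"
          unfolding w_def t_def using insert.hyps by (simp add: algebra_simps)
        have e2: "(\<Sum>b\<in>insert b S. (q \<bullet> b) * (h \<bullet> b)) = (\<Sum>b\<in>S. (q \<bullet> b) * (h \<bullet> b)) + (q \<bullet> b) * t"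
          unfolding t_def using insert.hyps by simp
        have e3: "real (card (insert b S)) * ((1 + 2 * L) * \<epsilon> * norm h)
            = card S * ((1 + 2 * L) * \<epsilon> * norm h) + \<epsilon> * norm h + 2 * (L * (\<epsilon> * norm h))"
          using insert.hyps by (simp add: algebra_simps)
        show ?case unfolding e1 e2 e3 using 1 2 3 IH by linarith
      qed simp
      have "\<bar>f (z + h) - f z - q \<bullet> h\<bar> \<le> DIM('a) * ((1 + 2 * L) * \<epsilon> * norm h)"
        using main[of Basis] by (simp add: euclidean_representation euclidean_inner[of q h])
      also have "\<dots> = DIM('a) * ((1 + 2 * L) * \<epsilon>) * norm h" by simp
      also have "\<dots> \<le> \<tau> * norm h" using e2 by (rule mult_right_mono) auto
      finally show ?thesis .
    qed
    moreover have "min r (1 / Suc k) > 0" using r by auto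
    ultimately have "\<exists>A. \<exists>d>0. \<forall>h. norm h < d \<longrightarrow> \<bar>f (z + h) - f z - A \<bullet> h\<bar> \<le> \<tau> * norm h" by blast
    then show False using z by blast
  qed
  ultimately show ?thesis by (rule negligible_subset)
qed

text \<open>Two slopes that approximate with errors \<open>1/(i+1)\<close> and \<open>1/(j+1)\<close> differ by at most the sum of these errors, so they converge to
a derivative.\<close>

lemma differentiable_if_approx_affine:
  fixes f :: "'a::euclidean_space \<Rightarrow> real"
  assumes "\<And>\<tau>. \<tau> \<in> range (\<lambda>j::nat. 1 / Suc j) \<Longrightarrow> \<exists>A. \<exists>d>0. \<forall>h. norm h < d \<longrightarrow> \<bar>f (z + h) - f z - A \<bullet> h\<bar> \<le> \<tau> * norm h"
  shows "f differentiable (at z)"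
proof -
  have "\<forall>j. \<exists>A. \<exists>d>0. \<forall>h. norm h < d \<longrightarrow> \<bar>f (z + h) - f z - A \<bullet> h\<bar> \<le> 1 / Suc j * norm h" using assms by blast
  then obtain A d where Ad: "\<And>j. d j > 0" "\<And>j h. norm h < d j \<Longrightarrow> \<bar>f (z + h) - f z - A j \<bullet> h\<bar> \<le> 1 / Suc j * norm h" by metis
  have close: "norm (A i - A j) \<le> 1 / Suc i + 1 / Suc j" for i j
  proof (cases "A i = A j")
    case False
    define D where "D = A i - A j"
    have nD: "norm D > 0" using False by (simp add: D_def)
    define s where "s = min (d i) (d j) / (2 * norm D)"
    have s: "s > 0" unfolding s_def using nD Ad by auto
    have ns: "norm (s *\<^sub>R D) = min (d i) (d j) / 2" using nD Ad(1)[of i] Ad(1)[of j] by (simp add: s_def abs_of_nonneg)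
    have "norm (s *\<^sub>R D) < d i" "norm (s *\<^sub>R D) < d j" unfolding ns using Ad(1)[of i] Ad(1)[of j] by linarith+
    from Ad(2)[OF this(1)] Ad(2)[OF this(2)]
    have "\<bar>D \<bullet> (s *\<^sub>R D)\<bar> \<le> (1 / Suc i + 1 / Suc j) * norm (s *\<^sub>R D)"
      unfolding D_def by (simp add: algebra_simps inner_diff_left) 
    moreover have "\<bar>D \<bullet> (s *\<^sub>R D)\<bar> = s * norm D * norm D" using s by (simp add: dot_square_norm power2_eq_square)
    moreover have "(1 / Suc i + 1 / Suc j) * norm (s *\<^sub>R D) = s * norm D * (1 / Suc i + 1 / Suc j)" using s by simp
    ultimately have "s * norm D * norm D \<le> s * norm D * (1 / Suc i + 1 / Suc j)" by (simp only:)
    then show ?thesis using s nD unfolding D_def[symmetric] by (subst (asm) mult_le_cancel_left_pos) auto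
  qed simp
  have "Cauchy A"
    unfolding Cauchy_altdef2
  proof (intro allI impI)
    fix e :: real assume e: "e > 0"
    then obtain N where N: "1 / Suc N < e / 2" using nat_approx_posE[of "e/2"] by auto
    have "dist (A n) (A N) < e" if "n \<ge> N" for n
    proof -
      have "1 / Suc n \<le> 1 / Suc N" using that by (simp add: frac_le)
      then show ?thesis using close[of n N] N by (simp add: dist_norm)
    qed
    then show "\<exists>N. \<forall>n\<ge>N. dist (A n) (A N) < e" by blast
  qed
  then obtain B where B: "A \<longlonglongrightarrow> B" using Cauchy_convergent_iff convergent_def by blast
  have cB: "norm (A j - B) \<le> 1 / Suc j" for j
  proof (rule LIMSEQ_le)
    show "(\<lambda>i. norm (A j - A i)) \<longlonglongrightarrow> norm (A j - B)" by (intro tendsto_intros B)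
    show "(\<lambda>i. 1 / Suc j + 1 / Suc i) \<longlonglongrightarrow> 1 / Suc j"
      using tendsto_add[OF tendsto_const LIMSEQ_inverse_real_of_nat, of "1 / Suc j"] by (simp add: inverse_eq_divide)
  qed (use close in auto)
  have "(f has_derivative (\<lambda>h. B \<bullet> h)) (at z)"
    unfolding has_derivative_at_alt
  proof (intro conjI allI impI)
    show "bounded_linear ((\<bullet>) B)" by (rule bounded_linear_inner_right)
    fix e :: real assume e: "e > 0"
    then obtain j where j: "1 / Suc j < e / 2" using nat_approx_posE[of "e/2"] by auto
    show "\<exists>d>0. \<forall>y. norm (y - z) < d \<longrightarrow> norm (f y - f z - B \<bullet> (y - z)) \<le> e * norm (y - z)"
    proof (intro exI[of _ "d j"] conjI allI impI Ad(1))
      fix y assume y: "norm (y - z) < d j"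
      have 1: "\<bar>f y - f z - A j \<bullet> (y - z)\<bar> \<le> 1 / Suc j * norm (y - z)" using Ad(2)[OF y] by simp
      have "\<bar>(A j - B) \<bullet> (y - z)\<bar> \<le> norm (A j - B) * norm (y - z)" by (rule Cauchy_Schwarz_ineq2)
      also have "\<dots> \<le> 1 / Suc j * norm (y - z)" by (rule mult_right_mono[OF cB]) auto
      finally have 2: "\<bar>A j \<bullet> (y - z) - B \<bullet> (y - z)\<bar> \<le> 1 / Suc j * norm (y - z)" by (simp add: inner_diff_left)
      have "1 / Suc j * norm (y - z) \<le> e / 2 * norm (y - z)" by (rule mult_right_mono) (use j in auto)
      then show "norm (f y - f z - B \<bullet> (y - z)) \<le> e * norm (y - z)" using 1 2 unfolding real_norm_def by linarith
    qed
  qed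
  then show ?thesis unfolding differentiable_def by blast
qed

theorem rademacher:
  fixes f :: "'a::euclidean_space \<Rightarrow> 'b::euclidean_space"
  assumes lip: "L-lipschitz_on UNIV f"
  shows "negligible {z. \<not> f differentiable (at z)}"
proof -
  define Z where "Z i j = {z. \<not> (\<exists>A. \<exists>d>0. \<forall>h. norm h < d \<longrightarrow> \<bar>f (z + h) \<bullet> i - f z \<bullet> i - A \<bullet> h\<bar> \<le> 1 / Suc j * norm h)}" for i :: 'b and j :: nat
  have lipi: "L-lipschitz_on UNIV (\<lambda>x. f x \<bullet> i)" if i: "i \<in> Basis" for i
  proof (rule lipschitz_onI)
    fix x y
    have "dist (f x \<bullet> i) (f y \<bullet> i) \<le> dist (f x) (f y)"
      using Basis_le_norm[OF i, of "f x - f y"] by (simp add: dist_norm inner_diff_left)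
    also have "\<dots> \<le> L * dist x y" by (rule lipschitz_onD[OF lip]) auto
    finally show "dist (f x \<bullet> i) (f y \<bullet> i) \<le> L * dist x y" .
  qed (use lip in \<open>auto simp: lipschitz_on_def\<close>)
  have "negligible (\<Union>i\<in>Basis. \<Union>j. Z i j)"
  proof (rule negligible_countable_Union)
    fix S assume "S \<in> (\<lambda>i. \<Union>j. Z i j) ` Basis"
    then obtain i where i: "i \<in> Basis" "S = (\<Union>j. Z i j)" by blast
    have "negligible (Z i j)" for j unfolding Z_def by (rule negligible_not_approx_affine[OF lipi[OF i(1)]]) simp
    then show "negligible S" unfolding i(2) by (intro negligible_countable_Union) auto
  qed (simp add: countable_finite)
  moreover have "{z. \<not> f differentiable (at z)} \<subseteq> (\<Union>i\<in>Basis. \<Union>j. Z i j)"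
  proof (rule subsetI, rule ccontr)
    fix z assume z: "z \<in> {z. \<not> f differentiable (at z)}" and nz: "z \<notin> (\<Union>i\<in>Basis. \<Union>j. Z i j)"
    have "(\<lambda>x. f x \<bullet> i) differentiable (at z)" if "i \<in> Basis" for i
      by (rule differentiable_if_approx_affine) (use nz that in \<open>auto simp: Z_def\<close>)
    then have "f differentiable (at z)" by (subst differentiable_componentwise_within) auto
    then show False using z by blast
  qed
  ultimately show ?thesis by (rule negligible_subset)
qed

section \<open>Smooth cut-offs of boxes\<close>

text \<open>For \<open>p = 1\<close> this is the classical function \<open>exp (-1/t)\<close>, extended by zero. The polynomial in \<open>1/t\<close> makes
the family closed under differentiation.\<close>

definition exp_cutoff :: "real poly \<Rightarrow> real \<Rightarrow> real" where
  "exp_cutoff p t = (if t > 0 then poly p (1 / t) * exp (- 1 / t) else 0)"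

lemma tendsto_poly_mult_exp_neg: "((\<lambda>x. poly q x * exp (- x)) \<longlongrightarrow> (0::real)) at_top"
proof -
  have "((\<lambda>x. \<Sum>i\<le>degree q. coeff q i * (x ^ i / exp x)) \<longlongrightarrow> (\<Sum>i\<le>degree q. coeff q i * 0)) at_top"
    by (intro tendsto_intros tendsto_power_div_exp_0)
  then show ?thesis
    by (simp add: poly_altdef exp_minus divide_inverse sum_distrib_right mult.assoc)
qed

lemma exp_cutoff_has_real_derivative:
  "(exp_cutoff p has_real_derivative exp_cutoff ([:0, 0, 1:] * (p - pderiv p)) t) (at t)"
proof -
  consider "t > 0" | "t < 0" | "t = 0" by linarith
  then show ?thesis
  proof cases
    case 1
    have "((\<lambda>t. poly p (1 / t) * exp (- 1 / t)) has_real_derivative exp_cutoff ([:0, 0, 1:] * (p - pderiv p)) t) (at t)"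
      using 1 by (auto intro!: derivative_eq_intros poly_DERIV[THEN DERIV_chain2] simp: exp_cutoff_def field_simps power2_eq_square)
    then show ?thesis
      by (rule has_field_derivative_transform_within_open[of _ _ _ "{0<..}"]) (use 1 in \<open>auto simp: exp_cutoff_def\<close>)
  next
    case 2
    have "((\<lambda>t. 0) has_real_derivative exp_cutoff ([:0, 0, 1:] * (p - pderiv p)) t) (at t)"
      using 2 by (auto simp: exp_cutoff_def)
    then show ?thesis
      by (rule has_field_derivative_transform_within_open[of _ _ _ "{..<0}"]) (use 2 in \<open>auto simp: exp_cutoff_def\<close>)
  next
    case 3
    have "((\<lambda>t. poly ([:0, 1:] * p) (inverse t) * exp (- inverse t)) \<longlongrightarrow> 0) (at_right 0)"
      by (rule filterlim_compose[OF tendsto_poly_mult_exp_neg filterlim_inverse_at_top_right])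
    then have "((\<lambda>y. (exp_cutoff p y - exp_cutoff p 0) / (y - 0)) \<longlongrightarrow> 0) (at_right 0)"
      by (rule Lim_transform_eventually)
         (auto simp: exp_cutoff_def eventually_at_filter divide_inverse)
    moreover have "((\<lambda>y. (exp_cutoff p y - exp_cutoff p 0) / (y - 0)) \<longlongrightarrow> 0) (at_left 0)"
      by (rule Lim_transform_eventually[OF tendsto_const])
         (auto simp: exp_cutoff_def eventually_at_filter)
    ultimately have "((\<lambda>y. (exp_cutoff p y - exp_cutoff p 0) / (y - 0)) \<longlongrightarrow> 0) (at 0)"
      by (simp add: filterlim_at_split)
    then show ?thesis using 3 by (simp add: has_field_derivative_iff exp_cutoff_def)
  qed
qed

text \<open>An algebra of functions that is closed under partial derivatives. All its members are therefore smooth,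
and no explicit higher derivative has to be computed.\<close>

inductive_set cutoff_algebra :: "(real^'n::finite \<Rightarrow> real) set" where
  base: "(\<lambda>x. exp_cutoff p (c * x $ i + d)) \<in> cutoff_algebra"
| const: "(\<lambda>x. c) \<in> cutoff_algebra"
| add: "f \<in> cutoff_algebra \<Longrightarrow> g \<in> cutoff_algebra \<Longrightarrow> (\<lambda>x. f x + g x) \<in> cutoff_algebra"
| mult: "f \<in> cutoff_algebra \<Longrightarrow> g \<in> cutoff_algebra \<Longrightarrow> (\<lambda>x. f x * g x) \<in> cutoff_algebra"

lemma partial_deriv_eq:
  "(f has_derivative f') (at x) \<Longrightarrow> partial_deriv i f x = f' (axis i 1)"
  unfolding partial_deriv_def by (subst frechet_derivative_at[symmetric]) auto

lemma cutoff_algebra_closed_under_derivative: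
  fixes f :: "real^'n::finite \<Rightarrow> real"
  shows "f \<in> cutoff_algebra \<Longrightarrow> f differentiable_on UNIV \<and> (\<forall>j. partial_deriv j f \<in> cutoff_algebra)"
proof (induction f rule: cutoff_algebra.induct)
  case (base p c i d)
  define p' where "p' = [:0, 0, 1:] * (p - pderiv p)"
  have der: "((\<lambda>x. exp_cutoff p (c * x $ i + d)) has_derivative (\<lambda>h. exp_cutoff p' (c * x $ i + d) * (c * h $ i))) (at x)" for x :: "real^'n"
  proof -
    have 1: "((\<lambda>x::real^'n. c * x $ i + d) has_derivative (\<lambda>h. c * h $ i)) (at x)"
      by (auto intro!: derivative_eq_intros bounded_linear_imp_has_derivative bounded_linear_vec_nth)
    have 2: "(exp_cutoff p has_derivative (\<lambda>h. exp_cutoff p' (c * x $ i + d) * h)) (at (c * x $ i + d))"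
      using exp_cutoff_has_real_derivative[of p "c * x $ i + d"] unfolding has_field_derivative_def p'_def .
    show ?thesis using has_derivative_compose[OF 1 2] by simp
  qed
  have "partial_deriv j (\<lambda>x::real^'n. exp_cutoff p (c * x $ i + d)) = (\<lambda>x. exp_cutoff p' (c * x $ i + d) * (c * axis j 1 $ i))" for j
    using partial_deriv_eq[OF der] by (intro ext) auto
  moreover have "(\<lambda>x::real^'n. exp_cutoff p' (c * x $ i + d) * (c * axis j 1 $ i)) \<in> cutoff_algebra" for j
    by (intro cutoff_algebra.intros)
  ultimately show ?case using der by (auto simp: differentiable_on_def differentiable_def intro: has_derivative_at_withinI)
next
  case (const c)
  have "partial_deriv j (\<lambda>x::real^'n. c) = (\<lambda>x. 0)" for j
    by (intro ext, subst partial_deriv_eq[OF has_derivative_const]) auto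
  then show ?case by (auto intro: cutoff_algebra.const)
next
  case (add f g)
  then have d: "(f has_derivative frechet_derivative f (at x)) (at x)" "(g has_derivative frechet_derivative g (at x)) (at x)" for x
    by (auto simp: differentiable_on_def frechet_derivative_works)
  have "partial_deriv j (\<lambda>x. f x + g x) = (\<lambda>x. partial_deriv j f x + partial_deriv j g x)" for j
    by (intro ext, subst partial_deriv_eq[OF has_derivative_add[OF d]]) (simp add: partial_deriv_def)
  then show ?case using add by (auto intro: cutoff_algebra.add)
next
  case (mult f g)
  then have d: "(f has_derivative frechet_derivative f (at x)) (at x)" "(g has_derivative frechet_derivative g (at x)) (at x)" for x
    by (auto simp: differentiable_on_def frechet_derivative_works)
  have "partial_deriv j (\<lambda>x. f x * g x) = (\<lambda>x. f x * partial_deriv j g x + partial_deriv j f x * g x)" for j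
    by (intro ext, subst partial_deriv_eq[OF has_derivative_mult[OF d]]) (simp add: partial_deriv_def)
  then show ?case using mult by (auto intro!: cutoff_algebra.add cutoff_algebra.mult)
qed

lemma Ck_cutoff_algebra: "f \<in> cutoff_algebra \<Longrightarrow> Ck k f"
proof (induction k arbitrary: f)
  case 0
  then show ?case using cutoff_algebra_closed_under_derivative differentiable_imp_continuous_on by auto
next
  case (Suc k)
  then show ?case using cutoff_algebra_closed_under_derivative[OF Suc.prems] by auto
qed

lemma cutoff_algebra_prod:
  "finite S \<Longrightarrow> (\<And>i. i \<in> S \<Longrightarrow> f i \<in> cutoff_algebra) \<Longrightarrow> (\<lambda>x. \<Prod>i\<in>S. f i x) \<in> cutoff_algebra"
  by (induction S rule: finite_induct) (auto intro: cutoff_algebra.intros)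

text \<open>The scaling \<open>exp (-1/(k t))\<close>, in place of a rescaling of the support, makes these functions converge to
the indicator of the open box while all of them are supported in its closure.\<close>

definition box_cutoff :: "nat \<Rightarrow> real^'n::finite \<Rightarrow> real^'n \<Rightarrow> real^'n \<Rightarrow> real" where
  "box_cutoff k a b x = (\<Prod>i\<in>UNIV. exp_cutoff 1 (k * x $ i + - k * a $ i) * exp_cutoff 1 (- k * x $ i + k * b $ i))"

lemma exp_cutoff_1_bounds: "0 \<le> exp_cutoff 1 t" "exp_cutoff 1 t \<le> 1" "exp_cutoff 1 t \<noteq> 0 \<longleftrightarrow> t > 0"
  by (auto simp: exp_cutoff_def)

lemma box_cutoff_bounds: "0 \<le> box_cutoff k a b x" "box_cutoff k a b x \<le> 1"
  unfolding box_cutoff_def by (auto intro!: prod_nonneg prod_le_1 mult_le_one simp: exp_cutoff_1_bounds)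

lemma box_cutoff_nz: "box_cutoff k a b x \<noteq> 0 \<Longrightarrow> x \<in> box a b"
proof -
  assume "box_cutoff k a b x \<noteq> 0"
  then have "real k * x $ i + - real k * a $ i > 0" "- real k * x $ i + real k * b $ i > 0" for i
    unfolding box_cutoff_def by (auto simp: exp_cutoff_1_bounds)
  then have "real k * a $ i < real k * x $ i \<and> real k * x $ i < real k * b $ i" for i
    by (simp add: algebra_simps)
  then show "x \<in> box a b" by (auto simp: mem_box_cart mult_less_cancel_left)
qed

lemma box_cutoff_test_function: "box_cutoff k a b \<in> test_functions UNIV"
proof -
  have "Ck j (box_cutoff k a b)" for j
    unfolding box_cutoff_def by (intro Ck_cutoff_algebra cutoff_algebra_prod cutoff_algebra.mult cutoff_algebra.base) auto
  moreover have "bounded {x. box_cutoff k a b x \<noteq> 0}"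
    by (rule bounded_subset[OF bounded_box[of a b]]) (use box_cutoff_nz in auto)
  ultimately show ?thesis unfolding test_functions_def by (auto simp: compact_closure)
qed

lemma box_cutoff_tendsto_indicator: "(\<lambda>k. box_cutoff k a b x) \<longlonglongrightarrow> indicator (box a b) x"
proof (cases "x \<in> box a b")
  case True
  have E: "(\<lambda>k. exp_cutoff 1 (real k * t)) \<longlonglongrightarrow> 1" if t: "t > 0" for t
  proof -
    have "(\<lambda>k. exp (- (1 / t) * inverse (real k))) \<longlonglongrightarrow> exp (- (1 / t) * 0)"
      by (intro tendsto_intros lim_inverse_n)
    then have "(\<lambda>k. exp (- (1 / t) * inverse (real k))) \<longlonglongrightarrow> 1" by simp
    then show ?thesis
      by (rule Lim_transform_eventually)
         (use t in \<open>auto simp: exp_cutoff_def eventually_sequentially field_simps intro!: exI[of _ 1]\<close>)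
  qed
  have "(\<lambda>k. \<Prod>i\<in>UNIV. exp_cutoff 1 (real k * (x $ i - a $ i)) * exp_cutoff 1 (real k * (b $ i - x $ i))) \<longlonglongrightarrow> (\<Prod>i\<in>(UNIV::'a set). 1 * 1)"
    by (intro tendsto_intros E) (use True in \<open>auto simp: mem_box_cart\<close>)
  then show ?thesis using True by (simp add: box_cutoff_def algebra_simps)
next
  case False
  then have "box_cutoff k a b x = 0" for k using box_cutoff_nz by blast
  then show ?thesis using False by simp
qed

text \<open>The cut-offs show that the integral over every open box vanishes. The boxes are stable under
intersection and generate the Borel sets, so the integral over every Borel set vanishes.\<close>

lemma AE_zero_if_orthogonal_to_test_functions:
  fixes F :: "real^'n::finite \<Rightarrow> real"
  assumes F: "integrable lborel F"
    and z: "\<And>\<phi>. \<phi> \<in> test_functions UNIV \<Longrightarrow> (\<integral>x. F x * \<phi> x \<partial>lborel) = 0"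
  shows "AE x in lborel. F x = 0"
proof (rule sigma_finite_measure.density_zero[OF sigma_finite_lborel F])
  have Fm[measurable]: "F \<in> borel_measurable borel" using F by auto
  have int: "integrable lborel (\<lambda>x. indicator A x * F x)" if "A \<in> sets borel" for A
    using integrable_mult_indicator[of A lborel F] F that by simp
  have box: "(\<integral>x. indicator (box a b) x * F x \<partial>lborel) = 0" for a b
  proof -
    have "(\<lambda>k. \<integral>x. F x * box_cutoff k a b x \<partial>lborel) \<longlonglongrightarrow> (\<integral>x. F x * indicator (box a b) x \<partial>lborel)"
    proof (rule integral_dominated_convergence[where w="\<lambda>x. \<bar>F x\<bar>"])
      show "integrable lborel (\<lambda>x. \<bar>F x\<bar>)" using F by simp
      have "continuous_on UNIV (box_cutoff k a b)" for k
        using box_cutoff_test_function[of k a b] unfolding test_functions_def by (auto dest: spec[of _ 0])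
      then show "(\<lambda>x. F x * box_cutoff k a b x) \<in> borel_measurable lborel" for k
        using borel_measurable_continuous_onI by (intro borel_measurable_times) auto
      show "AE x in lborel. (\<lambda>k. F x * box_cutoff k a b x) \<longlonglongrightarrow> F x * indicator (box a b) x"
        by (intro AE_I2 tendsto_intros box_cutoff_tendsto_indicator)
      show "AE x in lborel. norm (F x * box_cutoff k a b x) \<le> \<bar>F x\<bar>" for k
        using box_cutoff_bounds[of k a b] by (intro AE_I2) (auto simp: abs_mult mult_left_le)
    qed simp
    moreover have "(\<integral>x. F x * box_cutoff k a b x \<partial>lborel) = 0" for k by (rule z[OF box_cutoff_test_function])
    ultimately show ?thesis by (simp add: LIMSEQ_const_iff mult.commute)
  qed
  have tot: "(\<integral>x. F x \<partial>lborel) = 0"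
  proof -
    have "(\<lambda>k. \<integral>x. indicator (box (- real k *\<^sub>R One) (real k *\<^sub>R One)) x * F x \<partial>lborel) \<longlonglongrightarrow> (\<integral>x. F x \<partial>lborel)"
    proof (rule integral_dominated_convergence[where w="\<lambda>x. \<bar>F x\<bar>"])
      show "AE x in lborel. (\<lambda>k. indicator (box (- real k *\<^sub>R One) (real k *\<^sub>R One)) x * F x) \<longlonglongrightarrow> F x"
      proof (rule AE_I2)
        fix x :: "real^'n"
        obtain N where N: "norm x < real N" using reals_Archimedean2 by blast
        have "x \<in> box (- real k *\<^sub>R One) (real k *\<^sub>R One)" if "k \<ge> N" for k
        proof -
          have "- real k < x \<bullet> i \<and> x \<bullet> i < real k" if "i \<in> Basis" for i
            using Basis_le_norm[OF that, of x] N \<open>k \<ge> N\<close> by linarith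
          then show ?thesis by (auto simp: mem_box)
        qed
        then show "(\<lambda>k. indicator (box (- real k *\<^sub>R One) (real k *\<^sub>R One)) x * F x) \<longlonglongrightarrow> F x"
          by (intro tendsto_eventually eventually_sequentiallyI[of N]) (simp add: indicator_def)
      qed
    qed (use F in \<open>auto simp: indicator_def\<close>)
    then show ?thesis by (simp add: box LIMSEQ_const_iff)
  qed
  have "(\<integral>x. indicator A x * F x \<partial>lborel) = 0" if A: "A \<in> sigma_sets UNIV (range (\<lambda>(a, b). box a b :: (real^'n) set))" for A
  proof (rule sigma_sets_induct_disjoint[OF _ _ A])
    show "Int_stable (range (\<lambda>(a, b). box a b :: (real^'n) set))"
      by (auto simp: Int_stable_def Int_interval box_Int_box)
  next
    fix A :: "(real^'n) set" assume "A \<in> range (\<lambda>(a, b). box a b)"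
    then show "(\<integral>x. indicator A x * F x \<partial>lborel) = 0" using box by auto
  next
    fix A assume A: "A \<in> sigma_sets UNIV (range (\<lambda>(a, b). box a b :: (real^'n) set))"
      and IH: "(\<integral>x. indicator A x * F x \<partial>lborel) = 0"
    have Ab: "A \<in> sets borel" using A by (subst borel_eq_box) auto
    have "(\<integral>x. indicator (UNIV - A) x * F x \<partial>lborel) = (\<integral>x. F x - indicator A x * F x \<partial>lborel)"
      by (rule Bochner_Integration.integral_cong) (auto simp: indicator_def)
    also have "\<dots> = 0" using int[OF Ab] F tot IH by simp
    finally show "(\<integral>x. indicator (UNIV - A) x * F x \<partial>lborel) = 0" .
  next
    fix A :: "nat \<Rightarrow> (real^'n) set"
    assume dj: "disjoint_family A" and A: "range A \<subseteq> sigma_sets UNIV (range (\<lambda>(a, b). box a b :: (real^'n) set))"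
      and IH: "\<And>i. (\<integral>x. indicator (A i) x * F x \<partial>lborel) = 0"
    have Ab: "A i \<in> sets borel" for i using A by (subst borel_eq_box) auto
    have "(LINT x:(\<Union>i. A i)|lborel. F x) = (\<Sum>i. (LINT x:A i|lborel. F x))"
    proof (rule lebesgue_integral_countable_add)
      show "A i \<inter> A j = {}" if "i \<noteq> j" for i j using dj that by (auto simp: disjoint_family_on_def)
      show "set_integrable lborel (\<Union>i. A i) F" unfolding set_integrable_def
        using int[of "\<Union>i. A i"] Ab by auto
    qed (use Ab in auto)
    then show "(\<integral>x. indicator (\<Union>i. A i) x * F x \<partial>lborel) = 0"
      using IH by (simp add: set_lebesgue_integral_def)
  qed auto
  then show "set_lebesgue_integral lborel A F = 0" if "A \<in> sets lborel" for A
    using that unfolding set_lebesgue_integral_def by (subst (asm) sets_lborel, subst (asm) borel_eq_box) auto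
qed

section \<open>Sobolev functions on the whole space\<close>

lemma test_function_differentiable:
  assumes "\<phi> \<in> test_functions U"
  shows "\<phi> differentiable (at x)" "continuous_on UNIV \<phi>" "continuous_on UNIV (partial_deriv i \<phi>)"
    "\<phi> \<in> borel_measurable borel" "partial_deriv i \<phi> \<in> borel_measurable borel"
proof -
  have C: "Ck k \<phi>" for k using assms by (simp add: test_functions_def)
  show 1: "\<phi> differentiable (at x)" using C[of "Suc 0"] by (auto simp: differentiable_on_def)
  show 2: "continuous_on UNIV \<phi>" using C[of 0] by simp
  show 3: "continuous_on UNIV (partial_deriv i \<phi>)" using C[of "Suc 0"] by simp
  show "\<phi> \<in> borel_measurable borel" "partial_deriv i \<phi> \<in> borel_measurable borel"
    using 2 3 by (auto intro: borel_measurable_continuous_onI)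
qed

lemma test_function_has_derivative:
  fixes \<phi> :: "real^'n::finite \<Rightarrow> real"
  assumes "\<phi> \<in> test_functions U"
  shows "(\<phi> has_derivative (\<lambda>h. \<Sum>i\<in>UNIV. h $ i * partial_deriv i \<phi> x)) (at x)"
proof -
  have d: "(\<phi> has_derivative frechet_derivative \<phi> (at x)) (at x)"
    using test_function_differentiable(1)[OF assms] by (simp add: frechet_derivative_works)
  then have lin: "linear (frechet_derivative \<phi> (at x))" using has_derivative_linear by blast
  have "frechet_derivative \<phi> (at x) h = (\<Sum>i\<in>UNIV. h $ i * partial_deriv i \<phi> x)" for h
  proof -
    have "frechet_derivative \<phi> (at x) h = frechet_derivative \<phi> (at x) (\<Sum>i\<in>UNIV. h $ i *s axis i 1)"
      by (simp add: basis_expansion)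
    also have "\<dots> = (\<Sum>i\<in>UNIV. h $ i * partial_deriv i \<phi> x)"
      by (simp add: linear_sum[OF lin] scalar_mult_eq_scaleR linear_scale[OF lin] partial_deriv_def)
    finally show ?thesis .
  qed
  then have "frechet_derivative \<phi> (at x) = (\<lambda>h. \<Sum>i\<in>UNIV. h $ i * partial_deriv i \<phi> x)" by (rule ext)
  with d show ?thesis by simp
qed

lemma test_function_zero_outside:
  assumes "\<phi> \<in> test_functions U" "x \<notin> closure {x. \<phi> x \<noteq> 0}"
  shows "\<phi> x = 0" "partial_deriv i \<phi> x = 0"
proof -
  show "\<phi> x = 0" using assms(2) closure_subset[of "{x. \<phi> x \<noteq> 0}"] by auto
  have "((\<lambda>x. 0) has_derivative (\<lambda>h. 0)) (at x)" by simp
  then have "(\<phi> has_derivative (\<lambda>h. 0)) (at x)"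
  proof (rule has_derivative_transform_within_open)
    show "open (- closure {x. \<phi> x \<noteq> 0})" by (intro open_Compl closed_closure)
    show "x \<in> - closure {x. \<phi> x \<noteq> 0}" using assms(2) by simp
    show "0 = \<phi> y" if "y \<in> - closure {x. \<phi> x \<noteq> 0}" for y
      using that closure_subset[of "{x. \<phi> x \<noteq> 0}"] by auto
  qed
  then show "partial_deriv i \<phi> x = 0" by (subst partial_deriv_eq) auto
qed

lemma test_function_bounded:
  assumes "\<phi> \<in> test_functions U"
  obtains M where "\<And>x. \<bar>\<phi> x\<bar> \<le> M" "\<And>x i. \<bar>partial_deriv i \<phi> x\<bar> \<le> M" "M \<ge> 0"
proof -
  let ?K = "closure {x. \<phi> x \<noteq> 0}"
  have K: "compact ?K" using assms by (simp add: test_functions_def)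
  have b: "\<exists>M. \<forall>x. \<bar>g x\<bar> \<le> M" if c: "continuous_on UNIV g" and z: "\<And>x. x \<notin> ?K \<Longrightarrow> g x = (0::real)" for g
  proof -
    have "bounded (g ` ?K)" by (intro compact_imp_bounded compact_continuous_image continuous_on_subset[OF c] K) auto
    then obtain M where M: "\<And>y. y \<in> g ` ?K \<Longrightarrow> norm y \<le> M" unfolding bounded_iff by blast
    have "\<bar>g x\<bar> \<le> max M 0" for x
    proof (cases "x \<in> ?K")
      case True
      then have "norm (g x) \<le> M" using M by blast
      then show ?thesis by simp
    qed (simp add: z)
    then show ?thesis by blast
  qed
  obtain M0 where M0: "\<And>x. \<bar>\<phi> x\<bar> \<le> M0" using b[OF test_function_differentiable(2)[OF assms]] test_function_zero_outside[OF assms] by blast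
  have "\<forall>i. \<exists>M. \<forall>x. \<bar>partial_deriv i \<phi> x\<bar> \<le> M"
    using b[OF test_function_differentiable(3)[OF assms]] test_function_zero_outside[OF assms] by blast
  then obtain Mi where Mi: "\<And>i x. \<bar>partial_deriv i \<phi> x\<bar> \<le> Mi i" by metis
  have Mi0: "Mi i \<ge> 0" for i using Mi[of i undefined] by linarith
  have M00: "M0 \<ge> 0" using M0[of undefined] by linarith
  have le: "Mi i \<le> (\<Sum>i\<in>UNIV. Mi i)" for i by (rule member_le_sum) (use Mi0 in auto)
  have "(\<Sum>i\<in>UNIV. Mi i) \<ge> 0" by (intro sum_nonneg) (use Mi0 in auto)
  moreover have "\<bar>partial_deriv i \<phi> x\<bar> \<le> (\<Sum>i\<in>UNIV. Mi i)" for i x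
    using Mi[of i x] le[of i] by linarith
  ultimately show ?thesis using M0 M00
    by (intro that[of "M0 + (\<Sum>i\<in>UNIV. Mi i)"]) (auto intro: add_increasing add_increasing2)
qed

lemma has_derivative_translate:
  assumes "(\<phi> has_derivative f') (at (x - c))"
  shows "((\<lambda>x. \<phi> (x - c)) has_derivative f') (at x)"
proof -
  have "((\<lambda>x. x - c) has_derivative (\<lambda>h. h)) (at x)" by (auto intro!: derivative_eq_intros)
  from has_derivative_compose[OF this assms] show ?thesis by simp
qed

lemma Ck_translate: "Ck k \<phi> \<Longrightarrow> Ck k (\<lambda>x. \<phi> (x - c))"
proof (induction k arbitrary: \<phi>)
  case 0
  then show ?case by (auto intro!: continuous_intros continuous_on_compose2[of UNIV \<phi>])
next
  case (Suc k)
  have d: "(\<phi> has_derivative frechet_derivative \<phi> (at x)) (at x)" for x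
    using Suc.prems by (auto simp: differentiable_on_def frechet_derivative_works)
  have "partial_deriv i (\<lambda>x. \<phi> (x - c)) = (\<lambda>x. partial_deriv i \<phi> (x - c))" for i
    by (intro ext, subst partial_deriv_eq[OF has_derivative_translate[OF d]]) (simp add: partial_deriv_def)
  moreover have "(\<lambda>x. \<phi> (x - c)) differentiable_on UNIV"
    using has_derivative_translate[OF d] by (auto simp: differentiable_on_def differentiable_def)
  ultimately show ?case using Suc by auto
qed

lemma test_function_translate:
  fixes \<phi> :: "real^'n::finite \<Rightarrow> real"
  assumes p: "\<phi> \<in> test_functions UNIV"
  shows "(\<lambda>x. \<phi> (x - c)) \<in> test_functions UNIV" "partial_deriv i (\<lambda>x. \<phi> (x - c)) x = partial_deriv i \<phi> (x - c)"
proof -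
  have "bounded {x. \<phi> x \<noteq> 0}"
    using p bounded_subset[OF compact_imp_bounded closure_subset] unfolding test_functions_def by blast
  then have "bounded ((+) c ` {x. \<phi> x \<noteq> 0})" by (rule bounded_translation)
  moreover have "{x. \<phi> (x - c) \<noteq> 0} \<subseteq> (+) c ` {x. \<phi> x \<noteq> 0}" by (auto intro!: image_eqI[of _ _ "_ - c"])
  ultimately have "bounded {x. \<phi> (x - c) \<noteq> 0}" by (rule bounded_subset)
  then show "(\<lambda>x. \<phi> (x - c)) \<in> test_functions UNIV"
    using p Ck_translate by (auto simp: test_functions_def compact_closure)
  have "(\<Sum>j\<in>UNIV. axis i 1 $ j * F j) = F i" for F :: "'n \<Rightarrow> real"
    by (subst sum.mono_neutral_cong_right[of UNIV "{i}" _ F]) (auto simp: axis_def)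
  then show "partial_deriv i (\<lambda>x. \<phi> (x - c)) x = partial_deriv i \<phi> (x - c)"
    by (subst partial_deriv_eq[OF has_derivative_translate[OF test_function_has_derivative[OF p]]])
qed

lemma lborel_integral_translate:
  fixes f :: "'a::euclidean_space \<Rightarrow> real"
  assumes [measurable]: "f \<in> borel_measurable borel"
  shows "(\<integral>x. f (x + c) \<partial>lborel) = (\<integral>x. f x \<partial>lborel)"
    "integrable lborel (\<lambda>x. f (x + c)) \<longleftrightarrow> integrable lborel f"
proof -
  have "(\<integral>x. f x \<partial>lborel) = (\<integral>x. f x \<partial>distr lborel borel ((+) c))" by (simp add: lborel_distr_plus)
  also have "\<dots> = (\<integral>x. f (c + x) \<partial>lborel)" by (rule integral_distr) auto
  finally show "(\<integral>x. f (x + c) \<partial>lborel) = (\<integral>x. f x \<partial>lborel)" by (simp add: add.commute)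
  have "integrable lborel f \<longleftrightarrow> integrable (distr lborel borel ((+) c)) f" by (simp add: lborel_distr_plus)
  also have "\<dots> \<longleftrightarrow> integrable lborel (\<lambda>x. f (c + x))" by (rule integrable_distr_eq) auto
  finally show "integrable lborel (\<lambda>x. f (x + c)) \<longleftrightarrow> integrable lborel f" by (simp add: add.commute)
qed

lemma integrable_mult_bounded:
  fixes f b :: "'a \<Rightarrow> real"
  assumes f: "integrable M f" and [measurable]: "b \<in> borel_measurable M" and B: "\<And>x. \<bar>b x\<bar> \<le> B"
  shows "integrable M (\<lambda>x. f x * b x)"
proof -
  have "integrable M (\<lambda>x. B * f x)" using f by simp
  then show ?thesis
  proof (rule Bochner_Integration.integrable_bound)
    show "(\<lambda>x. f x * b x) \<in> borel_measurable M" using f by measurable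
    have "\<bar>f x\<bar> * \<bar>b x\<bar> \<le> \<bar>B\<bar> * \<bar>f x\<bar>" for x
      using mult_left_mono[of "\<bar>b x\<bar>" "\<bar>B\<bar>" "\<bar>f x\<bar>"] B[of x] by (simp add: mult.commute)
    then show "AE x in M. norm (f x * b x) \<le> norm (B * f x)" by (simp add: abs_mult)
  qed
qed

lemma integrable_pair_unit_interval:
  fixes f :: "'a::euclidean_space \<Rightarrow> real"
  assumes f: "integrable lborel f"
  shows "integrable (lborel \<Otimes>\<^sub>M lborel) (\<lambda>(x, t). f x * indicator {0..1::real} t)"
proof -
  have [measurable]: "f \<in> borel_measurable borel" using f by auto
  show ?thesis
  proof (rule lborel_pair.Fubini_integrable)
    show "integrable lborel (\<lambda>x. LINT y|lborel. norm (case (x, y) of (x, t) \<Rightarrow> f x * indicator {0..1::real} t))"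
      using f by (simp add: abs_mult)
  qed auto
qed

text \<open>The fundamental theorem of calculus for a weak gradient. Tested against \<open>\<phi>\<close>, both sides agree:
move the translation to \<open>\<phi>\<close>, apply the fundamental theorem of calculus to \<open>\<phi>\<close> along \<open>h\<close>, and use
the definition of the weak gradient for each translate of \<open>\<phi>\<close>.\<close>

lemma weak_gradient_translate:
  fixes v :: "real^'n::finite \<Rightarrow> real" and g :: "real^'n \<Rightarrow> real^'n"
  assumes v: "integrable lborel v" and g: "integrable lborel g"
    and weak: "\<And>\<phi> i. \<phi> \<in> test_functions UNIV \<Longrightarrow> (\<integral>x. v x * partial_deriv i \<phi> x \<partial>lborel) = - (\<integral>x. g x $ i * \<phi> x \<partial>lborel)"
  shows "AE x in lborel. v (x + h) - v x = (\<integral>t. indicator {0..1} t * (g (x + t *\<^sub>R h) \<bullet> h) \<partial>lborel)"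
proof -
  have [measurable]: "v \<in> borel_measurable borel" "g \<in> borel_measurable borel" using v g by auto
  have gh: "integrable lborel (\<lambda>x. g x \<bullet> h)" using g by simp
  define G where "G x = (\<integral>t. indicator {0..1::real} t * (g (x + t *\<^sub>R h) \<bullet> h) \<partial>lborel)" for x
  have pairint: "integrable (lborel \<Otimes>\<^sub>M lborel) (\<lambda>(x, t). (g (x + t *\<^sub>R h) \<bullet> h) * indicator {0..1::real} t)"
  proof (subst lborel_pair.integrable_product_swap_iff[symmetric], rule lborel_pair.Fubini_integrable)
    have *: "(\<integral>x. \<bar>g (x + t *\<^sub>R h) \<bullet> h\<bar> \<partial>lborel) = (\<integral>x. \<bar>g x \<bullet> h\<bar> \<partial>lborel)" for t
      by (rule lborel_integral_translate) measurable
    show "integrable lborel (\<lambda>t. \<integral>x. norm (case (t, x) of (t, x) \<Rightarrow> case (x, t) of (x, t) \<Rightarrow> (g (x + t *\<^sub>R h) \<bullet> h) * indicator {0..1::real} t) \<partial>lborel)"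
      by (simp add: abs_mult *)
    show "AE t in lborel. integrable lborel (\<lambda>x. case (t, x) of (t, x) \<Rightarrow> case (x, t) of (x, t) \<Rightarrow> (g (x + t *\<^sub>R h) \<bullet> h) * indicator {0..1::real} t)"
      using gh by (auto simp: lborel_integral_translate(2)[of "\<lambda>x. g x \<bullet> h"])
  qed measurable
  have Gint: "integrable lborel G"
    using lborel_pair.integrable_fst'[OF pairint] unfolding G_def by (simp add: mult.commute)
  have vint: "integrable lborel (\<lambda>x. v (x + h))" using v by (simp add: lborel_integral_translate)
  have "AE x in lborel. v (x + h) - v x - G x = 0"
  proof (rule AE_zero_if_orthogonal_to_test_functions)
    show "integrable lborel (\<lambda>x. v (x + h) - v x - G x)" using Gint vint v by simp
    fix \<phi> :: "real^'n \<Rightarrow> real" assume p: "\<phi> \<in> test_functions UNIV"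
    obtain M where M: "\<And>x. \<bar>\<phi> x\<bar> \<le> M" "\<And>x i. \<bar>partial_deriv i \<phi> x\<bar> \<le> M" "M \<ge> 0"
      using test_function_bounded[OF p] by blast
    note [measurable] = test_function_differentiable(4,5)[OF p]
    define D where "D x = (\<Sum>i\<in>UNIV. h $ i * partial_deriv i \<phi> x)" for x
    have [measurable]: "D \<in> borel_measurable borel" unfolding D_def by measurable
    have Dc: "continuous_on UNIV D" unfolding D_def
      by (intro continuous_intros test_function_differentiable(3)[OF p])
    define B where "B = (\<Sum>i\<in>UNIV. \<bar>h $ i\<bar> * M)"
    have DB: "\<bar>D x\<bar> \<le> B" for x unfolding D_def B_def
      by (rule order_trans[OF sum_abs]) (auto simp: abs_mult intro!: sum_mono mult_left_mono M)
    have ftc: "\<phi> (x - h) - \<phi> x = (\<integral>t. indicator {0..1} t * - D (x - t *\<^sub>R h) \<partial>lborel)" for x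
    proof -
      have der: "((\<lambda>t. \<phi> (x - t *\<^sub>R h)) has_vector_derivative - D (x - t *\<^sub>R h)) (at t within {0..1})" for t
      proof -
        have 1: "((\<lambda>t. x - t *\<^sub>R h) has_derivative (\<lambda>s. - (s *\<^sub>R h))) (at t within {0..1})"
          by (auto intro!: derivative_eq_intros)
        have "((\<lambda>t. \<phi> (x - t *\<^sub>R h)) has_derivative (\<lambda>s. \<Sum>i\<in>UNIV. (- (s *\<^sub>R h)) $ i * partial_deriv i \<phi> (x - t *\<^sub>R h))) (at t within {0..1})"
          by (rule has_derivative_compose[OF 1 test_function_has_derivative[OF p]])
        moreover have "(\<Sum>i\<in>UNIV. (- (s *\<^sub>R h)) $ i * partial_deriv i \<phi> (x - t *\<^sub>R h)) = s *\<^sub>R - D (x - t *\<^sub>R h)" for s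
          by (simp add: D_def sum_distrib_left sum_negf mult.assoc)
        ultimately show ?thesis unfolding has_vector_derivative_def by simp
      qed
      have "(\<integral>t. indicator {0..1} t *\<^sub>R - D (x - t *\<^sub>R h) \<partial>lborel) = \<phi> (x - 1 *\<^sub>R h) - \<phi> (x - 0 *\<^sub>R h)"
        by (rule integral_FTC_atLeastAtMost[OF _ der])
           (auto intro!: continuous_intros continuous_on_compose2[OF Dc])
      then show ?thesis by simp
    qed
    have wk: "(\<integral>x. v x * D (x - t *\<^sub>R h) \<partial>lborel) = - (\<integral>x. (g x \<bullet> h) * \<phi> (x - t *\<^sub>R h) \<partial>lborel)" for t
    proof -
      let ?\<psi> = "\<lambda>x. \<phi> (x - t *\<^sub>R h)"
      have ps: "?\<psi> \<in> test_functions UNIV" by (rule test_function_translate[OF p])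
      have i1: "integrable lborel (\<lambda>x. v x * partial_deriv i \<phi> (x - t *\<^sub>R h))" for i
        by (rule integrable_mult_bounded[OF v]) (use M in auto)
      have i2: "integrable lborel (\<lambda>x. g x $ i * \<phi> (x - t *\<^sub>R h))" for i
        by (rule integrable_mult_bounded) (use M g in \<open>auto simp: cart_eq_inner_axis\<close>)
      have "(\<integral>x. v x * D (x - t *\<^sub>R h) \<partial>lborel) = (\<integral>x. (\<Sum>i\<in>UNIV. h $ i * (v x * partial_deriv i \<phi> (x - t *\<^sub>R h))) \<partial>lborel)"
        by (simp add: D_def sum_distrib_left mult_ac)
      also have "\<dots> = (\<Sum>i\<in>UNIV. h $ i * (\<integral>x. v x * partial_deriv i \<phi> (x - t *\<^sub>R h) \<partial>lborel))"
        using i1 by (subst Bochner_Integration.integral_sum) auto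
      also have "\<dots> = (\<Sum>i\<in>UNIV. h $ i * - (\<integral>x. g x $ i * \<phi> (x - t *\<^sub>R h) \<partial>lborel))"
        using weak[OF ps] by (simp add: test_function_translate(2)[OF p])
      also have "\<dots> = - (\<integral>x. (\<Sum>i\<in>UNIV. h $ i * (g x $ i * \<phi> (x - t *\<^sub>R h))) \<partial>lborel)"
        using i2 by (subst Bochner_Integration.integral_sum) (auto simp: sum_negf)
      also have "\<dots> = - (\<integral>x. (g x \<bullet> h) * \<phi> (x - t *\<^sub>R h) \<partial>lborel)"
        by (simp add: inner_vec_def sum_distrib_left sum_distrib_right mult_ac)
      finally show ?thesis .
    qed
    have i3: "integrable lborel (\<lambda>x. v x * \<phi> (x - h))" "integrable lborel (\<lambda>x. v x * \<phi> x)"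
      by (rule integrable_mult_bounded[OF v], use M in auto)+
    have i4: "integrable lborel (\<lambda>x. v (x + h) * \<phi> x)" "integrable lborel (\<lambda>x. G x * \<phi> x)"
      by (rule integrable_mult_bounded[OF vint], use M in auto, rule integrable_mult_bounded[OF Gint], use M in auto)
    have "(\<integral>x. v (x + h) * \<phi> x \<partial>lborel) = (\<integral>x. v x * \<phi> (x - h) \<partial>lborel)"
      using lborel_integral_translate(1)[of "\<lambda>x. v x * \<phi> (x - h)" h] by simp
    then have "(\<integral>x. v (x + h) * \<phi> x \<partial>lborel) - (\<integral>x. v x * \<phi> x \<partial>lborel) = (\<integral>x. v x * (\<phi> (x - h) - \<phi> x) \<partial>lborel)"
      using i3 by (simp add: right_diff_distrib)
    also have "\<dots> = (\<integral>x. \<integral>t. (v x * indicator {0..1} t) * - D (x - t *\<^sub>R h) \<partial>lborel \<partial>lborel)"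
      by (subst ftc) (simp add: mult.assoc)
    also have "\<dots> = (\<integral>t. \<integral>x. (v x * indicator {0..1} t) * - D (x - t *\<^sub>R h) \<partial>lborel \<partial>lborel)"
    proof (rule lborel_pair.Fubini_integral[symmetric])
      have "integrable (lborel \<Otimes>\<^sub>M lborel) (\<lambda>z. (case z of (x, t) \<Rightarrow> v x * indicator {0..1::real} t) * - D (fst z - snd z *\<^sub>R h))"
        by (rule integrable_mult_bounded[OF integrable_pair_unit_interval[OF v], of _ B]) (use DB in auto)
      then show "integrable (lborel \<Otimes>\<^sub>M lborel) (\<lambda>(x, t). v x * indicator {0..1} t * - D (x - t *\<^sub>R h))"
        by (simp add: case_prod_beta')
    qed
    also have "\<dots> = (\<integral>t. indicator {0..1} t * - (\<integral>x. v x * D (x - t *\<^sub>R h) \<partial>lborel) \<partial>lborel)"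
    proof (rule Bochner_Integration.integral_cong)
      fix t
      have "(\<lambda>x. (v x * indicator {0..1} t) * - D (x - t *\<^sub>R h)) = (\<lambda>x. (- indicator {0..1} t) * (v x * D (x - t *\<^sub>R h)))" by (simp add: mult_ac)
      then show "(\<integral>x. (v x * indicator {0..1} t) * - D (x - t *\<^sub>R h) \<partial>lborel) = indicator {0..1} t * - (\<integral>x. v x * D (x - t *\<^sub>R h) \<partial>lborel)"
        by (simp only: integral_mult_right_zero)
    qed simp
    also have "\<dots> = (\<integral>t. indicator {0..1} t * (\<integral>x. (g x \<bullet> h) * \<phi> (x - t *\<^sub>R h) \<partial>lborel) \<partial>lborel)"
      by (simp add: wk)
    also have "\<dots> = (\<integral>t. indicator {0..1} t * (\<integral>x. (g (x + t *\<^sub>R h) \<bullet> h) * \<phi> x \<partial>lborel) \<partial>lborel)"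
    proof -
      have "(\<integral>x. (g x \<bullet> h) * \<phi> (x - t *\<^sub>R h) \<partial>lborel) = (\<integral>x. (g (x + t *\<^sub>R h) \<bullet> h) * \<phi> x \<partial>lborel)" for t
        using lborel_integral_translate(1)[of "\<lambda>x. (g x \<bullet> h) * \<phi> (x - t *\<^sub>R h)" "t *\<^sub>R h"] by simp
      then show ?thesis by simp
    qed
    also have "\<dots> = (\<integral>t. \<integral>x. (g (x + t *\<^sub>R h) \<bullet> h) * indicator {0..1} t * \<phi> x \<partial>lborel \<partial>lborel)"
    proof (rule Bochner_Integration.integral_cong)
      fix t
      have "(\<lambda>x. (g (x + t *\<^sub>R h) \<bullet> h) * indicator {0..1} t * \<phi> x) = (\<lambda>x. indicator {0..1} t * ((g (x + t *\<^sub>R h) \<bullet> h) * \<phi> x))" by (simp add: mult_ac)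
      then show "indicator {0..1} t * (\<integral>x. (g (x + t *\<^sub>R h) \<bullet> h) * \<phi> x \<partial>lborel) = (\<integral>x. (g (x + t *\<^sub>R h) \<bullet> h) * indicator {0..1} t * \<phi> x \<partial>lborel)"
        by (simp only: integral_mult_right_zero)
    qed simp
    also have "\<dots> = (\<integral>x. \<integral>t. (g (x + t *\<^sub>R h) \<bullet> h) * indicator {0..1} t * \<phi> x \<partial>lborel \<partial>lborel)"
    proof (rule lborel_pair.Fubini_integral)
      have "integrable (lborel \<Otimes>\<^sub>M lborel) (\<lambda>z. (case z of (x, t) \<Rightarrow> (g (x + t *\<^sub>R h) \<bullet> h) * indicator {0..1::real} t) * \<phi> (fst z))"
        by (rule integrable_mult_bounded[OF pairint, of _ M]) (use M in auto)
      then show "integrable (lborel \<Otimes>\<^sub>M lborel) (\<lambda>(x, t). (g (x + t *\<^sub>R h) \<bullet> h) * indicator {0..1} t * \<phi> x)"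
        by (simp add: case_prod_beta')
    qed
    also have "\<dots> = (\<integral>x. G x * \<phi> x \<partial>lborel)" unfolding G_def
      by (simp only: integral_mult_left_zero) (simp add: mult.commute)
    finally show "(\<integral>x. (v (x + h) - v x - G x) * \<phi> x \<partial>lborel) = 0"
      using i3 i4 by (simp add: left_diff_distrib)
  qed
  then show ?thesis unfolding G_def by eventually_elim simp
qed

text \<open>For \<open>x \<in> A\<close> and \<open>x + h \<in> A'\<close> the segment from \<open>x\<close> to \<open>x + h\<close> stays in the ball and the function grows by
at least \<open>1\<close> along it, so \<open>\<bar>h\<bar>\<close> times the integral of \<open>\<bar>g\<bar>\<close> over the segment is at least \<open>1\<close>. Integrate over
\<open>x\<close> and \<open>h\<close>. The left-hand side is the measure of \<open>{(x,h). x \<in> A \<and> x + h \<in> A'}\<close>, and only \<open>\<bar>h\<bar> < 2r\<close>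
contribute.\<close>

lemma poincare_two_sets:
  fixes v :: "real^'n::finite \<Rightarrow> real" and g :: "real^'n \<Rightarrow> real^'n"
  assumes v: "integrable lborel v" and g: "integrable lborel g"
    and weak: "\<And>\<phi> i. \<phi> \<in> test_functions UNIV \<Longrightarrow> (\<integral>x. v x * partial_deriv i \<phi> x \<partial>lborel) = - (\<integral>x. g x $ i * \<phi> x \<partial>lborel)"
    and A[measurable]: "A \<in> sets borel" "A' \<in> sets borel" and sub: "A \<subseteq> ball p r" "A' \<subseteq> ball p r"
    and sep: "\<And>x y. x \<in> A \<Longrightarrow> y \<in> A' \<Longrightarrow> 1 \<le> v y - v x" and r: "r \<ge> 0"
  shows "emeasure lborel A * emeasure lborel A' \<le> ennreal (2 * r) * emeasure lborel (ball (0::real^'n) (2 * r)) * (\<integral>\<^sup>+x. ennreal (norm (g x)) * indicator (ball p r) x \<partial>lborel)"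
proof -
  have [measurable]: "v \<in> borel_measurable borel" "g \<in> borel_measurable borel" using v g by auto
  let ?B = "ball p r"
  define F where "F x = ennreal (norm (g x)) * indicator ?B x" for x
  have [measurable]: "F \<in> borel_measurable borel"
    unfolding F_def by (intro borel_measurable_times_ennreal borel_measurable_indicator) auto
  define I where "I = (\<integral>\<^sup>+x. F x \<partial>lborel)"
  have shift: "AE x in lborel. v (x + h) - v x = (\<integral>t. indicator {0..1} t * (g (x + t *\<^sub>R h) \<bullet> h) \<partial>lborel)" for h
    by (rule weak_gradient_translate[OF v g weak])
  have step: "(\<integral>\<^sup>+x. indicator A x * indicator A' (x + h) \<partial>lborel) \<le> ennreal (2 * r) * I * indicator (ball 0 (2 * r)) h" for h
  proof (cases "norm h < 2 * r")
    case False
    have "indicator A x * indicator A' (x + h) = (0::ennreal)" for x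
    proof (rule ccontr)
      assume "indicator A x * indicator A' (x + h) \<noteq> (0::ennreal)"
      then have "x \<in> ball p r" "x + h \<in> ball p r" using sub by (auto simp: indicator_def split: if_splits)
      then show False using False norm_triangle_ineq4[of "x + h - p" "x - p"] by (simp add: dist_norm norm_minus_commute)
    qed
    then have "(\<lambda>x. indicator A x * indicator A' (x + h)) = (\<lambda>x. 0::ennreal)" by (rule ext)
    then show ?thesis by (simp only: nn_integral_0_iff_AE) simp
  next
    case True
    have "(\<integral>\<^sup>+x. indicator A x * indicator A' (x + h) \<partial>lborel)
       \<le> (\<integral>\<^sup>+x. \<integral>\<^sup>+t. ennreal (2 * r) * F (x + t *\<^sub>R h) * indicator {0..1::real} t \<partial>lborel \<partial>lborel)"
    proof (rule nn_integral_mono_AE)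
      show "AE x in lborel. indicator A x * indicator A' (x + h) \<le> (\<integral>\<^sup>+t. ennreal (2 * r) * F (x + t *\<^sub>R h) * indicator {0..1::real} t \<partial>lborel)"
        using shift[of h]
      proof eventually_elim
        case (elim x)
        show ?case
        proof (cases "x \<in> A \<and> x + h \<in> A'")
          case xA: True
          have inB: "x + t *\<^sub>R h \<in> ?B" if "t \<in> {0..1}" for t
          proof -
            have "(1 - t) *\<^sub>R x + t *\<^sub>R (x + h) \<in> ?B"
              using xA sub that by (intro convexD[OF convex_ball]) auto
            then show ?thesis by (simp add: algebra_simps)
          qed
          have "1 \<le> v (x + h) - v x" using sep xA by auto
          also have "\<dots> = (\<integral>t. indicator {0..1} t * (g (x + t *\<^sub>R h) \<bullet> h) \<partial>lborel)" by (rule elim)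
          finally have "ennreal 1 \<le> ennreal (norm (\<integral>t. indicator {0..1} t * (g (x + t *\<^sub>R h) \<bullet> h) \<partial>lborel))"
            by (intro ennreal_leI) auto
          also have "\<dots> \<le> (\<integral>\<^sup>+t. ennreal (norm (indicator {0..1} t * (g (x + t *\<^sub>R h) \<bullet> h))) \<partial>lborel)"
          proof (cases "integrable lborel (\<lambda>t. indicator {0..1::real} t * (g (x + t *\<^sub>R h) \<bullet> h))")
            case True
            then show ?thesis by (rule integral_norm_bound_ennreal)
          next
            case False
            then show ?thesis by (simp only: not_integrable_integral_eq norm_zero ennreal_0 zero_le simp_thms)
          qed
          also have "\<dots> \<le> (\<integral>\<^sup>+t. ennreal (2 * r) * F (x + t *\<^sub>R h) * indicator {0..1::real} t \<partial>lborel)"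
          proof (rule nn_integral_mono)
            fix t :: real
            have "\<bar>g (x + t *\<^sub>R h) \<bullet> h\<bar> \<le> norm (g (x + t *\<^sub>R h)) * norm h" by (rule Cauchy_Schwarz_ineq2)
            also have "\<dots> \<le> 2 * r * norm (g (x + t *\<^sub>R h))" using True by (subst mult.commute) (intro mult_right_mono, auto)
            finally have "ennreal \<bar>g (x + t *\<^sub>R h) \<bullet> h\<bar> \<le> ennreal (2 * r) * ennreal (norm (g (x + t *\<^sub>R h)))"
              using r by (simp add: ennreal_mult[symmetric] ennreal_leI)
            then show "ennreal (norm (indicator {0..1} t * (g (x + t *\<^sub>R h) \<bullet> h))) \<le> ennreal (2 * r) * F (x + t *\<^sub>R h) * indicator {0..1::real} t"
              using inB[of t] by (cases "t \<in> {0..1}") (auto simp: indicator_def F_def)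
          qed
          finally show ?thesis using xA by simp
        qed auto
      qed
    qed
    also have "\<dots> = (\<integral>\<^sup>+t. \<integral>\<^sup>+x. ennreal (2 * r) * F (x + t *\<^sub>R h) * indicator {0..1::real} t \<partial>lborel \<partial>lborel)"
      by (rule lborel_pair.Fubini'[symmetric]) measurable
    also have "\<dots> = (\<integral>\<^sup>+t. ennreal (2 * r) * I * indicator {0..1::real} t \<partial>lborel)"
    proof (rule nn_integral_cong)
      fix t :: real
      have "(\<integral>\<^sup>+x. ennreal (2 * r) * F (x + t *\<^sub>R h) * indicator {0..1::real} t \<partial>lborel)
        = (\<integral>\<^sup>+x. ennreal (2 * r) * F x * indicator {0..1::real} t \<partial>lborel)"
        by (rule nn_integral_lborel_translate) measurable
      also have "\<dots> = ennreal (2 * r) * I * indicator {0..1::real} t"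
        unfolding I_def by (simp add: nn_integral_cmult nn_integral_multc)
      finally show "(\<integral>\<^sup>+x. ennreal (2 * r) * F (x + t *\<^sub>R h) * indicator {0..1::real} t \<partial>lborel) = ennreal (2 * r) * I * indicator {0..1::real} t" .
    qed
    also have "\<dots> = ennreal (2 * r) * I" by (simp add: nn_integral_cmult)
    finally show ?thesis using True by simp
  qed
  have "emeasure lborel A * emeasure lborel A' = (\<integral>\<^sup>+x. indicator A x * emeasure lborel A' \<partial>lborel)"
    by (simp add: nn_integral_multc)
  also have "\<dots> = (\<integral>\<^sup>+x. indicator A x * (\<integral>\<^sup>+h. indicator A' (x + h) \<partial>lborel) \<partial>lborel)"
  proof -
    have "(\<integral>\<^sup>+h. indicator A' (x + h) \<partial>lborel) = emeasure lborel A'" for x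
      using nn_integral_lborel_translate[of "indicator A'" x] by (simp add: add.commute)
    then show ?thesis by simp
  qed
  also have "\<dots> = (\<integral>\<^sup>+x. \<integral>\<^sup>+h. indicator A x * indicator A' (x + h) \<partial>lborel \<partial>lborel)"
    by (simp add: nn_integral_cmult)
  also have "\<dots> = (\<integral>\<^sup>+h. \<integral>\<^sup>+x. indicator A x * indicator A' (x + h) \<partial>lborel \<partial>lborel)"
    by (rule lborel_pair.Fubini'[symmetric]) measurable
  also have "\<dots> \<le> (\<integral>\<^sup>+h. ennreal (2 * r) * I * indicator (ball (0::real^'n) (2 * r)) h \<partial>lborel)"
    by (rule nn_integral_mono) (rule step)
  also have "\<dots> = ennreal (2 * r) * I * emeasure lborel (ball (0::real^'n) (2 * r))"
    by (subst nn_integral_cmult_indicator) auto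
  finally show ?thesis unfolding I_def F_def by (simp add: mult_ac)
qed

lemma borel_representative_of_W11:
  fixes v :: "real^'n::finite \<Rightarrow> real"
  assumes "v \<in> W11 UNIV"
  obtains v' g where "integrable lborel v'" "integrable lborel (g :: real^'n \<Rightarrow> real^'n)" "AE x in lebesgue. v x = v' x"
    "\<And>\<phi> i. \<phi> \<in> test_functions UNIV \<Longrightarrow> (\<integral>x. v' x * partial_deriv i \<phi> x \<partial>lborel) = - (\<integral>x. g x $ i * \<phi> x \<partial>lborel)"
proof -
  have v: "integrable lebesgue v" using assms by (simp add: W11_def lebesgue_on_UNIV_eq)
  obtain g0 where g0: "integrable lebesgue g0" "\<And>\<phi> i. \<phi> \<in> test_functions UNIV \<Longrightarrow> (\<integral>x. v x * partial_deriv i \<phi> x \<partial>lebesgue) = - (\<integral>x. g0 x $ i * \<phi> x \<partial>lebesgue)"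
    using assms by (auto simp: W11_def has_L1_gradient_def lebesgue_on_UNIV_eq)
  have g0i: "integrable lebesgue (\<lambda>x. g0 x $ i)" for i using g0(1) by (simp add: cart_eq_inner_axis)
  have rep: "\<exists>w'. integrable lborel w' \<and> (AE x in lebesgue. w x = w' x)" if w: "integrable lebesgue w" for w :: "real^'n \<Rightarrow> real"
  proof -
    have wm: "w \<in> borel_measurable lebesgue" using w by auto
    obtain w' where w': "w' \<in> borel_measurable lborel" "AE x in lborel. w x = w' x"
      using completion_ex_borel_measurable_real[OF wm] by blast
    have ae: "AE x in lebesgue. w x = w' x" using w'(2) by (rule AE_completion)
    have "integrable lebesgue w'"
      by (rule integrable_cong_AE_imp[OF w _ ae]) (rule measurable_completion[OF w'(1)])
    then show ?thesis using w' ae integrable_completion by blast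
  qed
  obtain v' where v': "integrable lborel v'" "AE x in lebesgue. v x = v' x" using rep[OF v] by blast
  obtain G where G: "\<And>i. integrable lborel (G i)" "\<And>i. AE x in lebesgue. g0 x $ i = G i x" using rep[OF g0i] by metis
  define g where "g x = (\<chi> i. G i x)" for x
  have "integrable lborel g"
  proof -
    have "g x = (\<Sum>i\<in>UNIV. G i x *\<^sub>R axis i 1)" for x
      using basis_expansion[of "g x"] by (simp add: g_def scalar_mult_eq_scaleR)
    then have "g = (\<lambda>x. \<Sum>i\<in>UNIV. G i x *\<^sub>R axis i 1)" by (rule ext)
    then show ?thesis using G(1) by (simp only:) (intro Bochner_Integration.integrable_sum integrable_scaleR_left, simp)
  qed
  moreover have "(\<integral>x. v' x * partial_deriv i \<phi> x \<partial>lborel) = - (\<integral>x. g x $ i * \<phi> x \<partial>lborel)" if p: "\<phi> \<in> test_functions UNIV" for \<phi> i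
  proof -
    note m = test_function_differentiable(4,5)[OF p]
    have v'm: "v' \<in> borel_measurable borel" and Gm: "G i \<in> borel_measurable borel" using v' G by auto
    have "(\<integral>x. v' x * partial_deriv i \<phi> x \<partial>lborel) = (\<integral>x. v' x * partial_deriv i \<phi> x \<partial>lebesgue)"
      by (rule integral_completion[symmetric]) (use v'm m in measurable)
    also have "\<dots> = (\<integral>x. v x * partial_deriv i \<phi> x \<partial>lebesgue)"
    proof (rule integral_cong_AE)
      show "(\<lambda>x. v' x * partial_deriv i \<phi> x) \<in> borel_measurable lebesgue" by (rule measurable_completion) (use v'm m in measurable)
      show "(\<lambda>x. v x * partial_deriv i \<phi> x) \<in> borel_measurable lebesgue"
        by (rule borel_measurable_times[OF borel_measurable_integrable[OF v]]) (rule measurable_completion, use m in simp)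
      show "AE x in lebesgue. v' x * partial_deriv i \<phi> x = v x * partial_deriv i \<phi> x" using v'(2) by eventually_elim simp
    qed
    also have "\<dots> = - (\<integral>x. g0 x $ i * \<phi> x \<partial>lebesgue)" by (rule g0(2)[OF p])
    also have "(\<integral>x. g0 x $ i * \<phi> x \<partial>lebesgue) = (\<integral>x. G i x * \<phi> x \<partial>lebesgue)"
    proof (rule integral_cong_AE)
      show "(\<lambda>x. G i x * \<phi> x) \<in> borel_measurable lebesgue" by (rule measurable_completion) (use Gm m in measurable)
      show "(\<lambda>x. g0 x $ i * \<phi> x) \<in> borel_measurable lebesgue"
        by (rule borel_measurable_times[OF borel_measurable_integrable[OF g0i]]) (rule measurable_completion, use m in simp)
      show "AE x in lebesgue. g0 x $ i * \<phi> x = G i x * \<phi> x" using G(2)[of i] by eventually_elim simp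
    qed
    also have "\<dots> = (\<integral>x. g x $ i * \<phi> x \<partial>lborel)"
      by (subst integral_completion) (use Gm m in \<open>auto simp: g_def\<close>)
    finally show ?thesis .
  qed
  ultimately show ?thesis using that[OF v'(1) _ v'(2)] by blast
qed

section \<open>Integration by parts for Lipschitz functions\<close>

lemma has_derivative_imp_difference_quotient:
  fixes f :: "'a::real_normed_vector \<Rightarrow> real"
  assumes "(f has_derivative f') (at x)"
  shows "((\<lambda>t. (f (x + t *\<^sub>R e) - f x) / t) \<longlongrightarrow> f' e) (at 0)"
proof -
  have 1: "((\<lambda>t. x + t *\<^sub>R e) has_derivative (\<lambda>t. t *\<^sub>R e)) (at 0)" by (auto intro!: derivative_eq_intros)
  have "(f has_derivative f') (at (x + 0 *\<^sub>R e))" using assms by simp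
  from has_derivative_compose[OF 1 this] have d: "((\<lambda>t. f (x + t *\<^sub>R e)) has_derivative (\<lambda>t. f' (t *\<^sub>R e))) (at 0)" .
  have "linear f'" using assms has_derivative_linear by blast
  then have "(\<lambda>t. f' (t *\<^sub>R e)) = (\<lambda>t. t * f' e)" by (simp add: linear_scale)
  then have "(\<lambda>t. f' (t *\<^sub>R e)) = (*) (f' e)" by (simp add: mult.commute fun_eq_iff)
  with d have "((\<lambda>t. f (x + t *\<^sub>R e)) has_real_derivative f' e) (at 0)" by (simp add: has_field_derivative_def)
  then show ?thesis by (simp add: has_field_derivative_iff)
qed

text \<open>Every difference quotient has integral zero by translation invariance, and the Lipschitz constant
dominates all of them.\<close>

lemma integral_directional_derivative_eq_0:
  fixes w d :: "'a::euclidean_space \<Rightarrow> real"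
  assumes lip: "L-lipschitz_on UNIV w" and supp: "\<And>x. w x \<noteq> 0 \<Longrightarrow> norm x < R"
    and dm: "d \<in> borel_measurable lebesgue"
    and lim: "AE x in lebesgue. ((\<lambda>t. (w (x + t *\<^sub>R e) - w x) / t) \<longlongrightarrow> d x) (at 0)"
  shows "(\<integral>x. d x \<partial>lebesgue) = 0"
proof -
  have wc: "continuous_on UNIV w" by (rule lipschitz_on_continuous_on[OF lip])
  have wm[measurable]: "w \<in> borel_measurable borel" by (rule borel_measurable_continuous_onI[OF wc])
  have wl: "\<bar>w x - w y\<bar> \<le> L * norm (x - y)" for x y using lipschitz_onD[OF lip, of x y] by (simp add: dist_norm)
  define q where "q k x = (w (x + (1 / Suc k) *\<^sub>R e) - w x) / (1 / Suc k)" for k :: nat and x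
  have qm[measurable]: "q k \<in> borel_measurable borel" for k unfolding q_def by measurable
  have wint: "integrable lborel w"
  proof -
    obtain B where B: "\<And>x. x \<in> cball 0 R \<Longrightarrow> norm (w x) \<le> B"
      using compact_imp_bounded[OF compact_continuous_image[OF continuous_on_subset[OF wc subset_UNIV] compact_cball[of 0 R]]]
      unfolding bounded_iff by blast
    show ?thesis
  proof (rule Bochner_Integration.integrable_bound)
    show "integrable lborel (\<lambda>x::'a. B * indicator (cball 0 R) x)"
      using emeasure_lborel_cball_finite[of "0::'a" R]
      by (intro integrable_mult_right integrable_real_indicator) simp_all
    show "AE x in lborel. norm (w x) \<le> norm (B * indicator (cball 0 R) x)"
      using B supp by (intro AE_I2) (force simp: indicator_def)
  qed simp
  qed
  have "(\<integral>x. q k x \<partial>lebesgue) = 0" for k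
  proof -
    have "(\<integral>x. q k x \<partial>lborel) = ((\<integral>x. w (x + (1 / Suc k) *\<^sub>R e) \<partial>lborel) - (\<integral>x. w x \<partial>lborel)) / (1 / Suc k)"
      unfolding q_def using wint by (simp add: lborel_integral_translate)
    then show ?thesis by (simp add: lborel_integral_translate integral_completion)
  qed
  moreover have "(\<lambda>k. \<integral>x. q k x \<partial>lebesgue) \<longlonglongrightarrow> (\<integral>x. d x \<partial>lebesgue)"
  proof (rule integral_dominated_convergence[where w="\<lambda>x. L * norm e * indicator (ball 0 (R + norm e)) x"])
    show "integrable lebesgue (\<lambda>x::'a. L * norm e * indicator (ball 0 (R + norm e)) x)"
      using emeasure_lborel_ball_finite[of "0::'a" "R + norm e"]
      by (intro integrable_mult_right integrable_real_indicator) simp_all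
    show "q k \<in> borel_measurable lebesgue" for k by (rule measurable_completion) simp
    show "AE x in lebesgue. (\<lambda>k. q k x) \<longlonglongrightarrow> d x"
      using lim
    proof eventually_elim
      case (elim x)
      have "filterlim (\<lambda>k. 1 / real (Suc k)) (at 0) sequentially"
        unfolding filterlim_at using LIMSEQ_inverse_real_of_nat by (simp add: inverse_eq_divide)
      from filterlim_compose[OF elim this] show ?case unfolding q_def .
    qed
    show "AE x in lebesgue. norm (q k x) \<le> L * norm e * indicator (ball 0 (R + norm e)) x" for k
    proof (rule AE_I2)
      fix x :: 'a
      show "norm (q k x) \<le> L * norm e * indicator (ball 0 (R + norm e)) x"
      proof (cases "x \<in> ball 0 (R + norm e)")
        case True
        have "\<bar>w (x + (1 / Suc k) *\<^sub>R e) - w x\<bar> \<le> L * (1 / Suc k * norm e)" using wl[of "x + (1 / Suc k) *\<^sub>R e" x] by simp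
        then have "\<bar>w (x + (1 / Suc k) *\<^sub>R e) - w x\<bar> / (1 / Suc k) \<le> L * (1 / Suc k * norm e) / (1 / Suc k)"
          by (rule divide_right_mono) simp
        moreover have "\<bar>q k x\<bar> = \<bar>w (x + (1 / Suc k) *\<^sub>R e) - w x\<bar> / (1 / Suc k)" by (simp add: q_def abs_mult)
        ultimately have "\<bar>q k x\<bar> \<le> L * (1 / Suc k * norm e) / (1 / Suc k)" by simp
        then show ?thesis using True by simp
      next
        case False
        have n: "norm ((1 / Suc k) *\<^sub>R e) \<le> norm e" using mult_right_mono[of "1 / Suc k" 1 "norm e"] by simp
        have "norm x \<ge> R + norm e" using False by simp
        then have "\<not> norm x < R" "\<not> norm (x + (1 / Suc k) *\<^sub>R e) < R"
          using n norm_ge_zero[of e] norm_diff_ineq[of x "(1 / Suc k) *\<^sub>R e"] by linarith+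
        then have "w x = 0" "w (x + (1 / Suc k) *\<^sub>R e) = 0" using supp by blast+
        then show ?thesis using False by (simp add: q_def indicator_def)
      qed
    qed
  qed (rule dm)
  ultimately show ?thesis by (simp add: LIMSEQ_const_iff)
qed

lemma lipschitz_test_function:
  fixes \<phi> :: "real^'n::finite \<Rightarrow> real"
  assumes p: "\<phi> \<in> test_functions U"
  obtains L where "L-lipschitz_on UNIV \<phi>"
proof -
  obtain M where M: "\<And>x. \<bar>\<phi> x\<bar> \<le> M" "\<And>x i. \<bar>partial_deriv i \<phi> x\<bar> \<le> M" "M \<ge> 0"
    using test_function_bounded[OF p] by blast
  define L where "L = real CARD('n) * M"
  have "dist (\<phi> x) (\<phi> y) \<le> L * dist x y" for x y
  proof -
    have "norm (\<phi> x - \<phi> y) \<le> L * norm (x - y)"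
    proof (rule differentiable_bound[of UNIV _ "\<lambda>x h. \<Sum>i\<in>UNIV. h $ i * partial_deriv i \<phi> x"])
      show "(\<phi> has_derivative (\<lambda>h. \<Sum>i\<in>UNIV. h $ i * partial_deriv i \<phi> x)) (at x within UNIV)" for x
        using test_function_has_derivative[OF p] by simp
      fix x
      show "onorm (\<lambda>h. \<Sum>i\<in>UNIV. h $ i * partial_deriv i \<phi> x) \<le> L"
      proof (rule onorm_le)
        fix h :: "real^'n"
        have "\<bar>\<Sum>i\<in>UNIV. h $ i * partial_deriv i \<phi> x\<bar> \<le> (\<Sum>i\<in>(UNIV::'n set). norm h * M)"
          by (intro order_trans[OF sum_abs] sum_mono) (simp add: abs_mult mult_mono M component_le_norm_cart)
        then show "norm (\<Sum>i\<in>UNIV. h $ i * partial_deriv i \<phi> x) \<le> L * norm h" by (simp add: L_def mult_ac)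
      qed
    qed auto
    then show ?thesis by (simp add: dist_norm)
  qed
  then show ?thesis using that[of L] M(3) by (auto simp: lipschitz_on_def L_def)
qed

text \<open>The product \<open>u \<phi>\<close> vanishes outside a compact subset of \<open>\<Omega>\<close>, hence is globally Lipschitz although \<open>u\<close> is
Lipschitz only on compact subsets. Its derivative, given by the product rule, has integral zero.\<close>

lemma has_L1_gradient_if_differentiable:
  fixes u :: "real^'n::finite \<Rightarrow> real" and g :: "real^'n \<Rightarrow> real^'n"
  assumes oU: "open \<Omega>" and um[measurable]: "u \<in> borel_measurable borel" and ub: "\<And>x. \<bar>u x\<bar> \<le> 1"
    and loc: "\<And>K. compact K \<Longrightarrow> K \<subseteq> \<Omega> \<Longrightarrow> \<exists>L. L-lipschitz_on K u"
    and N: "negligible N" and der: "\<And>x. x \<in> \<Omega> - N \<Longrightarrow> (u has_derivative (\<lambda>h. g x \<bullet> h)) (at x)"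
    and gint: "integrable (lebesgue_on \<Omega>) g"
  shows "has_L1_gradient \<Omega> u g"
  unfolding has_L1_gradient_def
proof (intro conjI ballI allI gint)
  fix \<phi> :: "real^'n \<Rightarrow> real" and i assume p: "\<phi> \<in> test_functions \<Omega>"
  let ?K = "closure {x. \<phi> x \<noteq> 0}"
  have K: "compact ?K" "?K \<subseteq> \<Omega>" using p by (auto simp: test_functions_def)
  note zero = test_function_zero_outside[OF p]
  show "(\<integral>x. u x * partial_deriv i \<phi> x \<partial>lebesgue_on \<Omega>) = - (\<integral>x. g x $ i * \<phi> x \<partial>lebesgue_on \<Omega>)"
  proof (cases "?K = {}")
    case True
    then have "x \<notin> ?K" for x by (simp only: empty_iff not_False_eq_True)
    note z = zero[OF this]
    have e1: "(\<lambda>x. u x * partial_deriv i \<phi> x) = (\<lambda>x. 0)" by (rule ext, subst z(2), rule mult_zero_right)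
    have e2: "(\<lambda>x. g x $ i * \<phi> x) = (\<lambda>x. 0)" by (rule ext, subst z(1), rule mult_zero_right)
    show ?thesis unfolding e1 e2 by simp
  next
    case nemp: False
    note [measurable] = test_function_differentiable(4,5)[OF p]
    obtain M where M: "\<And>x. \<bar>\<phi> x\<bar> \<le> M" "\<And>x i. \<bar>partial_deriv i \<phi> x\<bar> \<le> M" "M \<ge> 0"
      using test_function_bounded[OF p] by blast
    obtain L1 where L1: "L1-lipschitz_on UNIV \<phi>" using lipschitz_test_function[OF p] .
    obtain \<rho> where rho: "\<rho> > 0" "{x. infdist x ?K \<le> \<rho>} \<subseteq> \<Omega>"
      using compact_in_open_separated[OF nemp K(1) oU K(2)] .
    define K' where "K' = {x. infdist x ?K \<le> \<rho>}"
    have "compact K'" unfolding K'_def using nemp K(1) rho by (intro compact_infdist_le) auto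
    then obtain L2 where L2: "L2-lipschitz_on K' u" using loc rho by (auto simp: K'_def)
    have KK': "x \<in> K'" if "x \<in> ?K" for x using that rho by (simp add: K'_def)
    have far: "dist x y \<ge> \<rho>" if "x \<in> ?K" "y \<notin> K'" for x y
      using that infdist_le[of x ?K y] by (auto simp: K'_def dist_commute)
    have L10: "L1 \<ge> 0" "L2 \<ge> 0" using L1 L2 by (auto simp: lipschitz_on_def)
    define w where "w x = u x * \<phi> x" for x
    define L where "L = L1 + M * L2 + M / \<rho>"
    have L0: "L \<ge> 0" unfolding L_def using L10 M rho by auto
    have Lge: "L1 + M * L2 \<le> L" "M / \<rho> \<le> L" unfolding L_def using L10 M rho by auto
    have w0: "w x = 0" if "x \<notin> ?K" for x using zero(1)[OF that] by (simp add: w_def)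
    have wM: "\<bar>w x\<bar> \<le> M" for x
      using mult_mono[OF ub[of x] M(1)[of x]] M by (simp add: w_def abs_mult)
    \<comment> \<open>either both points lie in the neighbourhood \<open>K'\<close>, or they are at least \<open>\<rho>\<close> apart\<close>
    have half: "\<bar>w x - w y\<bar> \<le> L * dist x y" if x: "x \<in> ?K" for x y
    proof (cases "y \<in> K'")
      case True
      have "w x - w y = u x * (\<phi> x - \<phi> y) + \<phi> y * (u x - u y)" by (simp add: w_def algebra_simps)
      also have "\<bar>\<dots>\<bar> \<le> \<bar>u x\<bar> * \<bar>\<phi> x - \<phi> y\<bar> + \<bar>\<phi> y\<bar> * \<bar>u x - u y\<bar>"
        by (simp add: abs_mult[symmetric] abs_triangle_ineq)
      also have "\<dots> \<le> 1 * (L1 * dist x y) + M * (L2 * dist x y)"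
        using lipschitz_onD[OF L1, of x y] lipschitz_onD[OF L2 KK'[OF x] True] L10 M
        by (intro add_mono mult_mono ub) (auto simp: dist_real_def)
      also have "\<dots> = (L1 + M * L2) * dist x y" by (simp add: algebra_simps)
      also have "\<dots> \<le> L * dist x y" by (intro mult_right_mono Lge) auto
      finally show ?thesis .
    next
      case False
      then have "w y = 0" using w0 KK' by blast
      have "\<bar>w x - w y\<bar> \<le> M" using wM \<open>w y = 0\<close> by simp
      also have "M = M / \<rho> * \<rho>" using rho by simp
      also have "\<dots> \<le> M / \<rho> * dist x y" using far[OF x False] M rho by (intro mult_left_mono) auto
      also have "\<dots> \<le> L * dist x y" by (intro mult_right_mono Lge) auto
      finally show ?thesis .
    qed
    have lipw: "L-lipschitz_on UNIV w"
    proof (rule lipschitz_onI)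
      fix x y :: "real^'n"
      show "dist (w x) (w y) \<le> L * dist x y"
        using half[of x y] half[of y x] w0[of x] w0[of y] L0
        by (cases "x \<in> ?K"; cases "y \<in> ?K") (auto simp: dist_real_def dist_commute abs_minus_commute)
    qed (rule L0)
    obtain R where R: "?K \<subseteq> ball 0 R" using compact_imp_bounded[OF K(1)] bounded_subset_ballD by blast
    define d where "d x = indicator \<Omega> x * (u x * partial_deriv i \<phi> x + g x $ i * \<phi> x)" for x
    have Om: "\<Omega> \<in> sets lebesgue" using oU by simp
    have gi: "integrable (lebesgue_on \<Omega>) (\<lambda>x. g x $ i)" using gint by (auto simp: cart_eq_inner_axis)
    have m1[measurable]: "\<phi> \<in> borel_measurable (lebesgue_on \<Omega>)" "u \<in> borel_measurable (lebesgue_on \<Omega>)" "partial_deriv i \<phi> \<in> borel_measurable (lebesgue_on \<Omega>)"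
      by (auto intro!: measurable_restrict_space1 measurable_completion)
    have i1: "integrable (lebesgue_on \<Omega>) (\<lambda>x. g x $ i * \<phi> x)"
      by (rule integrable_mult_bounded[OF gi _ M(1)]) measurable
    have i2: "integrable (lebesgue_on \<Omega>) (\<lambda>x. u x * partial_deriv i \<phi> x)"
    proof (rule Bochner_Integration.integrable_bound)
      have "integrable lebesgue (\<lambda>x. M * indicator ?K x)"
        using emeasure_compact_finite[OF K(1)] by (intro integrable_mult_right integrable_real_indicator) simp_all
      then show "integrable (lebesgue_on \<Omega>) (\<lambda>x. M * indicator ?K x)"
        using Om by (subst integrable_restrict_space) (simp, rule integrable_mult_indicator)
      have "\<bar>u x * partial_deriv i \<phi> x\<bar> \<le> M * indicator ?K x" for x
        using mult_mono[OF ub[of x] M(2)[where x=x and i=i]] M(3) zero(2)[of x i] by (cases "x \<in> ?K") (auto simp: abs_mult)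
      then show "AE x in lebesgue_on \<Omega>. norm (u x * partial_deriv i \<phi> x) \<le> norm (M * indicator ?K x)"
        by (intro AE_I2) (smt (verit, best) real_norm_def)
    qed measurable
    have dint: "integrable lebesgue d"
      using Bochner_Integration.integrable_add[OF i2 i1] Om unfolding d_def by (simp add: integrable_restrict_space)
    have "(\<integral>x. d x \<partial>lebesgue) = 0"
    proof (rule integral_directional_derivative_eq_0[OF lipw])
      show "norm x < R" if "w x \<noteq> 0" for x
      proof -
        have "x \<in> ?K" using w0[of x] that by (rule_tac ccontr) simp
        then have "x \<in> ball 0 R" by (rule subsetD[OF R])
        then show ?thesis by simp
      qed
      show "d \<in> borel_measurable lebesgue" using dint by auto
      have "AE x in lebesgue. x \<notin> N" using N by (intro AE_not_in) (simp add: negligible_iff_null_sets)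
      then show "AE x in lebesgue. ((\<lambda>t. (w (x + t *\<^sub>R axis i 1) - w x) / t) \<longlongrightarrow> d x) (at 0)"
      proof eventually_elim
        case (elim x)
        show ?case
        proof (cases "x \<in> \<Omega>")
          case True
          have phi': "(\<Sum>j\<in>UNIV. axis i 1 $ j * partial_deriv j \<phi> x) = partial_deriv i \<phi> x"
            by (subst sum.mono_neutral_cong_right[of UNIV "{i}" _ "\<lambda>j. partial_deriv j \<phi> x"]) (auto simp: axis_def)
          have "(w has_derivative (\<lambda>h. u x * (\<Sum>j\<in>UNIV. h $ j * partial_deriv j \<phi> x) + (g x \<bullet> h) * \<phi> x)) (at x)"
            unfolding w_def using True elim by (intro has_derivative_mult der test_function_has_derivative[OF p]) auto
          from has_derivative_imp_difference_quotient[OF this, of "axis i 1"] show ?thesis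
            using True by (simp only: d_def phi' cart_eq_inner_axis[of "g x" i, symmetric] indicator_simps(1) mult_1_left)
        next
          case False
          then have xK: "x \<in> - ?K" using K by auto
          have "(w has_derivative (\<lambda>h. 0)) (at x)"
          proof (rule has_derivative_transform_within_open[of "\<lambda>x. 0"])
            show "open (- ?K)" by (intro open_Compl closed_closure)
          qed (use xK w0 in auto)
          from has_derivative_imp_difference_quotient[OF this, of "axis i 1"] show ?thesis
            using False by (simp add: d_def)
        qed
      qed
    qed
    moreover have "(\<integral>x. d x \<partial>lebesgue) = (\<integral>x. u x * partial_deriv i \<phi> x + g x $ i * \<phi> x \<partial>lebesgue_on \<Omega>)"
      unfolding d_def using Om by (simp add: integral_restrict_space)
    ultimately show ?thesis using i1 i2 by simp
  qed
qed

section \<open>Transition layers\<close>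

text \<open>Riesz representation of the derivative.\<close>

lemma differentiable_imp_gradient:
  fixes f :: "'a::euclidean_space \<Rightarrow> real"
  assumes "f differentiable (at x)"
  obtains a where "(f has_derivative (\<lambda>v. a \<bullet> v)) (at x)"
proof -
  obtain f' where f': "(f has_derivative f') (at x)" using assms unfolding differentiable_def by blast
  then have lin: "linear f'" using has_derivative_linear by blast
  have "f' v = (\<Sum>b\<in>Basis. f' b *\<^sub>R b) \<bullet> v" for v
  proof -
    have "f' v = f' (\<Sum>b\<in>Basis. (v \<bullet> b) *\<^sub>R b)" by (simp add: euclidean_representation)
    also have "\<dots> = (\<Sum>b\<in>Basis. f' b *\<^sub>R b) \<bullet> v"
      by (simp add: linear_sum[OF lin] linear_scale[OF lin] inner_sum_left) (simp add: inner_commute mult.commute)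
    finally show ?thesis .
  qed
  then have "f' = (\<lambda>v. (\<Sum>b\<in>Basis. f' b *\<^sub>R b) \<bullet> v)" by (rule ext)
  with f' that show ?thesis by metis
qed

lemma norm_gradient_le_lipschitz:
  fixes f :: "'a::euclidean_space \<Rightarrow> real"
  assumes d: "(f has_derivative (\<lambda>v. a \<bullet> v)) (at x)" and lip: "L-lipschitz_on UNIV f"
  shows "norm a \<le> L"
proof -
  have L: "L \<ge> 0" using lip by (simp add: lipschitz_on_def)
  have "((\<lambda>t. \<bar>(f (x + t *\<^sub>R a) - f x) / t\<bar>) \<longlongrightarrow> \<bar>a \<bullet> a\<bar>) (at 0)"
    by (intro tendsto_rabs has_derivative_imp_difference_quotient[OF d])
  moreover have "\<bar>(f (x + t *\<^sub>R a) - f x) / t\<bar> \<le> L * norm a" for t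
  proof -
    have "\<bar>f (x + t *\<^sub>R a) - f x\<bar> \<le> L * (\<bar>t\<bar> * norm a)"
      using lipschitz_onD[OF lip, of "x + t *\<^sub>R a" x] by (simp add: dist_norm)
    then show ?thesis using L by (cases "t = 0") (auto simp: field_simps)
  qed
  ultimately have "\<bar>a \<bullet> a\<bar> \<le> L * norm a"
    by (intro tendsto_upperbound[of _ _ "at (0::real)"]) auto
  then show ?thesis using L by (cases "a = 0") (auto simp: dot_square_norm power2_eq_square)
qed

text \<open>Every line of direction \<open>e\<close> contains at most one zero.\<close>

lemma negligible_zeros_of_increasing_along:
  fixes k :: "'a::euclidean_space \<Rightarrow> real"
  assumes c: "continuous_on UNIV k" and inc: "\<And>x t. t > 0 \<Longrightarrow> k x < k (x + t *\<^sub>R e)"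
  shows "negligible {x. k x = 0}"
proof (rule negligible_if_null_on_lines[of _ e])
  have "closed {x. k x = 0}" by (intro closed_Collect_eq c continuous_intros)
  then show "{x. k x = 0} \<in> sets borel" by simp
  fix x
  have uniq: "\<not> s < t" if "k (x + s *\<^sub>R e) = 0" "k (x + t *\<^sub>R e) = 0" for s t
    using inc[of "t - s" "x + s *\<^sub>R e"] that by (auto simp: algebra_simps)
  have "finite {t. x + t *\<^sub>R e \<in> {x. k x = 0}}"
  proof (cases "\<exists>t0. k (x + t0 *\<^sub>R e) = 0")
    case True
    then obtain t0 where t0: "k (x + t0 *\<^sub>R e) = 0" by blast
    have "t = t0" if "k (x + t *\<^sub>R e) = 0" for t
      using uniq[OF that t0] uniq[OF t0 that] by linarith
    then have "{t. x + t *\<^sub>R e \<in> {x. k x = 0}} \<subseteq> {t0}" by blast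
    then show ?thesis by (rule finite_subset) simp
  qed simp
  then show "negligible {t. x + t *\<^sub>R e \<in> {x. k x = 0}}" by (rule negligible_finite)
qed

text \<open>On a line that crosses the layer transversally, the layer has length comparable to its width, although
this width varies. Two points \<open>s\<close>, \<open>t\<close> of the layer satisfy \<open>\<bar>t - s\<bar>/2 \<le> \<epsilon> t + \<epsilon> s\<close>, and since \<open>\<epsilon>\<close>
varies slowly, \<open>\<bar>t - s\<bar> \<le> 6 \<epsilon> t\<close>. Thus the layer lies in an interval \<open>[a,b]\<close> of length at most
\<open>12 \<epsilon> t\<close> for each of its points \<open>t\<close>, and the integrand is at most \<open>12/(b - a)\<close>.\<close>

lemma nn_integral_transition_layer_line:
  fixes h \<epsilon> :: "real \<Rightarrow> real"
  assumes [measurable]: "h \<in> borel_measurable borel" "\<epsilon> \<in> borel_measurable borel"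
    and h: "\<And>s t. s \<le> t \<Longrightarrow> h t - h s \<ge> (t - s) / 2"
    and e: "\<And>s t. \<bar>\<epsilon> t - \<epsilon> s\<bar> \<le> \<bar>t - s\<bar> / 8"
  shows "(\<integral>\<^sup>+t. ennreal (1 / \<epsilon> t) * indicator {t. \<bar>h t\<bar> \<le> \<epsilon> t \<and> \<epsilon> t > 0} t \<partial>lborel) \<le> 12"
proof -
  define T where "T = {t. \<bar>h t\<bar> \<le> \<epsilon> t \<and> \<epsilon> t > 0}"
  have [measurable]: "T \<in> sets borel" unfolding T_def by measurable
  have close: "\<bar>t - s\<bar> \<le> 6 * \<epsilon> t" if "s \<in> T" "t \<in> T" for s t
  proof -
    have "\<bar>t - s\<bar> / 2 \<le> \<bar>h t - h s\<bar>" using h[of s t] h[of t s] by (cases "s \<le> t") auto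
    also have "\<dots> \<le> \<epsilon> t + \<epsilon> s" using that by (auto simp: T_def)
    finally have "\<bar>t - s\<bar> / 2 \<le> \<epsilon> t + \<epsilon> s" .
    moreover have "\<epsilon> t > 0" using that by (simp add: T_def)
    moreover have "\<epsilon> s - \<epsilon> t \<le> \<bar>\<epsilon> t - \<epsilon> s\<bar>" by simp
    ultimately show ?thesis using e[of t s] by argo
  qed
  show ?thesis
  proof (cases "T = {}")
    case True
    then show ?thesis unfolding T_def[symmetric] by simp
  next
    case False
    then obtain t0 where t0: "t0 \<in> T" by blast
    define a where "a = Inf T"
    define b where "b = Sup T"
    have bdd: "bdd_below T" "bdd_above T"
      using close[OF _ t0] by (auto intro!: bdd_belowI[of _ "t0 - 6 * \<epsilon> t0"] bdd_aboveI[of _ "t0 + 6 * \<epsilon> t0"] simp: abs_le_iff) (smt (verit))+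
    have ab: "a \<le> t" "t \<le> b" if "t \<in> T" for t
      unfolding a_def b_def using that bdd by (auto intro: cInf_lower cSup_upper)
    have ba: "b - a \<le> 12 * \<epsilon> t" if t: "t \<in> T" for t
    proof -
      have "b \<le> t + 6 * \<epsilon> t" unfolding b_def using close[OF _ t] by (intro cSup_least[OF False]) (auto simp: abs_le_iff algebra_simps)
      moreover have "a \<ge> t - 6 * \<epsilon> t" unfolding a_def using close[OF _ t] by (intro cInf_greatest[OF False]) (auto simp: abs_le_iff algebra_simps)
      ultimately show ?thesis by simp
    qed
    show ?thesis
    proof (cases "a < b")
      case True
      have "(\<integral>\<^sup>+t. ennreal (1 / \<epsilon> t) * indicator T t \<partial>lborel) \<le> (\<integral>\<^sup>+t. ennreal (12 / (b - a)) * indicator {a..b} t \<partial>lborel)"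
      proof (rule nn_integral_mono)
        fix t
        show "ennreal (1 / \<epsilon> t) * indicator T t \<le> ennreal (12 / (b - a)) * indicator {a..b} t"
        proof (cases "t \<in> T")
          case t: True
          then have "\<epsilon> t > 0" by (simp add: T_def)
          then have "1 / \<epsilon> t \<le> 12 / (b - a)" using ba[OF t] True by (simp add: field_simps)
          then show ?thesis using ab[OF t] t by (simp add: ennreal_leI)
        qed simp
      qed
      also have "\<dots> = ennreal (12 / (b - a)) * ennreal (b - a)" using True by (simp add: nn_integral_cmult_indicator)
      also have "\<dots> = ennreal (12 / (b - a) * (b - a))" using True by (intro ennreal_mult[symmetric]) auto
      also have "\<dots> = ennreal 12"
      proof -
        have "12 / c * c = 12" if "c \<noteq> 0" for c :: real using that by simp
        from this[of "b - a"] show ?thesis using True by (metis diff_gt_0_iff_gt less_irrefl)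
      qed
      also have "\<dots> = 12" by simp
      finally show ?thesis unfolding T_def .
    next
      case False
      then have "T \<subseteq> {a}" using ab by force
      then have "AE t in lborel. t \<notin> T" by (intro AE_I'[of "{a}"]) auto
      then have "(\<integral>\<^sup>+t. ennreal (1 / \<epsilon> t) * indicator T t \<partial>lborel) = (\<integral>\<^sup>+(t::real). 0 \<partial>lborel)"
        by (intro nn_integral_cong_AE) (auto elim: eventually_mono)
      then show ?thesis unfolding T_def by simp
    qed
  qed
qed

definition unit_clamp :: "real \<Rightarrow> real" where "unit_clamp s = max (-1) (min 1 s)"

lemma unit_clamp_lipschitz: "\<bar>unit_clamp s - unit_clamp t\<bar> \<le> \<bar>s - t\<bar>"
  by (auto simp: unit_clamp_def)

lemma unit_clamp_bound: "\<bar>unit_clamp s\<bar> \<le> 1" by (auto simp: unit_clamp_def)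

text \<open>The gradient of \<open>h/\<epsilon>\<close> is at most \<open>3/\<epsilon>\<close> where \<open>\<bar>h\<bar> \<le> \<epsilon>\<close>, and the clamped function is locally constant
elsewhere. Averaging along the direction \<open>\<nu>\<close>, in which \<open>h\<close> increases at a fixed rate, reduces the
integrability of \<open>1/\<epsilon>\<close> on the layer to the estimate on lines. The functions \<open>h\<close> and \<open>\<epsilon>\<close> are
differentiable almost everywhere by Rademacher's theorem; the kinks \<open>h = \<epsilon>\<close> and \<open>h = -\<epsilon>\<close> are null
because \<open>h - \<epsilon>\<close> and \<open>h + \<epsilon>\<close> still increase along \<open>\<nu>\<close>.\<close>

lemma layer_function_in_W11:
  fixes h \<epsilon> :: "real^'n::finite \<Rightarrow> real"
  assumes oO: "open \<Omega>" and bO: "bounded \<Omega>"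
    and hl: "2-lipschitz_on UNIV h" and el: "(1/8)-lipschitz_on UNIV \<epsilon>"
    and nu: "norm \<nu> = 1" and inc: "\<And>x t. t \<ge> 0 \<Longrightarrow> h (x + t *\<^sub>R \<nu>) - h x \<ge> t / 2"
    and epos: "\<And>x. x \<in> \<Omega> \<Longrightarrow> \<epsilon> x > 0"
  shows "(\<lambda>x. unit_clamp (h x / \<epsilon> x)) \<in> W11 \<Omega>"
proof -
  have hc: "continuous_on UNIV h" and ec: "continuous_on UNIV \<epsilon>"
    using hl el lipschitz_on_continuous_on by blast+
  have [measurable]: "h \<in> borel_measurable borel" "\<epsilon> \<in> borel_measurable borel"
    using hc ec by (auto intro: borel_measurable_continuous_onI)
  have h_lip: "\<bar>h x - h y\<bar> \<le> 2 * norm (x - y)" for x y using lipschitz_onD[OF hl, of x y] by (simp add: dist_norm)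
  have e_lip: "\<bar>\<epsilon> x - \<epsilon> y\<bar> \<le> norm (x - y) / 8" for x y using lipschitz_onD[OF el, of x y] by (simp add: dist_norm)
  define u where "u x = unit_clamp (h x / \<epsilon> x)" for x
  have um[measurable]: "u \<in> borel_measurable borel" unfolding u_def unit_clamp_def by measurable
  have ub: "\<bar>u x\<bar> \<le> 1" for x unfolding u_def by (rule unit_clamp_bound)
  have Os: "\<Omega> \<in> sets lebesgue" "\<Omega> \<in> lmeasurable" using oO bO by (auto intro: lmeasurable_open)
  have uint: "integrable (lebesgue_on \<Omega>) u"
  proof (rule Bochner_Integration.integrable_bound)
    show "integrable (lebesgue_on \<Omega>) (\<lambda>x. 1::real)" 
      using Os by (auto simp: integrable_restrict_space fmeasurable_def intro!: integrable_real_indicator)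
    show "u \<in> borel_measurable (lebesgue_on \<Omega>)" by (intro measurable_restrict_space1 measurable_completion) simp
  qed (use ub in auto)
  \<comment> \<open>the exceptional set, off which the layer function is differentiable\<close>
  define N where "N = {x. \<not> h differentiable (at x)} \<union> {x. \<not> \<epsilon> differentiable (at x)} \<union> {x. h x - \<epsilon> x = 0} \<union> {x. h x + \<epsilon> x = 0}"
  have N: "negligible N"
  proof -
    have 1: "h x - \<epsilon> x < h (x + t *\<^sub>R \<nu>) - \<epsilon> (x + t *\<^sub>R \<nu>)" "h x + \<epsilon> x < h (x + t *\<^sub>R \<nu>) + \<epsilon> (x + t *\<^sub>R \<nu>)" if "t > 0" for x t
    proof -
      have i: "h (x + t *\<^sub>R \<nu>) - h x \<ge> t / 2" using inc that by simp
      have "\<bar>\<epsilon> (x + t *\<^sub>R \<nu>) - \<epsilon> x\<bar> \<le> t / 8" using e_lip[of "x + t *\<^sub>R \<nu>" x] that nu by simp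
      then have "\<epsilon> (x + t *\<^sub>R \<nu>) - \<epsilon> x \<le> t / 8" "- (t / 8) \<le> \<epsilon> (x + t *\<^sub>R \<nu>) - \<epsilon> x" by (simp_all only: abs_le_iff) auto
      with i that show "h x - \<epsilon> x < h (x + t *\<^sub>R \<nu>) - \<epsilon> (x + t *\<^sub>R \<nu>)" "h x + \<epsilon> x < h (x + t *\<^sub>R \<nu>) + \<epsilon> (x + t *\<^sub>R \<nu>)" by argo+
    qed
    show ?thesis unfolding N_def
      by (intro negligible_Un rademacher[OF hl] rademacher[OF el] negligible_zeros_of_increasing_along[where e=\<nu>] 1
            continuous_intros hc ec)
  qed
  define L where "L x \<longleftrightarrow> \<bar>h x\<bar> \<le> \<epsilon> x \<and> \<epsilon> x > 0" for x
  have "\<exists>a. (u has_derivative (\<lambda>v. a \<bullet> v)) (at x) \<and> norm a \<le> (if L x then 3 / \<epsilon> x else 0)" if x: "x \<in> \<Omega> - N" for x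
  proof -
    have ex: "\<epsilon> x > 0" using x epos by auto
    consider (inside) "\<bar>h x\<bar> < \<epsilon> x" | (above) "h x > \<epsilon> x" | (below) "h x < - \<epsilon> x" using x unfolding N_def by fastforce
    then show ?thesis
    proof cases
      case inside
      obtain a where a: "(h has_derivative (\<lambda>v. a \<bullet> v)) (at x)" using x differentiable_imp_gradient[of h x] unfolding N_def by auto
      obtain b where b: "(\<epsilon> has_derivative (\<lambda>v. b \<bullet> v)) (at x)" using x differentiable_imp_gradient[of \<epsilon> x] unfolding N_def by auto
      have na: "norm a \<le> 2" "norm b \<le> 1/8" using norm_gradient_le_lipschitz[OF a hl] norm_gradient_le_lipschitz[OF b el] by auto
      define c where "c = (1 / \<epsilon> x) *\<^sub>R a - (h x / (\<epsilon> x * \<epsilon> x)) *\<^sub>R b"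
      have "((\<lambda>y. h y / \<epsilon> y) has_derivative (\<lambda>v. ((a \<bullet> v) * \<epsilon> x - h x * (b \<bullet> v)) / (\<epsilon> x * \<epsilon> x))) (at x)"
        by (rule has_derivative_divide'[OF a b]) (use ex in simp)
      moreover have "((a \<bullet> v) * \<epsilon> x - h x * (b \<bullet> v)) / (\<epsilon> x * \<epsilon> x) = c \<bullet> v" for v
        unfolding c_def using ex by (simp add: inner_diff_left diff_divide_distrib)
      ultimately have "((\<lambda>y. h y / \<epsilon> y) has_derivative (\<lambda>v. c \<bullet> v)) (at x)" by simp
      then have "(u has_derivative (\<lambda>v. c \<bullet> v)) (at x)"
      proof (rule has_derivative_transform_within_open)
        show "open {x. \<bar>h x\<bar> < \<epsilon> x}" by (intro open_Collect_less continuous_intros hc ec)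
        show "x \<in> {x. \<bar>h x\<bar> < \<epsilon> x}" using inside by simp
        fix y assume "y \<in> {x. \<bar>h x\<bar> < \<epsilon> x}"
        then have "\<bar>h y\<bar> < \<epsilon> y" "\<epsilon> y > 0" by auto
        then have "\<bar>h y / \<epsilon> y\<bar> < 1" by (simp add: abs_divide)
        then have "h y / \<epsilon> y < 1" "- 1 < h y / \<epsilon> y" by (simp_all only: abs_less_iff) auto
        then show "h y / \<epsilon> y = u y" unfolding u_def unit_clamp_def by simp
      qed
      moreover have "norm c \<le> 3 / \<epsilon> x"
      proof -
        have "norm c \<le> norm ((1 / \<epsilon> x) *\<^sub>R a) + norm ((h x / (\<epsilon> x * \<epsilon> x)) *\<^sub>R b)" unfolding c_def by (rule norm_triangle_ineq4)
        also have "\<dots> = (1 / \<epsilon> x) * norm a + (1 / \<epsilon> x) * ((\<bar>h x\<bar> / \<epsilon> x) * norm b)" using ex by (simp add: abs_mult abs_divide)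
        also have "\<dots> \<le> (1 / \<epsilon> x) * 2 + (1 / \<epsilon> x) * (1 * (1/8))"
          using inside na ex by (intro add_mono mult_left_mono mult_mono) (auto simp: divide_le_eq)
        also have "\<dots> \<le> 3 / \<epsilon> x" using ex by (simp add: field_simps)
        finally show ?thesis .
      qed
      ultimately show ?thesis using inside ex unfolding L_def by auto
    next
      case above
      have "(u has_derivative (\<lambda>v. 0)) (at x)"
      proof (rule has_derivative_transform_within_open[of "\<lambda>x. 1"])
        show "open {x. 0 < \<epsilon> x \<and> \<epsilon> x < h x}" by (intro open_Collect_conj open_Collect_less continuous_intros hc ec)
        show "1 = u y" if "y \<in> {x. 0 < \<epsilon> x \<and> \<epsilon> x < h x}" for y
          using that by (simp add: u_def unit_clamp_def min_def)
      qed (use above ex in auto)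
      then show ?thesis using ex above by (intro exI[of _ 0]) (auto simp: L_def)
    next
      case below
      have "(u has_derivative (\<lambda>v. 0)) (at x)"
      proof (rule has_derivative_transform_within_open[of "\<lambda>x. -1"])
        show "open {x. 0 < \<epsilon> x \<and> h x < - \<epsilon> x}" by (intro open_Collect_conj open_Collect_less continuous_intros hc ec)
        show "-1 = u y" if "y \<in> {x. 0 < \<epsilon> x \<and> h x < - \<epsilon> x}" for y
        proof -
          have "h y / \<epsilon> y < -1" using that by (simp add: divide_less_eq)
          then show ?thesis by (simp add: u_def unit_clamp_def)
        qed
      qed (use below ex in auto)
      then show ?thesis using ex below by (intro exI[of _ 0]) (auto simp: L_def)
    qed
  qed
  then obtain G where G: "\<And>x. x \<in> \<Omega> - N \<Longrightarrow> (u has_derivative (\<lambda>v. G x \<bullet> v)) (at x)"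
      "\<And>x. x \<in> \<Omega> - N \<Longrightarrow> norm (G x) \<le> (if L x then 3 / \<epsilon> x else 0)" by metis
  define g where "g x = (if x \<in> \<Omega> - N then G x else 0)" for x
  have Ns: "\<Omega> - N \<in> sets lebesgue" using Os N by (auto intro: negligible_imp_sets)
  have gm: "g \<in> borel_measurable lebesgue"
  proof (subst borel_measurable_euclidean_space, rule ballI)
    fix b :: "real^'n" assume "b \<in> Basis"
    define q where "q k x = indicator (\<Omega> - N) x * ((u (x + (1 / Suc k) *\<^sub>R b) - u x) / (1 / Suc k))" for k :: nat and x
    show "(\<lambda>x. g x \<bullet> b) \<in> borel_measurable lebesgue"
    proof (rule borel_measurable_LIMSEQ_real)
      show "q k \<in> borel_measurable lebesgue" for k unfolding q_def
        by (intro borel_measurable_times borel_measurable_indicator Ns measurable_completion) simp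
      show "(\<lambda>k. q k x) \<longlonglongrightarrow> g x \<bullet> b" for x
      proof (cases "x \<in> \<Omega> - N")
        case True
        have "filterlim (\<lambda>k. 1 / real (Suc k)) (at 0) sequentially"
          unfolding filterlim_at using LIMSEQ_inverse_real_of_nat by (simp add: inverse_eq_divide)
        from filterlim_compose[OF has_derivative_imp_difference_quotient[OF G(1)[OF True], of b] this]
        show ?thesis using True unfolding q_def g_def by simp
      next
        case False
        then show ?thesis unfolding q_def g_def by auto
      qed
    qed
  qed
  define F where "F x = ennreal (1 / \<epsilon> x) * indicator {x. L x \<and> x \<in> \<Omega>} x" for x
  have Lset: "{x. L x} \<in> sets borel" unfolding L_def by measurable
  have Fm[measurable]: "F \<in> borel_measurable borel" unfolding F_def
    using Lset oO sets.Int[OF Lset borel_open[OF oO]] by (intro borel_measurable_times_ennreal borel_measurable_indicator) (auto simp: Int_def)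
  obtain R where R: "\<Omega> \<subseteq> ball 0 R" using bounded_subset_ballD[OF bO] by blast
  have "(\<integral>\<^sup>+x. F x \<partial>lborel) = (\<integral>\<^sup>+x. \<integral>\<^sup>+t. F (x + t *\<^sub>R \<nu>) * indicator {0..1} t \<partial>lborel \<partial>lborel)"
    by (rule nn_integral_average_along_line) (rule Fm)
  also have "\<dots> \<le> (\<integral>\<^sup>+x. 12 * indicator (ball 0 (R + 1)) x \<partial>(lborel :: (real^'n) measure))"
  proof (rule nn_integral_mono)
    fix x
    show "(\<integral>\<^sup>+t. F (x + t *\<^sub>R \<nu>) * indicator {0..1} t \<partial>lborel) \<le> 12 * indicator (ball 0 (R + 1)) x"
    proof (cases "x \<in> ball 0 (R + 1)")
      case False
      have "F (x + t *\<^sub>R \<nu>) * indicator {0..1} t = 0" for t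
      proof (rule ccontr)
        assume "\<not> ?thesis"
        then have t: "t \<in> {0..1}" "x + t *\<^sub>R \<nu> \<in> \<Omega>" unfolding F_def by (auto simp: indicator_def split: if_splits)
        then have "norm (x + t *\<^sub>R \<nu>) < R" using R by auto
        then show False using False norm_diff_ineq[of x "t *\<^sub>R \<nu>"] nu t by auto
      qed
      then have "(\<lambda>t. F (x + t *\<^sub>R \<nu>) * indicator {0..1} t) = (\<lambda>t. 0)" by (rule ext)
      then show ?thesis by (simp only: nn_integral_0_iff_AE) simp
    next
      case True
      have "(\<integral>\<^sup>+t. F (x + t *\<^sub>R \<nu>) * indicator {0..1} t \<partial>lborel)
         \<le> (\<integral>\<^sup>+t. ennreal (1 / \<epsilon> (x + t *\<^sub>R \<nu>)) * indicator {t. \<bar>h (x + t *\<^sub>R \<nu>)\<bar> \<le> \<epsilon> (x + t *\<^sub>R \<nu>) \<and> \<epsilon> (x + t *\<^sub>R \<nu>) > 0} t \<partial>lborel)"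
        by (rule nn_integral_mono) (auto simp: F_def L_def indicator_def)
      also have "\<dots> \<le> 12"
      proof (rule nn_integral_transition_layer_line)
        show "h (x + t *\<^sub>R \<nu>) - h (x + s *\<^sub>R \<nu>) \<ge> (t - s) / 2" if "s \<le> t" for s t
          using inc[of "t - s" "x + s *\<^sub>R \<nu>"] that by (simp add: algebra_simps)
        show "\<bar>\<epsilon> (x + t *\<^sub>R \<nu>) - \<epsilon> (x + s *\<^sub>R \<nu>)\<bar> \<le> \<bar>t - s\<bar> / 8" for s t
          using e_lip[of "x + t *\<^sub>R \<nu>" "x + s *\<^sub>R \<nu>"] nu by (simp add: scaleR_diff_left[symmetric])
      qed measurable
      finally show ?thesis using True by simp
    qed
  qed
  also have "\<dots> < \<infinity>" using emeasure_lborel_ball_finite[of "0::real^'n" "R + 1"]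
    by (simp add: nn_integral_cmult_indicator ennreal_mult_less_top)
  finally have Ffin: "(\<integral>\<^sup>+x. F x \<partial>lborel) < \<infinity>" .
  have "integrable lebesgue g"
  proof (rule integrableI_bounded)
    have "(\<integral>\<^sup>+x. ennreal (norm (g x)) \<partial>lebesgue) \<le> (\<integral>\<^sup>+x. 3 * F x \<partial>lebesgue)"
    proof (rule nn_integral_mono)
      fix x
      show "ennreal (norm (g x)) \<le> 3 * F x"
      proof (cases "x \<in> \<Omega> - N")
        case True
        have e: "\<epsilon> x > 0" using True epos by auto
        have "ennreal (norm (g x)) \<le> ennreal (if L x then 3 / \<epsilon> x else 0)"
          using G(2)[OF True] True by (intro ennreal_leI) (simp add: g_def)
        also have "\<dots> = 3 * F x"
          using True e ennreal_mult[of 3 "1 / \<epsilon> x"] by (auto simp: F_def)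
        finally show ?thesis .
      next
        case False
        then have "g x = 0" unfolding g_def by (rule if_not_P)
        then show ?thesis by simp
      qed
    qed
    also have "\<dots> = 3 * (\<integral>\<^sup>+x. F x \<partial>lborel)" by (simp add: nn_integral_completion nn_integral_cmult)
    also have "\<dots> < \<infinity>" using Ffin by (simp add: ennreal_mult_less_top)
    finally show "(\<integral>\<^sup>+x. ennreal (norm (g x)) \<partial>lebesgue) < \<infinity>" .
  qed (rule gm)
  then have gint: "integrable (lebesgue_on \<Omega>) g"
    using Os by (subst integrable_restrict_space) (simp, rule integrable_mult_indicator)
  have "has_L1_gradient \<Omega> u g"
  proof (rule has_L1_gradient_if_differentiable[OF oO um ub _ N _ gint])
    show "(u has_derivative (\<bullet>) (g x)) (at x)" if "x \<in> \<Omega> - N" for x using G(1)[OF that] that by (simp add: g_def)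
    fix K :: "(real^'n) set" assume K: "compact K" "K \<subseteq> \<Omega>"
    show "\<exists>L. L-lipschitz_on K u"
    proof (cases "K = {}")
      case False
      obtain x0 where x0: "x0 \<in> K" "\<And>x. x \<in> K \<Longrightarrow> \<epsilon> x0 \<le> \<epsilon> x"
        using continuous_attains_inf[OF K(1) False continuous_on_subset[OF ec]] by auto
      define m where "m = \<epsilon> x0"
      have m: "m > 0" using x0 K epos unfolding m_def by auto
      obtain B where B: "\<And>x. x \<in> K \<Longrightarrow> \<bar>h x\<bar> \<le> B"
        using compact_imp_bounded[OF compact_continuous_image[OF continuous_on_subset[OF hc] K(1)]] unfolding bounded_iff by auto
      have B0: "B \<ge> 0" using B[OF x0(1)] by linarith
      \<comment> \<open>on \<open>K\<close> the width is at least \<open>m\<close> and the height at most \<open>B\<close>, which bounds the quotient \<open>h/\<epsilon>\<close>\<close>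
      have "\<bar>u x - u y\<bar> \<le> (2 / m + B / (8 * m * m)) * norm (x - y)" if xy: "x \<in> K" "y \<in> K" for x y
      proof -
        have e: "\<epsilon> x \<ge> m" "\<epsilon> y \<ge> m" using x0 xy unfolding m_def by auto
        have "\<bar>u x - u y\<bar> \<le> \<bar>h x / \<epsilon> x - h y / \<epsilon> y\<bar>" unfolding u_def by (rule unit_clamp_lipschitz)
        also have "h x / \<epsilon> x - h y / \<epsilon> y = (h x - h y) / \<epsilon> x + h y * (\<epsilon> y - \<epsilon> x) / (\<epsilon> x * \<epsilon> y)"
          using e m by (simp add: field_simps)
        also have "\<bar>\<dots>\<bar> \<le> \<bar>h x - h y\<bar> / \<epsilon> x + \<bar>h y\<bar> * \<bar>\<epsilon> y - \<epsilon> x\<bar> / (\<epsilon> x * \<epsilon> y)"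
          using e m by (intro order_trans[OF abs_triangle_ineq]) (simp add: abs_mult abs_divide)
        also have "\<dots> \<le> 2 * norm (x - y) / m + B * (norm (x - y) / 8) / (m * m)"
          using e m h_lip[of x y] e_lip[of y x] B[OF xy(2)] B0
          by (intro add_mono frac_le mult_mono) (auto simp: norm_minus_commute)
        also have "\<dots> = (2 / m + B / (8 * m * m)) * norm (x - y)" using m by (simp add: field_simps)
        finally show ?thesis .
      qed
      then have "(2 / m + B / (8 * m * m))-lipschitz_on K u"
        using m B0 by (intro lipschitz_onI) (auto simp: dist_norm)
      then show ?thesis by blast
    qed (auto intro: exI[of _ 0] simp: lipschitz_on_def)
  qed
  then show ?thesis using uint unfolding W11_def u_def[symmetric] u_def[abs_def, symmetric] by auto
qed

section \<open>Hausdorff null sets\<close>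

definition hausdorff_weight :: "nat \<Rightarrow> 'a::metric_space set \<Rightarrow> ennreal" where
  "hausdorff_weight m X = (if X = {} then 0 else ennreal (unit_ball_vol (real m) * (diameter X / 2) ^ m))"

lemma suminf_from_nat_into:
  assumes J: "countable J"
  shows "(\<Sum>n. if n \<in> to_nat_on J ` J then F (from_nat_into J n) else (0::ennreal)) = (\<integral>\<^sup>+j. F j \<partial>count_space J)"
proof -
  let ?g = "\<lambda>n. if n \<in> to_nat_on J ` J then F (from_nat_into J n) else (0::ennreal)"
  have "(\<Sum>n. ?g n) = (\<integral>\<^sup>+n. ?g n \<partial>count_space UNIV)" by (rule nn_integral_count_space_nat[symmetric])
  also have "\<dots> = (\<integral>\<^sup>+n. F (from_nat_into J n) * indicator (to_nat_on J ` J) n \<partial>count_space UNIV)"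
    by (rule nn_integral_cong) (auto simp: indicator_def)
  also have "\<dots> = (\<integral>\<^sup>+n. F (from_nat_into J n) \<partial>count_space (to_nat_on J ` J))"
    by (subst nn_integral_count_space_indicator) auto
  also have "\<dots> = (\<integral>\<^sup>+j. F (from_nat_into J (to_nat_on J j)) \<partial>count_space J)"
    by (rule nn_integral_bij_count_space[symmetric]) (use J in \<open>simp add: bij_betw_def inj_on_to_nat_on\<close>)
  also have "\<dots> = (\<integral>\<^sup>+j. F j \<partial>count_space J)"
    by (rule nn_integral_cong) (use J in simp)
  finally show ?thesis .
qed

lemma hausdorff_premeasure_le_suminf:
  assumes "A \<subseteq> (\<Union>i. C i)" "\<And>i::nat. bounded (C i) \<and> diameter (C i) \<le> \<delta>"
  shows "hausdorff_premeasure m \<delta> A \<le> (\<Sum>i. hausdorff_weight m (C i))"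
  unfolding hausdorff_premeasure_def hausdorff_weight_def by (rule INF_lower) (use assms in auto)

lemma hausdorff_premeasure_lessE:
  assumes "hausdorff_premeasure m \<delta> A < e"
  obtains C :: "nat \<Rightarrow> 'a::metric_space set" where "A \<subseteq> (\<Union>i. C i)" "\<And>i. bounded (C i) \<and> diameter (C i) \<le> \<delta>" "(\<Sum>i. hausdorff_weight m (C i)) < e"
  using assms unfolding hausdorff_premeasure_def hausdorff_weight_def INF_less_iff by auto

lemma hausdorff_premeasure_mono: "A \<subseteq> B \<Longrightarrow> hausdorff_premeasure m \<delta> A \<le> hausdorff_premeasure m \<delta> B"
  unfolding hausdorff_premeasure_def by (rule INF_superset_mono) auto

lemma hausdorff_premeasure_empty: "\<delta> \<ge> 0 \<Longrightarrow> hausdorff_premeasure m \<delta> {} = 0"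
  using hausdorff_premeasure_le_suminf[of "{}" "\<lambda>_. {}" \<delta> m] by (simp add: hausdorff_weight_def)

lemma hausdorff_premeasure_le_single:
  assumes "bounded A" "diameter A \<le> d" "d \<le> \<delta>"
  shows "hausdorff_premeasure m \<delta> A \<le> ennreal (unit_ball_vol (real m) * (d / 2) ^ m)"
proof -
  have d0: "0 \<le> diameter A" using assms(1) by (rule diameter_ge_0)
  have "hausdorff_premeasure m \<delta> A \<le> (\<Sum>i. hausdorff_weight m (if i = (0::nat) then A else {}))"
    by (rule hausdorff_premeasure_le_suminf) (use assms d0 in auto)
  also have "\<dots> = (\<Sum>i\<in>{0::nat}. hausdorff_weight m (if i = (0::nat) then A else {}))"
    by (rule suminf_finite) (auto simp: hausdorff_weight_def)
  also have "\<dots> \<le> ennreal (unit_ball_vol (real m) * (d / 2) ^ m)"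
    using assms d0 by (auto simp: hausdorff_weight_def intro!: ennreal_leI mult_left_mono power_mono)
  finally show ?thesis .
qed

lemma hausdorff_premeasure_UN_nat:
  fixes A :: "nat \<Rightarrow> 'a::metric_space set"
  shows "hausdorff_premeasure m \<delta> (\<Union>j. A j) \<le> (\<Sum>j. hausdorff_premeasure m \<delta> (A j))"
proof (cases "\<exists>j. hausdorff_premeasure m \<delta> (A j) = \<infinity>")
  case True
  then obtain j where j: "hausdorff_premeasure m \<delta> (A j) = \<infinity>" by blast
  have "hausdorff_premeasure m \<delta> (A j) \<le> (\<Sum>j. hausdorff_premeasure m \<delta> (A j))"
    using sum_le_suminf[of "\<lambda>j. hausdorff_premeasure m \<delta> (A j)" "{j}"] by simp
  then show ?thesis using j by (simp add: top_unique)
next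
  case False
  show ?thesis
  proof (rule ennreal_le_epsilon)
    fix e :: real assume e: "e > 0"
    have "\<exists>C :: nat \<Rightarrow> 'a set. A j \<subseteq> (\<Union>i. C i) \<and> (\<forall>i. bounded (C i) \<and> diameter (C i) \<le> \<delta>) \<and>
        (\<Sum>i. hausdorff_weight m (C i)) < hausdorff_premeasure m \<delta> (A j) + ennreal (e * (1/2) ^ Suc j)" for j
    proof -
      have "hausdorff_premeasure m \<delta> (A j) < hausdorff_premeasure m \<delta> (A j) + ennreal (e * (1/2) ^ Suc j)"
      proof -
        obtain x where x: "hausdorff_premeasure m \<delta> (A j) = ennreal x" "x \<ge> 0" using False by (cases "hausdorff_premeasure m \<delta> (A j)") auto
        have "0 < e * (1/2) ^ Suc j" using e by simp
        then show ?thesis unfolding x(1) using x(2) by (subst ennreal_plus[symmetric]) (auto intro!: ennreal_lessI)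
      qed
      then show ?thesis by (rule hausdorff_premeasure_lessE) blast
    qed
    then obtain C where C: "\<And>j. A j \<subseteq> (\<Union>i. C j i)" "\<And>j i. bounded (C j i) \<and> diameter (C j i) \<le> \<delta>"
        "\<And>j. (\<Sum>i. hausdorff_weight m (C j i)) < hausdorff_premeasure m \<delta> (A j) + ennreal (e * (1/2) ^ Suc j)" by metis
    define D where "D n = C (fst (prod_decode n)) (snd (prod_decode n))" for n
    have "hausdorff_premeasure m \<delta> (\<Union>j. A j) \<le> (\<Sum>n. hausdorff_weight m (D n))"
    proof (rule hausdorff_premeasure_le_suminf)
      show "(\<Union>j. A j) \<subseteq> (\<Union>n. D n)"
      proof
        fix x assume "x \<in> (\<Union>j. A j)"
        then obtain j i where "x \<in> C j i" using C(1) by blast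
        then have "x \<in> D (prod_encode (j, i))" by (simp add: D_def)
        then show "x \<in> (\<Union>n. D n)" by blast
      qed
    qed (use C in \<open>auto simp: D_def\<close>)
    also have "\<dots> = (\<Sum>j. \<Sum>i. hausdorff_weight m (C j i))"
      unfolding D_def using suminf_ennreal_2dimen[of "\<lambda>j. \<Sum>i. hausdorff_weight m (C j i)" "\<lambda>p. hausdorff_weight m (C (fst p) (snd p))"] by simp
    also have "\<dots> \<le> (\<Sum>j. hausdorff_premeasure m \<delta> (A j) + ennreal (e * (1/2) ^ Suc j))"
      by (intro suminf_le less_imp_le C(3) summableI)
    also have "\<dots> = (\<Sum>j. hausdorff_premeasure m \<delta> (A j)) + (\<Sum>j. ennreal (e * (1/2) ^ Suc j))"
      by (rule suminf_add[symmetric]) auto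
    also have "(\<Sum>j. ennreal (e * (1/2) ^ Suc j)) = ennreal e"
      using sums_mult[OF power_half_series, of e] e by (subst suminf_ennreal_eq[of _ "e * 1"]) auto
    finally show "hausdorff_premeasure m \<delta> (\<Union>j. A j) \<le> (\<Sum>j. hausdorff_premeasure m \<delta> (A j)) + ennreal e" .
  qed
qed

lemma hausdorff_premeasure_UN_countable:
  fixes A :: "'i \<Rightarrow> 'a::metric_space set"
  assumes J: "countable J" and d: "\<delta> \<ge> 0"
  shows "hausdorff_premeasure m \<delta> (\<Union>j\<in>J. A j) \<le> (\<integral>\<^sup>+j. hausdorff_premeasure m \<delta> (A j) \<partial>count_space J)"
proof -
  define A' where "A' n = (if n \<in> to_nat_on J ` J then A (from_nat_into J n) else {})" for n
  have "(\<Union>j\<in>J. A j) \<subseteq> (\<Union>n. A' n)"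
  proof
    fix x assume "x \<in> (\<Union>j\<in>J. A j)"
    then obtain j where "j \<in> J" "x \<in> A j" by blast
    then have "x \<in> A' (to_nat_on J j)" using J by (simp add: A'_def)
    then show "x \<in> (\<Union>n. A' n)" by blast
  qed
  then have "hausdorff_premeasure m \<delta> (\<Union>j\<in>J. A j) \<le> hausdorff_premeasure m \<delta> (\<Union>n. A' n)" by (rule hausdorff_premeasure_mono)
  also have "\<dots> \<le> (\<Sum>n. hausdorff_premeasure m \<delta> (A' n))" by (rule hausdorff_premeasure_UN_nat)
  also have "\<dots> = (\<Sum>n. if n \<in> to_nat_on J ` J then hausdorff_premeasure m \<delta> (A (from_nat_into J n)) else 0)"
    by (rule suminf_cong) (simp add: A'_def hausdorff_premeasure_empty[OF d])
  also have "\<dots> = (\<integral>\<^sup>+j. hausdorff_premeasure m \<delta> (A j) \<partial>count_space J)" by (rule suminf_from_nat_into[OF J])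
  finally show ?thesis .
qed

lemma hausdorff_measure_eq_0_iff: "hausdorff_measure m A = 0 \<longleftrightarrow> (\<forall>\<delta>>0. hausdorff_premeasure m \<delta> A = 0)"
  unfolding hausdorff_measure_def by (auto simp: SUP_eq_iff bot_ennreal[symmetric] SUP_bot_conv)

lemma hausdorff_null_mono: "hausdorff_measure m B = 0 \<Longrightarrow> A \<subseteq> B \<Longrightarrow> hausdorff_measure m A = 0"
  unfolding hausdorff_measure_eq_0_iff using hausdorff_premeasure_mono by (metis le_zero_eq)

lemma hausdorff_null_UN:
  assumes "countable J" "\<And>j. j \<in> J \<Longrightarrow> hausdorff_measure m (A j) = 0"
  shows "hausdorff_measure m (\<Union>j\<in>J. A j) = 0"
  unfolding hausdorff_measure_eq_0_iff
proof (intro allI impI)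
  fix \<delta> :: real assume d: "\<delta> > 0"
  have "hausdorff_premeasure m \<delta> (\<Union>j\<in>J. A j) \<le> (\<integral>\<^sup>+j. hausdorff_premeasure m \<delta> (A j) \<partial>count_space J)"
    by (rule hausdorff_premeasure_UN_countable) (use assms d in auto)
  also have "\<dots> = (\<integral>\<^sup>+j. 0 \<partial>count_space J)"
    by (rule nn_integral_cong) (use assms(2) d in \<open>auto simp: hausdorff_measure_eq_0_iff\<close>)
  finally show "hausdorff_premeasure m \<delta> (\<Union>j\<in>J. A j) = 0" by simp
qed

text \<open>A density estimate. By the Vitali covering lemma disjoint balls \<open>B(p,r)\<close> exist whose fivefold
enlargements cover \<open>S\<close>. The premeasures of the enlargements are bounded by integrals over the disjoint
balls, and these add up to at most the integral over \<open>V\<close>.\<close>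

lemma hausdorff_premeasure_image_le_integral:
  fixes S :: "'a::euclidean_space set" and G :: "'a \<Rightarrow> 'b::metric_space" and w :: "'a \<Rightarrow> ennreal"
  assumes [measurable]: "w \<in> borel_measurable borel" "V \<in> sets borel" and d: "\<delta> > 0"
    and loc: "\<And>p. p \<in> S \<Longrightarrow> \<exists>r. 0 < r \<and> r \<le> 1 \<and> ball p r \<subseteq> V \<and>
        hausdorff_premeasure m \<delta> (G ` (S \<inter> ball p (5 * r))) \<le> (\<integral>\<^sup>+x. w x * indicator (ball p r) x \<partial>lborel)"
  shows "hausdorff_premeasure m \<delta> (G ` S) \<le> (\<integral>\<^sup>+x. w x * indicator V x \<partial>lborel)"
proof -
  obtain r where r: "\<And>p. p \<in> S \<Longrightarrow> 0 < r p \<and> r p \<le> 1 \<and> ball p (r p) \<subseteq> V \<and>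
        hausdorff_premeasure m \<delta> (G ` (S \<inter> ball p (5 * r p))) \<le> (\<integral>\<^sup>+x. w x * indicator (ball p (r p)) x \<partial>lborel)"
    using loc by metis
  obtain C where C: "countable C" "C \<subseteq> S" "pairwise (\<lambda>i j. disjnt (ball i (r i)) (ball j (r j))) C"
     "S \<subseteq> (\<Union>i\<in>C. ball i (5 * r i))"
  proof (rule Vitali_covering_lemma_balls[where S=S and K=S and a="\<lambda>p. p" and r=r and B=1])
    show "S \<subseteq> (\<Union>p\<in>S. ball p (r p))" using r by force
  qed (use r in auto)
  have dj: "disjoint_family_on (\<lambda>i. ball i (r i)) C" using C(3) unfolding disjoint_family_on_def pairwise_def disjnt_def by fast
  have "hausdorff_premeasure m \<delta> (G ` S) \<le> hausdorff_premeasure m \<delta> (\<Union>p\<in>C. G ` (S \<inter> ball p (5 * r p)))"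
    by (rule hausdorff_premeasure_mono) (use C(4) in blast)
  also have "\<dots> \<le> (\<integral>\<^sup>+p. hausdorff_premeasure m \<delta> (G ` (S \<inter> ball p (5 * r p))) \<partial>count_space C)"
    by (rule hausdorff_premeasure_UN_countable) (use C d in auto)
  also have "\<dots> \<le> (\<integral>\<^sup>+p. \<integral>\<^sup>+x. w x * indicator (ball p (r p)) x \<partial>lborel \<partial>count_space C)"
    by (rule nn_integral_mono) (use r C(2) in auto)
  also have "\<dots> = (\<integral>\<^sup>+p. emeasure (density lborel w) (ball p (r p)) \<partial>count_space C)"
    by (rule nn_integral_cong) (simp add: emeasure_density)
  also have "\<dots> = emeasure (density lborel w) (\<Union>p\<in>C. ball p (r p))"
    by (rule emeasure_UN_countable[symmetric]) (use C dj in auto)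
  also have "\<dots> \<le> emeasure (density lborel w) V"
    by (rule emeasure_mono) (use r C(2) in auto)
  also have "\<dots> = (\<integral>\<^sup>+x. w x * indicator V x \<partial>lborel)" by (simp add: emeasure_density)
  finally show ?thesis .
qed

text \<open>The covering consists of balls, which are open, and is given explicitly rather than through the
premeasure, so that a compact set covered in this way has a whole neighbourhood that is covered.\<close>

lemma lipschitz_image_null_ball_cover:
  fixes f :: "real^'m::finite \<Rightarrow> 'b::euclidean_space"
  assumes lip: "L-lipschitz_on UNIV f" and S: "negligible S" and e: "e > 0" and d: "\<delta> > 0"
  obtains J :: "('b \<times> real) set" where "countable J" "f ` S \<subseteq> (\<Union>(a, r)\<in>J. ball a r)" "\<And>a r. (a, r) \<in> J \<Longrightarrow> 0 < r \<and> r \<le> \<delta>"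
    "(\<integral>\<^sup>+(a, r). ennreal (r ^ CARD('m)) \<partial>count_space J) \<le> ennreal e"
proof -
  let ?m = "CARD('m)"
  define M where "M = L + 1"
  have M: "M > 0" using lip by (simp add: M_def lipschitz_on_def)
  have fM: "dist (f x) (f y) \<le> M * dist x y" for x y
  proof -
    have "M * dist x y = L * dist x y + dist x y" by (simp add: M_def algebra_simps)
    then show ?thesis using lipschitz_onD[OF lip UNIV_I UNIV_I, of x y] zero_le_dist[of x y] by linarith
  qed
  define c where "c = (5 * M) ^ ?m / unit_ball_vol ?m"
  have vol: "unit_ball_vol ?m > 0" by simp
  have c: "c > 0" unfolding c_def using M by simp
  obtain V where V: "open V" "S \<subseteq> V" "(V - S) \<in> lmeasurable" "emeasure lebesgue (V - S) < ennreal (e / c)"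
    using sets_lebesgue_outer_open[of S "e / c"] S negligible_imp_sets e c by (metis divide_pos_pos)
  have Ve: "emeasure lborel V \<le> ennreal (e / c)"
  proof -
    have "emeasure lebesgue V = emeasure lebesgue ((V - S) \<union> S)" using V(2) by (simp add: Un_absorb2)
    also have "\<dots> = emeasure lebesgue (V - S)" using V(3) S by (intro emeasure_Un_null_set) (auto simp: negligible_iff_null_sets)
    finally show ?thesis using V by simp
  qed
  have "\<forall>p\<in>S. \<exists>r. 0 < r \<and> r \<le> 1 \<and> 5 * M * r \<le> \<delta> \<and> ball p r \<subseteq> V"
  proof
    fix p assume "p \<in> S"
    then obtain t where t: "t > 0" "ball p t \<subseteq> V" using V open_contains_ball by blast
    have "5 * M * min (min t 1) (\<delta> / (5 * M)) \<le> \<delta>"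
      using M mult_left_mono[of "min (min t 1) (\<delta> / (5 * M))" "\<delta> / (5 * M)" "5 * M"] by simp
    then show "\<exists>r. 0 < r \<and> r \<le> 1 \<and> 5 * M * r \<le> \<delta> \<and> ball p r \<subseteq> V"
      using t d M by (intro exI[of _ "min (min t 1) (\<delta> / (5 * M))"]) auto
  qed
  then obtain r where r: "\<And>p. p \<in> S \<Longrightarrow> 0 < r p \<and> r p \<le> 1 \<and> 5 * M * r p \<le> \<delta> \<and> ball p (r p) \<subseteq> V" by metis
  obtain C where C: "countable C" "C \<subseteq> S" "pairwise (\<lambda>i j. disjnt (ball i (r i)) (ball j (r j))) C"
     "S \<subseteq> (\<Union>i\<in>C. ball i (5 * r i))"
  proof (rule Vitali_covering_lemma_balls[where S=S and K=S and a="\<lambda>p. p" and r=r and B=1])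
    show "S \<subseteq> (\<Union>p\<in>S. ball p (r p))" using r by force
  qed (use r in auto)
  have dj: "disjoint_family_on (\<lambda>i. ball i (r i)) C" using C(3) unfolding disjoint_family_on_def pairwise_def disjnt_def by fast
  define F where "F p = (f p, 5 * M * r p)" for p
  show ?thesis
  proof (rule that[of "F ` C"])
    show "countable (F ` C)" using C by simp
    show "f ` S \<subseteq> (\<Union>(a, r)\<in>F ` C. ball a r)"
    proof
      fix y assume "y \<in> f ` S"
      then obtain x where x: "x \<in> S" "y = f x" by blast
      then obtain p where p: "p \<in> C" "dist p x < 5 * r p" using C(4) by auto
      have "dist (f p) (f x) \<le> M * dist p x" by (rule fM)
      also have "\<dots> < M * (5 * r p)" using p M by simp
      finally have "y \<in> ball (f p) (5 * M * r p)" using x by (simp add: mult_ac)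
      then show "y \<in> (\<Union>(a, r)\<in>F ` C. ball a r)" using p unfolding F_def by blast
    qed
    show "0 < s \<and> s \<le> \<delta>" if "(a, s) \<in> F ` C" for a s using that r C(2) M by (auto simp: F_def)
    have "(\<integral>\<^sup>+(a, r). ennreal (r ^ ?m) \<partial>count_space (F ` C)) \<le> (\<integral>\<^sup>+p. ennreal ((5 * M * r p) ^ ?m) \<partial>count_space C)"
    proof -
      obtain C' where C': "C' \<subseteq> C" "inj_on F C'" "F ` C = F ` C'"
        using subset_image_inj[of "F ` C" F C] by auto
      have "(\<integral>\<^sup>+z. (case z of (a, r) \<Rightarrow> ennreal (r ^ ?m)) \<partial>count_space (F ` C))
          = (\<integral>\<^sup>+p. (case F p of (a, r) \<Rightarrow> ennreal (r ^ ?m)) \<partial>count_space C')"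
        unfolding C'(3) by (rule nn_integral_bij_count_space[symmetric]) (use C' in \<open>simp add: bij_betw_def\<close>)
      also have "\<dots> = (\<integral>\<^sup>+p. ennreal ((5 * M * r p) ^ ?m) * indicator C' p \<partial>count_space UNIV)"
        unfolding F_def by (subst nn_integral_count_space_indicator) simp_all
      also have "\<dots> \<le> (\<integral>\<^sup>+p. ennreal ((5 * M * r p) ^ ?m) * indicator C p \<partial>count_space UNIV)"
        using C'(1) by (intro nn_integral_mono mult_left_mono) (auto simp: indicator_def)
      also have "\<dots> = (\<integral>\<^sup>+p. ennreal ((5 * M * r p) ^ ?m) \<partial>count_space C)"
        by (subst nn_integral_count_space_indicator) simp_all
      finally show ?thesis .
    qed
    also have "\<dots> = (\<integral>\<^sup>+p. ennreal c * emeasure lborel (ball p (r p)) \<partial>count_space C)"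
    proof (rule nn_integral_cong)
      fix p assume "p \<in> space (count_space C)"
      then have rp: "r p > 0" using r C(2) by auto
      have "ennreal c * emeasure lborel (ball p (r p)) = ennreal c * ennreal (unit_ball_vol ?m * r p ^ ?m)"
        using rp by (subst emeasure_ball) auto
      also have "\<dots> = ennreal (c * (unit_ball_vol ?m * r p ^ ?m))" using c rp by (intro ennreal_mult[symmetric]) auto
      also have "c * (unit_ball_vol ?m * r p ^ ?m) = (5 * M * r p) ^ ?m" using less_imp_neq[OF vol, symmetric] by (simp add: c_def power_mult_distrib)
      finally show "ennreal ((5 * M * r p) ^ ?m) = ennreal c * emeasure lborel (ball p (r p))" by simp
    qed
    also have "\<dots> = ennreal c * emeasure lborel (\<Union>p\<in>C. ball p (r p))"
      by (subst emeasure_UN_countable) (use C dj in \<open>auto simp: nn_integral_cmult\<close>)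
    also have "\<dots> \<le> ennreal c * ennreal (e / c)"
      using r C(2) V by (intro mult_left_mono order_trans[OF emeasure_mono Ve]) auto
    also have "\<dots> = ennreal e" using c e by (subst ennreal_mult[symmetric]) auto
    finally show "(\<integral>\<^sup>+(a, r). ennreal (r ^ ?m) \<partial>count_space (F ` C)) \<le> ennreal e" .
  qed
qed

lemma hausdorff_premeasure_le_ball_cover:
  fixes A :: "'b::euclidean_space set"
  assumes J: "countable J" "A \<subseteq> (\<Union>(a, r)\<in>J. ball a r)" "\<And>a r. (a, r) \<in> J \<Longrightarrow> 0 < r \<and> 2 * r \<le> \<delta>" and d: "\<delta> > 0"
  shows "hausdorff_premeasure m \<delta> A \<le> ennreal (unit_ball_vol m) * (\<integral>\<^sup>+(a, r). ennreal (r ^ m) \<partial>count_space J)"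
proof -
  have "hausdorff_premeasure m \<delta> A \<le> hausdorff_premeasure m \<delta> (\<Union>p\<in>J. ball (fst p) (snd p))"
    by (rule hausdorff_premeasure_mono) (use J(2) in \<open>auto simp: case_prod_beta\<close>)
  also have "\<dots> \<le> (\<integral>\<^sup>+p. hausdorff_premeasure m \<delta> (ball (fst p) (snd p)) \<partial>count_space J)"
    by (rule hausdorff_premeasure_UN_countable) (use J d in auto)
  also have "\<dots> \<le> (\<integral>\<^sup>+p. ennreal (unit_ball_vol m) * (case p of (a, r) \<Rightarrow> ennreal (r ^ m)) \<partial>count_space J)"
  proof (rule nn_integral_mono)
    fix p assume "p \<in> space (count_space J)"
    then obtain a r where p: "p = (a, r)" "0 < r" "2 * r \<le> \<delta>" using J(3) by (cases p) auto
    have "hausdorff_premeasure m \<delta> (ball a r) \<le> ennreal (unit_ball_vol m * (2 * r / 2) ^ m)"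
    proof (rule hausdorff_premeasure_le_single)
    qed (use p in auto)
    also have "\<dots> = ennreal (unit_ball_vol m) * ennreal (r ^ m)" using p by (simp add: ennreal_mult)
    finally show "hausdorff_premeasure m \<delta> (ball (fst p) (snd p)) \<le> ennreal (unit_ball_vol m) * (case p of (a, r) \<Rightarrow> ennreal (r ^ m))"
      using p by simp
  qed
  also have "\<dots> = ennreal (unit_ball_vol m) * (\<integral>\<^sup>+p. (case p of (a, r) \<Rightarrow> ennreal (r ^ m)) \<partial>count_space J)"
    by (rule nn_integral_cmult) auto
  finally show ?thesis .
qed

text \<open>Twice the radius bounds the diameter, so covering balls of radius \<open>\<delta>/2\<close> are admissible at scale
\<open>\<delta>\<close>.\<close>

lemma hausdorff_null_lipschitz_image_negligible:
  fixes f :: "real^'m::finite \<Rightarrow> 'b::euclidean_space"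
  assumes lip: "L-lipschitz_on UNIV f" and S: "negligible S"
  shows "hausdorff_measure CARD('m) (f ` S) = 0"
  unfolding hausdorff_measure_eq_0_iff
proof (intro allI impI)
  fix \<delta> :: real assume d: "\<delta> > 0"
  let ?m = "CARD('m)"
  have "hausdorff_premeasure ?m \<delta> (f ` S) \<le> 0 + ennreal e" if e: "e > 0" for e
  proof -
    have e': "e / unit_ball_vol ?m > 0" using e by simp
    have d2: "\<delta> / 2 > 0" using d by simp
    obtain J :: "('b \<times> real) set" where J: "countable J" "f ` S \<subseteq> (\<Union>(a, r)\<in>J. ball a r)" "\<And>a r. (a, r) \<in> J \<Longrightarrow> 0 < r \<and> r \<le> \<delta> / 2"
      "(\<integral>\<^sup>+(a, r). ennreal (r ^ ?m) \<partial>count_space J) \<le> ennreal (e / unit_ball_vol ?m)"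
      using lipschitz_image_null_ball_cover[OF lip S e' d2] by metis
    have "hausdorff_premeasure ?m \<delta> (f ` S) \<le> ennreal (unit_ball_vol ?m) * (\<integral>\<^sup>+(a, r). ennreal (r ^ ?m) \<partial>count_space J)"
      by (rule hausdorff_premeasure_le_ball_cover[OF J(1,2) _ d]) (use J(3) in force)
    also have "\<dots> \<le> ennreal (unit_ball_vol ?m) * ennreal (e / unit_ball_vol ?m)" by (intro mult_left_mono J(4)) auto
    also have "\<dots> = ennreal (unit_ball_vol ?m * (e / unit_ball_vol ?m))" using e by (intro ennreal_mult[symmetric]) auto
    also have "\<dots> = ennreal e" by (simp add: unit_ball_vol_pos[THEN less_imp_neq, symmetric])
    finally show ?thesis by simp
  qed
  then have "hausdorff_premeasure ?m \<delta> (f ` S) \<le> 0" by (rule ennreal_le_epsilon)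
  then show "hausdorff_premeasure ?m \<delta> (f ` S) = 0" by simp
qed

section \<open>Lipschitz images and flat cones\<close>

text \<open>Every vector can be moved into a coordinate hyperplane transversal to the kernel without changing its
image.\<close>

lemma singular_linear_image_eq_hyperplane_image:
  fixes A :: "real^'m::finite \<Rightarrow> 'b::real_vector"
  assumes lin: "linear A" and ker: "A e = 0" "e \<noteq> 0"
  obtains i where "range A \<subseteq> A ` {w. w $ i = 0}"
proof -
  obtain i where i: "e $ i \<noteq> 0" using ker(2) by (auto simp: vec_eq_iff)
  have "A w \<in> A ` {w. w $ i = 0}" for w
  proof (rule image_eqI)
    show "A w = A (w - (w $ i / e $ i) *\<^sub>R e)" using ker(1) by (simp add: linear_diff[OF lin] linear_scale[OF lin])
  qed (use i in simp)
  then show ?thesis using that by blast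
qed

text \<open>The image of a small ball lies close to the image of \<open>A\<close>, which is the Lipschitz image of a hyperplane
and hence null. Cover the compact set \<open>A ` cball 0 1\<close> by open balls of small total size; they
also cover an \<open>\<epsilon>\<close>-neighbourhood. Scaled by \<open>\<rho>\<close> and centred at \<open>f z\<close>, they cover
\<open>f ` ball z \<rho>\<close> as soon as \<open>f\<close> differs from its affine approximation by at most \<open>\<epsilon> \<rho>\<close> there.\<close>

lemma singular_point_small_image:
  fixes f :: "real^'m::finite \<Rightarrow> 'b::euclidean_space"
  assumes der: "(f has_derivative A) (at z)" and sing: "\<not> inj A" and tau: "\<tau> > 0" and d: "\<delta> > 0"
  shows "\<exists>\<rho>0>0. \<forall>\<rho>. 0 < \<rho> \<and> \<rho> < \<rho>0 \<longrightarrow> hausdorff_premeasure CARD('m) \<delta> (f ` ball z \<rho>) \<le> ennreal (\<tau> * \<rho> ^ CARD('m))"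
proof -
  let ?m = "CARD('m)"
  have bl: "bounded_linear A" using der by (rule has_derivative_bounded_linear)
  have lin: "linear A" using bl bounded_linear.linear by blast
  obtain e where e: "A e = 0" "e \<noteq> 0" using sing linear_injective_0[OF lin] by blast
  obtain i where i: "range A \<subseteq> A ` {w. w $ i = 0}" using singular_linear_image_eq_hyperplane_image[OF lin e] .
  obtain B where B: "B-lipschitz_on UNIV A"
  proof -
    obtain K where K: "K > 0" "\<And>x. norm (A x) \<le> norm x * K" using bounded_linear.pos_bounded[OF bl] by blast
    have "K-lipschitz_on UNIV A"
      by (rule lipschitz_onI) (use K in \<open>auto simp: dist_norm linear_diff[OF lin, symmetric] mult.commute\<close>)
    then show ?thesis by (rule that)
  qed
  have neg: "negligible {w :: real^'m. w $ i = 0}" by (rule negligible_standard_hyperplane_cart)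
  define v where "v = unit_ball_vol ?m"
  have v: "v > 0" unfolding v_def by simp
  have tv: "\<tau> / v > 0" using tau v by simp
  obtain J :: "('b \<times> real) set" where J: "countable J" "A ` {w. w $ i = 0} \<subseteq> (\<Union>(a, r)\<in>J. ball a r)" "\<And>a r. (a, r) \<in> J \<Longrightarrow> 0 < r \<and> r \<le> 1"
    "(\<integral>\<^sup>+(a, r). ennreal (r ^ ?m) \<partial>count_space J) \<le> ennreal (\<tau> / v)"
    using lipschitz_image_null_ball_cover[OF B neg tv zero_less_one] by metis
  let ?T = "A ` cball 0 1"
  let ?U = "\<Union>(a, r)\<in>J. ball a r"
  have TU: "?T \<subseteq> ?U" using i J(2) by blast
  have cT: "compact ?T" by (intro compact_continuous_image linear_continuous_on bl) auto
  have Tne: "?T \<noteq> {}" by auto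
  have oU: "open ?U" by auto
  obtain \<epsilon> where eps: "\<epsilon> > 0" "{x. infdist x ?T \<le> \<epsilon>} \<subseteq> ?U" using compact_in_open_separated[OF Tne cT oU TU] .
  obtain d0 where d0: "d0 > 0" "\<And>y. norm (y - z) < d0 \<Longrightarrow> norm (f y - f z - A (y - z)) \<le> \<epsilon> * norm (y - z)"
    using der eps(1) unfolding has_derivative_at_alt by blast
  show ?thesis
  proof (intro exI[of _ "min d0 (\<delta> / 2)"] conjI allI impI)
    show "min d0 (\<delta> / 2) > 0" using d0 d by simp
    fix \<rho> assume \<rho>: "0 < \<rho> \<and> \<rho> < min d0 (\<delta> / 2)"
    \<comment> \<open>the covering of \<open>?T\<close>, transported by \<open>q \<mapsto> f z + \<rho> q\<close>\<close>
    define F where "F = (\<lambda>(a, r). (f z + \<rho> *\<^sub>R a, \<rho> * r))"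
    have injF: "inj_on F J" unfolding F_def inj_on_def using \<rho> by auto
    have "hausdorff_premeasure ?m \<delta> (f ` ball z \<rho>) \<le> ennreal (unit_ball_vol ?m) * (\<integral>\<^sup>+(a, r). ennreal (r ^ ?m) \<partial>count_space (F ` J))"
    proof (rule hausdorff_premeasure_le_ball_cover[OF _ _ _ d])
      show "countable (F ` J)" using J by simp
      show "f ` ball z \<rho> \<subseteq> (\<Union>(a, r)\<in>F ` J. ball a r)"
      proof
        fix x assume "x \<in> f ` ball z \<rho>"
        then obtain y where y: "x = f y" "norm (y - z) < \<rho>" by (auto simp: dist_norm norm_minus_commute)
        define w where "w = (1 / \<rho>) *\<^sub>R (y - z)"
        define q where "q = (1 / \<rho>) *\<^sub>R (f y - f z)"
        have w: "w \<in> cball 0 1" 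
        proof -
          have "norm w = norm (y - z) / \<rho>" unfolding w_def norm_scaleR using \<rho> by simp
          then show ?thesis using y \<rho> by simp
        qed
        have "norm (f y - f z - A (y - z)) \<le> \<epsilon> * norm (y - z)" using d0(2)[of y] y \<rho> by simp
        also have "\<dots> \<le> \<epsilon> * \<rho>" using y eps by simp
        finally have n: "norm (f y - f z - A (y - z)) \<le> \<epsilon> * \<rho>" .
        have "q - A w = (1 / \<rho>) *\<^sub>R (f y - f z - A (y - z))"
          unfolding q_def w_def linear_scale[OF lin] by (simp add: scaleR_diff_right)
        then have "norm (q - A w) = norm (f y - f z - A (y - z)) / \<rho>" using \<rho> by simp
        also have "\<dots> \<le> \<epsilon>" using n \<rho> by (simp add: divide_le_eq)
        finally have "dist q (A w) \<le> \<epsilon>" by (simp add: dist_norm)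
        then have "infdist q ?T \<le> \<epsilon>" using infdist_le[of "A w" ?T q] w by auto
        then have "q \<in> ?U" using eps by blast
        then obtain a r where ar: "(a, r) \<in> J" "dist a q < r" by auto
        have "x = f z + \<rho> *\<^sub>R q" using y \<rho> by (simp add: q_def)
        then have "dist (f z + \<rho> *\<^sub>R a) x = \<rho> * dist a q" using \<rho> by (simp add: dist_norm scaleR_diff_right[symmetric])
        also have "\<dots> < \<rho> * r" using ar \<rho> by simp
        finally have "x \<in> ball (f z + \<rho> *\<^sub>R a) (\<rho> * r)" by simp
        moreover have "(f z + \<rho> *\<^sub>R a, \<rho> * r) \<in> F ` J" using ar unfolding F_def by force
        ultimately show "x \<in> (\<Union>(a, r)\<in>F ` J. ball a r)" by blast
      qed
      fix a' r' assume "(a', r') \<in> F ` J"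
      then obtain a r where "(a, r) \<in> J" "r' = \<rho> * r" unfolding F_def by auto
      then have r: "0 < r" "r \<le> 1" "r' = \<rho> * r" using J(3) by auto
      have "\<rho> * r \<le> \<rho>" using r \<rho> by (simp add: mult_left_le)
      then have "2 * r' \<le> \<delta>" using r(3) \<rho> by linarith
      then show "0 < r' \<and> 2 * r' \<le> \<delta>" using r \<rho> by simp
    qed
    also have "(\<integral>\<^sup>+(a, r). ennreal (r ^ ?m) \<partial>count_space (F ` J)) = (\<integral>\<^sup>+p. (case F p of (a, r) \<Rightarrow> ennreal (r ^ ?m)) \<partial>count_space J)"
      by (rule nn_integral_bij_count_space[symmetric]) (use injF in \<open>simp add: bij_betw_def\<close>)
    also have "\<dots> = (\<integral>\<^sup>+p. ennreal (\<rho> ^ ?m) * (case p of (a, r) \<Rightarrow> ennreal (r ^ ?m)) \<partial>count_space J)"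
      using \<rho> J(3) by (intro nn_integral_cong) (auto simp: F_def power_mult_distrib ennreal_mult less_imp_le)
    also have "\<dots> = ennreal (\<rho> ^ ?m) * (\<integral>\<^sup>+(a, r). ennreal (r ^ ?m) \<partial>count_space J)" by (rule nn_integral_cmult) auto
    also have "ennreal (unit_ball_vol ?m) * \<dots> \<le> ennreal v * (ennreal (\<rho> ^ ?m) * ennreal (\<tau> / v))"
      unfolding v_def[symmetric] by (intro mult_left_mono J(4)) auto
    also have "ennreal (\<rho> ^ ?m) * ennreal (\<tau> / v) = ennreal (\<rho> ^ ?m * (\<tau> / v))"
      using tv \<rho> by (intro ennreal_mult[symmetric]) auto
    also have "ennreal v * \<dots> = ennreal (v * (\<rho> ^ ?m * (\<tau> / v)))"
      using v tau \<rho> by (intro ennreal_mult[symmetric]) auto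
    also have "v * (\<rho> ^ ?m * (\<tau> / v)) = \<tau> * \<rho> ^ ?m" using v by simp
    finally show "hausdorff_premeasure ?m \<delta> (f ` ball z \<rho>) \<le> ennreal (\<tau> * \<rho> ^ ?m)" .
  qed
qed

text \<open>The preceding estimate holds with an arbitrarily small factor \<open>\<tau>\<close>, so the density estimate bounds the
premeasure by \<open>\<tau>\<close> times the volume of a ball.\<close>

lemma hausdorff_null_singular_image:
  fixes f :: "real^'m::finite \<Rightarrow> 'b::euclidean_space"
  assumes S: "\<And>z. z \<in> S \<Longrightarrow> \<exists>A. (f has_derivative A) (at z) \<and> \<not> inj A"
  shows "hausdorff_measure CARD('m) (f ` S) = 0"
proof -
  let ?m = "CARD('m)"
  have bdd: "hausdorff_measure ?m (f ` (S \<inter> ball 0 (real k))) = 0" for k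
    unfolding hausdorff_measure_eq_0_iff
  proof (intro allI impI)
    fix \<delta> :: real assume d: "\<delta> > 0"
    define c where "c = (5::real) ^ ?m / unit_ball_vol ?m"
    have vol: "unit_ball_vol ?m > 0" by simp
    have c: "c > 0" unfolding c_def by simp
    let ?V = "ball (0::real^'m) (real k + 1)"
    define W where "W = measure lborel ?V"
    have W: "emeasure lborel ?V = ennreal W" "W \<ge> 0" unfolding W_def
      using emeasure_lborel_ball_finite[of "0::real^'m" "real k + 1"] by (auto simp: emeasure_eq_ennreal_measure)
    have "hausdorff_premeasure ?m \<delta> (f ` (S \<inter> ball 0 (real k))) \<le> 0 + ennreal e" if e: "e > 0" for e
    proof -
      define \<tau> where "\<tau> = e / (c * (W + 1))"
      have tau: "\<tau> > 0" unfolding \<tau>_def using e c W by (intro divide_pos_pos mult_pos_pos) auto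
      have "hausdorff_premeasure ?m \<delta> (f ` (S \<inter> ball 0 (real k))) \<le> (\<integral>\<^sup>+x. ennreal (\<tau> * c) * indicator ?V x \<partial>lborel)"
      proof (rule hausdorff_premeasure_image_le_integral[OF _ _ d])
        fix p assume p: "p \<in> S \<inter> ball 0 (real k)"
        obtain A where A: "(f has_derivative A) (at p)" "\<not> inj A" using S p by blast
        obtain \<rho>0 where r0: "\<rho>0 > 0" "\<And>\<rho>. 0 < \<rho> \<Longrightarrow> \<rho> < \<rho>0 \<Longrightarrow> hausdorff_premeasure ?m \<delta> (f ` ball p \<rho>) \<le> ennreal (\<tau> * \<rho> ^ ?m)"
          using singular_point_small_image[OF A tau d] by blast
        define r where "r = min 1 (\<rho>0 / 10)"
        have r: "0 < r" "r \<le> 1" "5 * r < \<rho>0" unfolding r_def using r0 by auto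
        have "hausdorff_premeasure ?m \<delta> (f ` ((S \<inter> ball 0 (real k)) \<inter> ball p (5 * r))) \<le> hausdorff_premeasure ?m \<delta> (f ` ball p (5 * r))"
          by (rule hausdorff_premeasure_mono) auto
        also have "\<dots> \<le> ennreal (\<tau> * (5 * r) ^ ?m)" using r by (intro r0(2)) auto
        also have "\<tau> * (5 * r) ^ ?m = \<tau> * c * (unit_ball_vol ?m * r ^ ?m)" using less_imp_neq[OF vol, symmetric] by (simp add: c_def power_mult_distrib)
        also have "ennreal \<dots> = ennreal (\<tau> * c) * emeasure lborel (ball p r)"
          using r tau c by (subst emeasure_ball) (auto simp: ennreal_mult)
        also have "\<dots> = (\<integral>\<^sup>+x. ennreal (\<tau> * c) * indicator (ball p r) x \<partial>lborel)" by (subst nn_integral_cmult_indicator) auto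
        finally have *: "hausdorff_premeasure ?m \<delta> (f ` ((S \<inter> ball 0 (real k)) \<inter> ball p (5 * r))) \<le> (\<integral>\<^sup>+x. ennreal (\<tau> * c) * indicator (ball p r) x \<partial>lborel)" .
        have "ball p r \<subseteq> ?V"
        proof
          fix x assume "x \<in> ball p r"
          then show "x \<in> ?V" using p r(2) dist_triangle[of 0 x p] by (simp add: dist_commute)
        qed
        with r * show "\<exists>r. 0 < r \<and> r \<le> 1 \<and> ball p r \<subseteq> ?V \<and> hausdorff_premeasure ?m \<delta> (f ` ((S \<inter> ball 0 (real k)) \<inter> ball p (5 * r))) \<le> (\<integral>\<^sup>+x. ennreal (\<tau> * c) * indicator (ball p r) x \<partial>lborel)" by blast
      qed auto
      also have "\<dots> = ennreal (\<tau> * c) * ennreal W" unfolding W(1)[symmetric] by (subst nn_integral_cmult_indicator) auto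
      also have "\<dots> = ennreal (\<tau> * c * W)" using tau c W by (intro ennreal_mult[symmetric]) auto
      also have "\<dots> \<le> ennreal e"
      proof (rule ennreal_leI)
        have "\<tau> * c * W = e * (W / (W + 1))" using c unfolding \<tau>_def by simp
        also have "\<dots> \<le> e * 1" using e W by (intro mult_left_mono) (auto simp: divide_le_eq)
        finally show "\<tau> * c * W \<le> e" by simp
      qed
      finally show ?thesis by simp
    qed
    then have "hausdorff_premeasure ?m \<delta> (f ` (S \<inter> ball 0 (real k))) \<le> 0" by (rule ennreal_le_epsilon)
    then show "hausdorff_premeasure ?m \<delta> (f ` (S \<inter> ball 0 (real k))) = 0" by simp
  qed
  have "hausdorff_measure ?m (\<Union>k. f ` (S \<inter> ball 0 (real k))) = 0" by (rule hausdorff_null_UN) (use bdd in auto)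
  moreover have "f ` S \<subseteq> (\<Union>k. f ` (S \<inter> ball 0 (real k)))"
  proof
    fix y assume "y \<in> f ` S"
    then obtain x where x: "x \<in> S" "y = f x" by blast
    obtain k :: nat where "norm x < real k" using reals_Archimedean2 by blast
    then show "y \<in> (\<Union>k. f ` (S \<inter> ball 0 (real k)))" using x by (intro UN_I[of k]) auto
  qed
  ultimately show ?thesis by (rule hausdorff_null_mono)
qed

text \<open>For a unit vector \<open>\<nu>\<close> and \<open>0 \<le> \<eta> < 1\<close> such sets are exactly the subsets of Lipschitz graphs of slope
\<open>\<eta>/sqrt (1 - \<eta>\<^sup>2)\<close> over the hyperplane orthogonal to \<open>\<nu>\<close>.\<close>

definition cone_flat :: "real \<Rightarrow> 'a::real_inner \<Rightarrow> 'a set \<Rightarrow> bool" where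
  "cone_flat \<eta> \<nu> K \<longleftrightarrow> (\<forall>x\<in>K. \<forall>y\<in>K. \<bar>\<nu> \<bullet> (x - y)\<bar> \<le> \<eta> * norm (x - y))"

text \<open>Where the derivative \<open>A\<close> is injective, \<open>\<bar>f y - f z\<bar>\<close> is at least a multiple of \<open>\<bar>y - z\<bar>\<close>, while its
component normal to the range of \<open>A\<close> is \<open>o(\<bar>y - z\<bar>)\<close>. A normal exists because the dimension of the
range is smaller than that of the space. Countably many pieces suffice: the normal may be replaced by a
nearby direction from a dense set, and the scale at which the estimate holds by \<open>1/(k+1)\<close>; small balls
with centres in a dense set then confine pairs of points to this scale.\<close>

lemma lipschitz_range_decomposition:
  fixes f :: "real^'m::finite \<Rightarrow> 'b::euclidean_space"
  assumes lip: "L-lipschitz_on UNIV f" and dim: "CARD('m) < DIM('b)" and eta: "\<eta> > 0"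
  obtains I :: "('b \<times> nat \<times> (real^'m)) set" and \<nu> K Z where "countable I" "range f \<subseteq> Z \<union> (\<Union>i\<in>I. K i)"
    "hausdorff_measure CARD('m) Z = 0" "\<And>i. i \<in> I \<Longrightarrow> norm (\<nu> i) = 1 \<and> cone_flat \<eta> (\<nu> i) (K i)"
proof -
  let ?m = "CARD('m)"
  obtain D :: "'b set" where D: "countable D" "\<And>X. open X \<Longrightarrow> X \<noteq> {} \<Longrightarrow> \<exists>d\<in>D. d \<in> X"
    using countable_dense_exists by blast
  obtain Q :: "(real^'m) set" where Q: "countable Q" "\<And>X. open X \<Longrightarrow> X \<noteq> {} \<Longrightarrow> \<exists>d\<in>Q. d \<in> X"
    using countable_dense_exists by blast
  define P where "P = (\<lambda>(d :: 'b, k :: nat, q). {z \<in> ball q (1 / (2 * Suc k)). \<forall>y. norm (y - z) < 1 / Suc k \<longrightarrow> \<bar>sgn d \<bullet> (f y - f z)\<bar> \<le> \<eta> * norm (f y - f z)})"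
  define Nd where "Nd = {z. \<not> f differentiable (at z)}"
  define Sg where "Sg = {z. \<exists>A. (f has_derivative A) (at z) \<and> \<not> inj A}"
  define I where "I = (D - {0}) \<times> (UNIV :: nat set) \<times> Q"
  show ?thesis
  proof (rule that[where I=I and Z="f ` Nd \<union> f ` Sg" and K="\<lambda>i. f ` P i" and \<nu>="\<lambda>i. sgn (fst i)"])
    show "countable I" unfolding I_def using D Q by auto
    have 1: "hausdorff_measure ?m (f ` Nd) = 0" unfolding Nd_def
      by (rule hausdorff_null_lipschitz_image_negligible[OF lip rademacher[OF lip]])
    have 2: "hausdorff_measure ?m (f ` Sg) = 0" unfolding Sg_def by (rule hausdorff_null_singular_image) blast
    show "hausdorff_measure ?m (f ` Nd \<union> f ` Sg) = 0"
      using hausdorff_null_UN[of UNIV ?m "\<lambda>b. if b then f ` Nd else f ` Sg"] 1 2 by (simp add: UNIV_bool Un_commute)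
  next
    fix i assume "i \<in> I"
    then obtain d k q where i: "i = (d, k, q)" "d \<noteq> 0" unfolding I_def by (cases i) auto
    have "cone_flat \<eta> (sgn d) (f ` P i)"
      unfolding cone_flat_def
    proof (intro ballI)
      fix x y assume "x \<in> f ` P i" "y \<in> f ` P i"
      then obtain s t where st: "s \<in> P i" "t \<in> P i" "x = f s" "y = f t" by blast
      have "dist q s < 1 / (2 * Suc k)" "dist q t < 1 / (2 * Suc k)" using st by (auto simp: P_def i)
      then have "dist s t < 1 / (2 * Suc k) + 1 / (2 * Suc k)" using dist_triangle[of s t q] by (simp add: dist_commute)
      then have "norm (s - t) < 1 / Suc k" by (simp add: dist_norm field_simps)
      then show "\<bar>sgn d \<bullet> (x - y)\<bar> \<le> \<eta> * norm (x - y)" using st(2) unfolding st(3,4) P_def i by auto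
    qed
    then show "norm (sgn (fst i)) = 1 \<and> cone_flat \<eta> (sgn (fst i)) (f ` P i)" using i by (simp add: norm_sgn)
  next
    show "range f \<subseteq> f ` Nd \<union> f ` Sg \<union> (\<Union>i\<in>I. f ` P i)"
    proof
      fix x assume "x \<in> range f"
      then obtain z where z: "x = f z" by blast
      show "x \<in> f ` Nd \<union> f ` Sg \<union> (\<Union>i\<in>I. f ` P i)"
      proof (cases "z \<in> Nd \<union> Sg")
        case True
        then show ?thesis using z by blast
      next
        case False
        then obtain A where A: "(f has_derivative A) (at z)" unfolding Nd_def differentiable_def by auto
        then have inj: "inj A" using False unfolding Sg_def by auto
        have lin: "linear A" using A has_derivative_linear by blast
        obtain c where c: "c > 0" "\<And>w. norm (A w) \<ge> c * norm w"
          using linear_inj_bounded_below_pos[OF lin inj] by (metis mult.commute)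
        have "dim (range A) \<le> ?m" using dim_image_le[OF lin, of UNIV] by simp
        then have "dim (range A) < DIM('b)" using dim by simp
        then obtain \<nu>0 where nu0: "\<nu>0 \<noteq> 0" "\<And>y. y \<in> span (range A) \<Longrightarrow> orthogonal \<nu>0 y"
          using orthogonal_to_subspace_exists[of "range A"] by blast
        define \<nu> where "\<nu> = sgn \<nu>0"
        have nu: "norm \<nu> = 1" using nu0 by (simp add: \<nu>_def norm_sgn)
        have nuA: "\<nu> \<bullet> A w = 0" for w using nu0(2)[of "A w"] by (simp add: \<nu>_def sgn_div_norm orthogonal_def span_base)
        \<comment> \<open>the first bound gives \<open>\<bar>f y - f z\<bar> \<ge> (c/2) \<bar>y - z\<bar>\<close>, the second leaves \<open>\<eta>/2\<close> for the normal component\<close>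
        define \<epsilon> where "\<epsilon> = min (c / 2) (\<eta> * c / 4)"
        have eps: "\<epsilon> > 0" "\<epsilon> \<le> c / 2" "\<epsilon> \<le> \<eta> * c / 4" unfolding \<epsilon>_def using c eta by auto
        have "0 < min (1/2) (\<eta> / 8)" using eta by simp
        then have "ball \<nu> (min (1/2) (\<eta> / 8)) \<noteq> {}" unfolding ball_eq_empty not_le .
        then obtain d where d: "d \<in> D" "d \<in> ball \<nu> (min (1/2) (\<eta> / 8))" using D(2)[OF open_ball] by blast
        have nd: "norm (d - \<nu>) \<le> \<eta> / 8" "norm (d - \<nu>) < 1/2" using d by (auto simp: dist_norm norm_minus_commute)
        have d0: "d \<noteq> 0" using nd nu by auto
        have sd: "norm (sgn d - \<nu>) \<le> \<eta> / 4"
        proof -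
          have "norm (sgn d - d) = \<bar>1 - norm d\<bar>"
          proof -
            have "norm d *\<^sub>R sgn d = d" using d0 by (simp add: sgn_div_norm)
            then have "sgn d - d = (1 - norm d) *\<^sub>R sgn d" by (simp add: scaleR_left_diff_distrib)
            then show ?thesis using d0 by (simp add: norm_sgn)
          qed
          also have "\<dots> \<le> norm (d - \<nu>)" using norm_triangle_ineq3[of \<nu> d] nu by (simp add: norm_minus_commute)
          finally have "norm (sgn d - d) \<le> \<eta> / 8" using nd by simp
          then show ?thesis using nd norm_triangle_ineq[of "sgn d - d" "d - \<nu>"] by simp
        qed
        obtain r where r: "r > 0" "\<And>y. norm (y - z) < r \<Longrightarrow> norm (f y - f z - A (y - z)) \<le> \<epsilon> * norm (y - z)"
          using A eps(1) unfolding has_derivative_at_alt by blast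
        obtain k where k: "1 / Suc k < r" using nat_approx_posE[OF r(1)] .
        obtain q where q: "q \<in> Q" "q \<in> ball z (1 / (2 * Suc k))" using Q(2)[of "ball z (1 / (2 * Suc k))"] by auto
        have "\<bar>sgn d \<bullet> (f y - f z)\<bar> \<le> \<eta> * norm (f y - f z)" if y: "norm (y - z) < 1 / Suc k" for y
        proof -
          let ?F = "f y - f z"
          have n: "norm (?F - A (y - z)) \<le> \<epsilon> * norm (y - z)" using r(2)[of y] y k by simp
          have "c * norm (y - z) \<le> norm (A (y - z))" by (rule c(2))
          also have "\<dots> \<le> norm ?F + norm (?F - A (y - z))" by (metis norm_minus_commute norm_triangle_sub)
          also have "\<dots> \<le> norm ?F + c / 2 * norm (y - z)" using n mult_right_mono[OF eps(2), of "norm (y - z)"] by simp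
          finally have low: "c / 2 * norm (y - z) \<le> norm ?F" by simp
          have "\<nu> \<bullet> ?F = \<nu> \<bullet> (?F - A (y - z))" by (simp add: inner_diff_right nuA)
          then have "\<bar>\<nu> \<bullet> ?F\<bar> \<le> norm (?F - A (y - z))" using Cauchy_Schwarz_ineq2[of \<nu> "?F - A (y - z)"] nu by simp
          also have "\<dots> \<le> \<eta> * c / 4 * norm (y - z)" using n mult_right_mono[OF eps(3), of "norm (y - z)"] by simp
          also have "\<dots> = \<eta> / 2 * (c / 2 * norm (y - z))" by simp
          also have "\<dots> \<le> \<eta> / 2 * norm ?F" using low eta by (intro mult_left_mono) auto
          finally have 1: "\<bar>\<nu> \<bullet> ?F\<bar> \<le> \<eta> / 2 * norm ?F" .
          have "\<bar>(sgn d - \<nu>) \<bullet> ?F\<bar> \<le> norm (sgn d - \<nu>) * norm ?F" by (rule Cauchy_Schwarz_ineq2)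
          also have "\<dots> \<le> \<eta> / 4 * norm ?F" using sd by (rule mult_right_mono) simp
          finally have 2: "\<bar>(sgn d - \<nu>) \<bullet> ?F\<bar> \<le> \<eta> / 4 * norm ?F" .
          have "sgn d \<bullet> ?F = (sgn d - \<nu>) \<bullet> ?F + \<nu> \<bullet> ?F" by (simp add: inner_diff_left)
          then have "\<bar>sgn d \<bullet> ?F\<bar> \<le> \<eta> / 4 * norm ?F + \<eta> / 2 * norm ?F" using 1 2 abs_triangle_ineq[of "(sgn d - \<nu>) \<bullet> ?F" "\<nu> \<bullet> ?F"] by linarith
          also have "\<dots> \<le> \<eta> * norm ?F" using eta by (simp add: field_simps)
          finally show ?thesis .
        qed
        then have "z \<in> P (d, k, q)" using q unfolding P_def by (auto simp: dist_commute)
        moreover have "(d, k, q) \<in> I" unfolding I_def using d d0 q by auto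
        ultimately show ?thesis using z by blast
      qed
    qed
  qed
qed

section \<open>Heights above a flat cone, strips and half balls\<close>

text \<open>The signed height above the Lipschitz graph that extends \<open>K\<close>, an infimum of cones as in the McShane
extension. Defining it on the whole space avoids coordinates on the hyperplane orthogonal to \<open>\<nu>\<close>.\<close>

definition cone_height :: "real \<Rightarrow> 'a::real_inner \<Rightarrow> 'a set \<Rightarrow> 'a \<Rightarrow> real" where
  "cone_height \<eta> \<nu> K x = (INF y\<in>K. \<nu> \<bullet> (x - y) + \<eta> * norm (x - y))"

text \<open>Every term of the infimum has slope at least \<open>1 - \<eta> \<ge> 1/2\<close> in direction \<open>\<nu>\<close> and is Lipschitz with
constant \<open>1 + \<eta> \<le> 2\<close>. For \<open>p \<in> K\<close> the term of \<open>p\<close> bounds the height from above, and the cone condition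
bounds all other terms from below by \<open>\<nu> \<bullet> (x - p) - \<eta> \<bar>x - p\<bar>\<close>.\<close>

lemma cone_height_properties:
  fixes K :: "'a::real_inner set"
  assumes K: "K \<noteq> {}" and cone: "cone_flat \<eta> \<nu> K" and nu: "norm \<nu> = 1" and eta: "0 \<le> \<eta>" "\<eta> \<le> 1/2"
  shows "p \<in> K \<Longrightarrow> \<bar>cone_height \<eta> \<nu> K x - \<nu> \<bullet> (x - p)\<bar> \<le> \<eta> * norm (x - p)"
    and "t \<ge> 0 \<Longrightarrow> cone_height \<eta> \<nu> K (x + t *\<^sub>R \<nu>) - cone_height \<eta> \<nu> K x \<ge> t / 2"
    and "2-lipschitz_on UNIV (cone_height \<eta> \<nu> K)"
proof -
  let ?h = "cone_height \<eta> \<nu> K"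
  define T where "T x y = \<nu> \<bullet> (x - y) + \<eta> * norm (x - y)" for x y
  have h: "?h x = (INF y\<in>K. T x y)" for x by (simp add: cone_height_def T_def)
  have lower: "T x y \<ge> \<nu> \<bullet> (x - p) - \<eta> * norm (x - p)" if "p \<in> K" "y \<in> K" for x y p
  proof -
    have "\<nu> \<bullet> (p - y) \<ge> - (\<eta> * norm (p - y))" using cone that unfolding cone_flat_def by (meson abs_le_D2 minus_le_iff)
    moreover have "norm (p - y) \<le> norm (x - p) + norm (x - y)" using norm_triangle_ineq4[of "x - y" "x - p"] by simp
    then have "\<eta> * norm (p - y) \<le> \<eta> * norm (x - p) + \<eta> * norm (x - y)" using eta mult_left_mono by (metis distrib_left)
    moreover have "\<nu> \<bullet> (x - y) = \<nu> \<bullet> (x - p) + \<nu> \<bullet> (p - y)" by (simp add: inner_diff_right)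
    ultimately show ?thesis unfolding T_def by linarith
  qed
  obtain p0 where p0: "p0 \<in> K" using K by blast
  have bdd: "bdd_below (T x ` K)" for x using lower[OF p0] by (auto intro!: bdd_belowI2)
  have upper: "?h x \<le> T x y" if "y \<in> K" for x y unfolding h by (rule cINF_lower[OF bdd that])
  have great: "?h x \<ge> c" if "\<And>y. y \<in> K \<Longrightarrow> T x y \<ge> c" for x c unfolding h by (rule cINF_greatest[OF K that])
  show "\<bar>?h x - \<nu> \<bullet> (x - p)\<bar> \<le> \<eta> * norm (x - p)" if p: "p \<in> K" for x p
  proof -
    have "?h x \<le> \<nu> \<bullet> (x - p) + \<eta> * norm (x - p)" using upper[OF p, of x] by (simp add: T_def)
    moreover have "?h x \<ge> \<nu> \<bullet> (x - p) - \<eta> * norm (x - p)" by (rule great) (rule lower[OF p])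
    ultimately show ?thesis by (simp add: abs_le_iff)
  qed
  show "?h (x + t *\<^sub>R \<nu>) - ?h x \<ge> t / 2" if t: "t \<ge> 0" for x t
  proof -
    have "?h (x + t *\<^sub>R \<nu>) \<ge> ?h x + t / 2"
    proof (rule great)
      fix y assume y: "y \<in> K"
      have "\<nu> \<bullet> (x + t *\<^sub>R \<nu> - y) = \<nu> \<bullet> (x - y) + t"
        using nu by (simp add: inner_diff_right inner_add_right dot_square_norm)
      moreover have "norm (x - y) \<le> norm (x + t *\<^sub>R \<nu> - y) + t"
        using norm_triangle_ineq4[of "x + t *\<^sub>R \<nu> - y" "t *\<^sub>R \<nu>"] nu t by (simp add: algebra_simps)
      then have "\<eta> * norm (x - y) \<le> \<eta> * norm (x + t *\<^sub>R \<nu> - y) + \<eta> * t" using eta mult_left_mono by (metis distrib_left)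
      moreover have "\<eta> * t \<le> 1/2 * t" using eta t by (intro mult_right_mono) auto
      ultimately show "?h x + t / 2 \<le> T (x + t *\<^sub>R \<nu>) y" using upper[OF y, of x] unfolding T_def by linarith
    qed
    then show ?thesis by simp
  qed
  have one: "?h x \<le> ?h x' + 2 * norm (x - x')" for x x'
  proof -
    have "?h x' \<ge> ?h x - 2 * norm (x - x')"
    proof (rule great)
      fix y assume y: "y \<in> K"
      have "\<nu> \<bullet> (x - y) = \<nu> \<bullet> (x' - y) + \<nu> \<bullet> (x - x')" by (simp add: inner_diff_right)
      moreover have "\<nu> \<bullet> (x - x') \<le> norm (x - x')" using norm_cauchy_schwarz[of \<nu> "x - x'"] nu by simp
      moreover have "norm (x - y) \<le> norm (x' - y) + norm (x - x')" using norm_triangle_ineq[of "x' - y" "x - x'"] by simp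
      then have "\<eta> * norm (x - y) \<le> \<eta> * norm (x' - y) + \<eta> * norm (x - x')" using eta mult_left_mono by (metis distrib_left)
      moreover have "\<eta> * norm (x - x') \<le> 1 * norm (x - x')" using eta by (intro mult_right_mono) auto
      ultimately show "?h x - 2 * norm (x - x') \<le> T x' y" using upper[OF y, of x] unfolding T_def by linarith
    qed
    then show ?thesis by simp
  qed
  show "2-lipschitz_on UNIV ?h"
  proof (rule lipschitz_onI)
    fix x y
    show "dist (?h x) (?h y) \<le> 2 * dist x y"
      using one[of x y] one[of y x] by (simp add: dist_real_def dist_norm norm_minus_commute abs_le_iff)
  qed simp
qed

text \<open>Translates along \<open>\<nu>\<close> by at most \<open>r\<close> keep the strip in a ball of radius \<open>2r\<close>, and a line of direction \<open>\<nu>\<close>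
meets it in a segment of length \<open>2 s r\<close>. The bound does not depend on \<open>\<nu>\<close>.\<close>

lemma emeasure_strip_le:
  fixes p \<nu> :: "'a::euclidean_space"
  assumes nu: "norm \<nu> = 1" and r: "r > 0" and s: "s \<ge> 0"
  shows "emeasure lborel {x \<in> ball p r. \<bar>\<nu> \<bullet> (x - p)\<bar> \<le> s * r} \<le> ennreal (2 * s * 2 ^ DIM('a)) * emeasure lborel (ball p r)"
proof -
  define S where "S = {x \<in> ball p r. \<bar>\<nu> \<bullet> (x - p)\<bar> \<le> s * r}"
  have "closed {x. \<bar>\<nu> \<bullet> (x - p)\<bar> \<le> s * r}" by (intro closed_Collect_le continuous_intros)
  moreover have "S = ball p r \<inter> {x. \<bar>\<nu> \<bullet> (x - p)\<bar> \<le> s * r}" by (auto simp: S_def)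
  ultimately have [measurable]: "S \<in> sets borel" by auto
  have "emeasure lborel S = (\<integral>\<^sup>+x. indicator S x \<partial>lborel)" by simp
  also have "\<dots> = (\<integral>\<^sup>+x. \<integral>\<^sup>+t. indicator S (x + t *\<^sub>R (r *\<^sub>R \<nu>)) * indicator {0..1} t \<partial>lborel \<partial>lborel)"
    by (rule nn_integral_average_along_line) measurable
  also have "\<dots> \<le> (\<integral>\<^sup>+x. ennreal (2 * s) * indicator (ball p (2 * r)) x \<partial>lborel)"
  proof (rule nn_integral_mono)
    fix x
    show "(\<integral>\<^sup>+t. indicator S (x + t *\<^sub>R (r *\<^sub>R \<nu>)) * indicator {0..1} t \<partial>lborel) \<le> ennreal (2 * s) * indicator (ball p (2 * r)) x"
    proof (cases "x \<in> ball p (2 * r)")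
      case False
      have "indicator S (x + t *\<^sub>R (r *\<^sub>R \<nu>)) * indicator {0..1} t = (0::ennreal)" for t
      proof (rule ccontr)
        assume "\<not> ?thesis"
        then have t: "t \<in> {0..1}" "x + t *\<^sub>R (r *\<^sub>R \<nu>) \<in> ball p r" unfolding S_def by (auto simp: indicator_def split: if_splits)
        have "t * r \<le> r" using t r by (simp add: mult_left_le_one_le)
        then have "norm (t *\<^sub>R (r *\<^sub>R \<nu>)) \<le> r" using t r nu by (simp add: abs_mult)
        moreover have "norm (x - p) \<le> norm (x + t *\<^sub>R (r *\<^sub>R \<nu>) - p) + norm (t *\<^sub>R (r *\<^sub>R \<nu>))"
          using norm_triangle_ineq4[of "x + t *\<^sub>R (r *\<^sub>R \<nu>) - p" "t *\<^sub>R (r *\<^sub>R \<nu>)"] by (simp add: algebra_simps)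
        moreover have "norm (x + t *\<^sub>R (r *\<^sub>R \<nu>) - p) < r" using t(2) by (simp only: mem_ball dist_norm norm_minus_commute)
        moreover have "norm (x - p) \<ge> 2 * r" using False by (simp add: dist_norm norm_minus_commute)
        ultimately show False by linarith
      qed
      then have "(\<lambda>t. indicator S (x + t *\<^sub>R (r *\<^sub>R \<nu>)) * indicator {0..1} t) = (\<lambda>t. 0::ennreal)" by (rule ext)
      then show ?thesis by (simp only: nn_integral_0_iff_AE) simp
    next
      case True
      define a where "a = - (\<nu> \<bullet> (x - p)) / r"
      have "(\<integral>\<^sup>+t. indicator S (x + t *\<^sub>R (r *\<^sub>R \<nu>)) * indicator {0..1} t \<partial>lborel) \<le> (\<integral>\<^sup>+t. indicator {a - s..a + s} t \<partial>lborel)"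
      proof (rule nn_integral_mono)
        fix t :: real
        have "t \<in> {a - s..a + s}" if "x + t *\<^sub>R (r *\<^sub>R \<nu>) \<in> S"
        proof -
          have "\<nu> \<bullet> (x + t *\<^sub>R (r *\<^sub>R \<nu>) - p) = \<nu> \<bullet> (x - p) + t * r"
            using nu by (simp add: inner_diff_right inner_add_right dot_square_norm)
          also have "\<dots> = r * (t - a)" unfolding a_def using r by (simp add: field_simps)
          finally have "\<bar>r * (t - a)\<bar> \<le> s * r" using that unfolding S_def by simp
          then have "r * \<bar>t - a\<bar> \<le> r * s" using r by (simp add: abs_mult mult.commute)
          then have "\<bar>t - a\<bar> \<le> s" using r by simp
          then show ?thesis by (auto simp: abs_le_iff)
        qed
        then show "indicator S (x + t *\<^sub>R (r *\<^sub>R \<nu>)) * indicator {0..1} t \<le> (indicator {a - s..a + s} t :: ennreal)"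
          by (auto simp: indicator_def)
      qed
      also have "\<dots> = ennreal (2 * s)" using s by simp
      finally show ?thesis using True by simp
    qed
  qed
  also have "\<dots> = ennreal (2 * s) * emeasure lborel (ball p (2 * r))" by (subst nn_integral_cmult_indicator) auto
  also have "emeasure lborel (ball p (2 * r)) = ennreal (2 ^ DIM('a)) * emeasure lborel (ball p r)"
    using r by (simp add: emeasure_ball power_mult_distrib ennreal_mult[symmetric] mult_ac)
  finally show ?thesis using s unfolding S_def by (simp add: ennreal_mult mult.assoc)
qed

text \<open>Point reflection at \<open>p\<close> exchanges the two half balls.\<close>

lemma measure_half_ball_le:
  fixes p \<nu> :: "'a::euclidean_space"
  shows "measure lborel {x \<in> ball p r. \<nu> \<bullet> (x - p) < 0} \<le> measure lborel (ball p r) / 2"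
    and "measure lborel {x \<in> ball p r. \<nu> \<bullet> (x - p) > 0} \<le> measure lborel (ball p r) / 2"
proof -
  define N where "N = {x \<in> ball p r. \<nu> \<bullet> (x - p) < 0}"
  define P where "P = {x \<in> ball p r. \<nu> \<bullet> (x - p) > 0}"
  have "open {x. \<nu> \<bullet> (x - p) < 0}" "open {x. \<nu> \<bullet> (x - p) > 0}" by (intro open_Collect_less continuous_intros)+
  moreover have "N = ball p r \<inter> {x. \<nu> \<bullet> (x - p) < 0}" "P = ball p r \<inter> {x. \<nu> \<bullet> (x - p) > 0}" by (auto simp: N_def P_def)
  ultimately have o: "open N" "open P" by auto
  then have [measurable]: "N \<in> sets borel" "P \<in> sets borel" by auto
  have fin: "emeasure lborel X < \<infinity>" if "X \<subseteq> ball p r" for X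
    using emeasure_mono[OF that, of lborel] emeasure_lborel_ball_finite[of p r] by (simp add: le_less_trans)
  have "emeasure lborel N = emeasure lborel P"
  proof -
    have "emeasure lborel N = emeasure (density (distr lborel borel (\<lambda>x. 2 *\<^sub>R p + (-1) *\<^sub>R x)) (\<lambda>_. ennreal (\<bar>-1\<bar> ^ DIM('a)))) N"
      using lborel_affine[of "-1" "2 *\<^sub>R p"] by simp
    also have "\<dots> = emeasure (distr lborel borel (\<lambda>x. 2 *\<^sub>R p + (-1) *\<^sub>R x)) N" by (simp add: density_1)
    also have "\<dots> = emeasure lborel ((\<lambda>x. 2 *\<^sub>R p + (-1) *\<^sub>R x) -` N)" by (subst emeasure_distr) auto
    also have "(\<lambda>x. 2 *\<^sub>R p + (-1) *\<^sub>R x) -` N = P"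
      unfolding N_def P_def by (auto simp: dist_norm algebra_simps inner_diff_right norm_minus_commute scaleR_2)
    finally show ?thesis .
  qed
  then have eq: "measure lborel N = measure lborel P" by (simp add: measure_def)
  have NPsub: "N \<subseteq> ball p r" "P \<subseteq> ball p r" by (auto simp: N_def P_def)
  have "measure lborel (N \<union> P) = measure lborel N + measure lborel P"
    by (rule measure_Union) (use fin[OF NPsub(1)] fin[OF NPsub(2)] in simp_all, auto simp: N_def P_def)
  moreover have "measure lborel (N \<union> P) \<le> measure lborel (ball p r)"
    by (rule measure_mono_fmeasurable) (use NPsub fin[of "ball p r"] in \<open>auto simp: fmeasurable_def\<close>)
  ultimately show "measure lborel {x \<in> ball p r. \<nu> \<bullet> (x - p) < 0} \<le> measure lborel (ball p r) / 2"
    "measure lborel {x \<in> ball p r. \<nu> \<bullet> (x - p) > 0} \<le> measure lborel (ball p r) / 2"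
    using eq unfolding N_def P_def by auto
qed

section \<open>Dense boundary points\<close>

lemma frequently_dense_scales:
  assumes "upper_density \<Omega> p > ereal c" and b: "b > 0"
  obtains r where "0 < r" "r < b" "measure lebesgue (\<Omega> \<inter> ball p r) > c * measure lebesgue (ball p r)"
proof -
  have "\<not> (\<forall>\<^sub>F r in at_right 0. ereal (measure lebesgue (\<Omega> \<inter> ball p r) / measure lebesgue (ball p r)) \<le> ereal c)"
  proof
    assume "\<forall>\<^sub>F r in at_right 0. ereal (measure lebesgue (\<Omega> \<inter> ball p r) / measure lebesgue (ball p r)) \<le> ereal c"
    then have "upper_density \<Omega> p \<le> ereal c" unfolding upper_density_def by (rule Limsup_bounded)
    with assms(1) show False by simp
  qed
  then have "\<exists>r>0. r < b \<and> \<not> measure lebesgue (\<Omega> \<inter> ball p r) / measure lebesgue (ball p r) \<le> c"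
    using b unfolding eventually_at_right_field ereal_less_eq by blast
  then obtain r where r: "0 < r" "r < b" "c < measure lebesgue (\<Omega> \<inter> ball p r) / measure lebesgue (ball p r)" by auto
  have "measure lebesgue (ball p r) > 0" using content_ball_pos[OF r(1)] by simp
  then have "measure lebesgue (\<Omega> \<inter> ball p r) > c * measure lebesgue (ball p r)" using r(3) by (simp add: less_divide_eq)
  with r that show ?thesis by blast
qed

text \<open>The height \<open>h\<close> over \<open>K\<close> yields the layer function \<open>u\<close> on \<open>\<Omega>\<close>, and \<open>v\<close> is its extension. In a
ball \<open>B(p,r)\<close> in which \<open>\<Omega>\<close> has density larger than \<open>1/2 + \<delta>\<close>, outside the strip \<open>\<bar>\<nu> \<bullet> (x - p)\<bar> \<le> 2 \<eta> r\<close>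
the function \<open>u\<close> is the sign of \<open>\<nu> \<bullet> (x - p)\<close>: there \<open>\<bar>h\<bar> \<ge> \<eta> r\<close>, while \<open>\<epsilon> \<le> c r\<^sup>2 \<le> \<eta> r\<close> because
\<open>p\<close> lies outside \<open>\<Omega>\<close>. The strip has proportion at most \<open>\<delta>/2\<close> by the choice of \<open>\<eta>\<close>, so \<open>v \<ge> 1\<close>
and \<open>v \<le> -1\<close> each hold on a proportion \<open>\<delta>/2\<close> of the ball. The Poincare inequality and the
density estimate bound the premeasure by the integral of a multiple of the gradient over
\<open>{\<bar>h\<bar> < 1/(j+1)}\<close>. These sets shrink to \<open>{h = 0}\<close>, which is null.\<close>

theorem hausdorff_null_dense_points_on_cone_flat:
  fixes \<Omega> :: "(real^'n::finite) set"
  assumes ext: "W11_extension_domain \<Omega>" and bd: "bounded \<Omega>" and m: "CARD('n) = Suc m"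
    and nu: "norm \<nu> = 1" and cone: "cone_flat \<eta> \<nu> K" and eta: "0 < \<eta>" "\<eta> \<le> 1/2"
    and del: "\<delta> > 0" "8 * 2 ^ CARD('n) * \<eta> \<le> \<delta>"
  shows "hausdorff_measure m (K \<inter> {x \<in> frontier \<Omega>. upper_density \<Omega> x > ereal (1/2 + \<delta>)}) = 0"
proof (cases "K = {}")
  case True
  then show ?thesis unfolding hausdorff_measure_eq_0_iff by (simp add: hausdorff_premeasure_empty)
next
  case K: False
  let ?n = "CARD('n)"
  define H where "H = K \<inter> {x \<in> frontier \<Omega>. upper_density \<Omega> x > ereal (1/2 + \<delta>)}"
  have oO: "open \<Omega>" using ext by (simp add: W11_extension_domain_def)
  define h where "h = cone_height \<eta> \<nu> K"
  note ch = cone_height_properties[OF K cone nu less_imp_le[OF eta(1)] eta(2), folded h_def]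
  have hc: "continuous_on UNIV h" using ch(3) lipschitz_on_continuous_on by blast
  have h0: "h p = 0" if "p \<in> K" for p using ch(1)[OF that, of p] by simp

  \<comment> \<open>the width of the transition layer\<close>
  obtain R0 where R0: "\<Omega> \<subseteq> ball 0 R0" using bounded_subset_ballD[OF bd] by blast
  define R where "R = max 1 R0"
  have R: "R \<ge> 1" "\<Omega> \<subseteq> ball 0 R" using R0 by (auto simp: R_def)
  obtain i0 :: 'n where True by simp
  define y0 :: "real^'n" where "y0 = R *\<^sub>R axis i0 1"
  have y0: "y0 \<in> - \<Omega>" "norm y0 = R" using R by (auto simp: y0_def)
  define d where "d x = infdist x (- \<Omega>)" for x
  have d0: "d x = 0" if "x \<notin> \<Omega>" for x using that by (simp add: d_def)
  have dpos: "d x > 0" if "x \<in> \<Omega>" for x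
    unfolding d_def using that oO y0 by (intro infdist_pos_not_in_closed) auto
  have dlip: "\<bar>d x - d y\<bar> \<le> dist x y" for x y unfolding d_def by (rule infdist_triangle_abs)
  have dnn: "d x \<ge> 0" for x unfolding d_def by (rule infdist_nonneg)
  have dR: "d x \<le> 2 * R" for x
  proof (cases "x \<in> \<Omega>")
    case True
    have "d x \<le> dist x y0" unfolding d_def by (rule infdist_le[OF y0(1)])
    also have "\<dots> \<le> norm x + norm y0" by (simp add: dist_norm norm_triangle_ineq4)
    also have "\<dots> \<le> 2 * R" using True R y0 by auto
    finally show ?thesis .
  qed (use d0 R in auto)
  \<comment> \<open>\<open>d \<le> 2 R\<close>, so \<open>c d\<^sup>2\<close> has Lipschitz constant \<open>4 R c = 1/8\<close>\<close>
  define c where "c = 1 / (32 * R)"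
  have c: "c > 0" using R by (simp add: c_def)
  define \<epsilon> where "\<epsilon> x = c * (d x)\<^sup>2" for x
  have epos: "\<epsilon> x > 0" if "x \<in> \<Omega>" for x unfolding \<epsilon>_def using dpos[OF that] c by simp
  have el: "(1/8)-lipschitz_on UNIV \<epsilon>"
  proof (rule lipschitz_onI)
    fix x y
    have "\<epsilon> x - \<epsilon> y = c * ((d x - d y) * (d x + d y))"
      unfolding \<epsilon>_def by (simp add: power2_eq_square algebra_simps)
    then have "\<bar>\<epsilon> x - \<epsilon> y\<bar> = c * (\<bar>d x - d y\<bar> * \<bar>d x + d y\<bar>)" using c by (simp add: abs_mult)
    also have "\<dots> \<le> c * (dist x y * (4 * R))"
      using c dlip[of x y] dR[of x] dR[of y] dnn[of x] dnn[of y] by (intro mult_left_mono mult_mono) auto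
    also have "\<dots> = 1/8 * dist x y" using R by (simp add: c_def)
    finally show "dist (\<epsilon> x) (\<epsilon> y) \<le> 1/8 * dist x y" by (simp add: dist_real_def)
  qed simp
  define u where "u x = unit_clamp (h x / \<epsilon> x)" for x
  have uW: "u \<in> W11 \<Omega>" unfolding u_def[abs_def]
    by (rule layer_function_in_W11[OF oO bd ch(3) el nu ch(2) epos])
  from ext[unfolded W11_extension_domain_def, THEN conjunct2, THEN conjunct2]
  obtain T and M :: real where TM: "M > 0 \<and> (\<forall>u\<in>W11 \<Omega>. T u \<in> W11 UNIV) \<and>
        (\<forall>u\<in>W11 \<Omega>. \<forall>v\<in>W11 \<Omega>. (AE x in lebesgue_on \<Omega>. u x = v x) \<longrightarrow> (AE x in lebesgue. T u x = T v x)) \<and>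
        (\<forall>u\<in>W11 \<Omega>. (AE x in lebesgue_on \<Omega>. T u x = u x) \<and> W11_norm UNIV (T u) \<le> M * W11_norm \<Omega> u)"
    by (elim exE)
  note T = TM[THEN conjunct2, THEN conjunct1] TM[THEN conjunct2, THEN conjunct2, THEN conjunct2]
  define v0 where "v0 = T u"
  have v0: "v0 \<in> W11 UNIV" "AE x in lebesgue_on \<Omega>. v0 x = u x"
    unfolding v0_def using T(1)[THEN bspec, OF uW] T(2)[THEN bspec, OF uW, THEN conjunct1] .
  obtain v g where v: "integrable lborel v" and g: "integrable lborel (g :: real^'n \<Rightarrow> real^'n)" and vv0: "AE x in lebesgue. v0 x = v x"
    and weak: "\<And>\<phi> i. \<phi> \<in> test_functions UNIV \<Longrightarrow> (\<integral>x. v x * partial_deriv i \<phi> x \<partial>lborel) = - (\<integral>x. g x $ i * \<phi> x \<partial>lborel)"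
    by (rule borel_representative_of_W11[OF v0(1)], rule that)
  have [measurable]: "v \<in> borel_measurable borel" "g \<in> borel_measurable borel" using v g by auto
  have "AE x in lebesgue. x \<in> \<Omega> \<longrightarrow> v0 x = u x" using v0(2) oO by (subst (asm) AE_restrict_space_iff) auto
  then have vu: "AE x in lebesgue. x \<in> \<Omega> \<longrightarrow> v x = u x" using vv0 by eventually_elim auto
  obtain N where N: "N \<in> null_sets lebesgue" "{x. \<not> (x \<in> \<Omega> \<longrightarrow> v x = u x)} \<subseteq> N"
    using vu unfolding eventually_ae_filter by auto

  \<comment> \<open>the ratio of the premeasure of \<open>B(p,5r)\<close> to the lower bound for the gradient on \<open>B(p,r)\<close>; the radius cancels\<close>
  define C where "C = unit_ball_vol m * 5 ^ m * 8 * 2 ^ ?n / (\<delta>\<^sup>2 * unit_ball_vol ?n)"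
  have voln: "unit_ball_vol ?n > 0" and volm: "unit_ball_vol m > 0" by simp_all
  have C: "C \<ge> 0" unfolding C_def using volm voln del by simp
  define w where "w x = ennreal (C * norm (g x))" for x
  have wm[measurable]: "w \<in> borel_measurable borel" unfolding w_def by measurable
  define V where "V j = {x. \<bar>h x\<bar> < 1 / real (Suc j)}" for j
  have oV: "open (V j)" for j unfolding V_def by (intro open_Collect_less continuous_intros hc)

  have bound: "hausdorff_premeasure m \<delta>' H \<le> emeasure (density lborel w) (V j)" if d': "\<delta>' > 0" for \<delta>' j
  proof -
    have "hausdorff_premeasure m \<delta>' ((\<lambda>x. x) ` H) \<le> (\<integral>\<^sup>+x. w x * indicator (V j) x \<partial>lborel)"
    proof (rule hausdorff_premeasure_image_le_integral[OF wm _ d'])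
      show "V j \<in> sets borel" using oV by simp
      fix p assume "p \<in> H"
      then have p: "p \<in> K" "p \<in> frontier \<Omega>" "upper_density \<Omega> p > ereal (1/2 + \<delta>)" by (auto simp: H_def)
      have pO: "p \<notin> \<Omega>" using p(2) oO by (simp add: frontier_def interior_open)
      have "p \<in> V j" using h0[OF p(1)] by (simp add: V_def)
      then obtain b0 where b0: "b0 > 0" "ball p b0 \<subseteq> V j" using oV open_contains_ball by blast
      \<comment> \<open>\<open>10 r \<le> \<delta>'\<close> makes \<open>B(p,5r)\<close> admissible at scale \<open>\<delta>'\<close>, and \<open>c r \<le> \<eta>\<close> makes the layer thinner than the strip\<close>
      define b where "b = min (min 1 b0) (min (\<delta>' / 10) (\<eta> / c))"
      have "b > 0" unfolding b_def using b0 d' eta c by simp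
      then obtain r where r: "0 < r" "r < b" and dens: "measure lebesgue (\<Omega> \<inter> ball p r) > (1/2 + \<delta>) * measure lebesgue (ball p r)"
        using frequently_dense_scales[OF p(3)] by blast
      have rb: "r \<le> 1" "r < b0" "10 * r \<le> \<delta>'" "c * r \<le> \<eta>" using r c by (auto simp: b_def field_simps)
      let ?B = "ball p r"
      define \<beta> where "\<beta> = measure lborel ?B"
      have Bfin: "emeasure lborel ?B = ennreal \<beta>" unfolding \<beta>_def
        using emeasure_lborel_ball_finite[of p r] by (intro emeasure_eq_ennreal_measure) auto
      have beta: "\<beta> = unit_ball_vol ?n * r ^ Suc m" unfolding \<beta>_def using r m content_ball[of r p] by simp
      have bpos: "\<beta> > 0" unfolding beta using voln r by simp
      define strip where "strip = {x \<in> ?B. \<bar>\<nu> \<bullet> (x - p)\<bar> \<le> (2 * \<eta>) * r}"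
      have sm: "strip \<in> sets lborel"
      proof -
        have "closed {x. \<bar>\<nu> \<bullet> (x - p)\<bar> \<le> (2 * \<eta>) * r}" by (intro closed_Collect_le continuous_intros)
        moreover have "strip = ?B \<inter> {x. \<bar>\<nu> \<bullet> (x - p)\<bar> \<le> (2 * \<eta>) * r}" by (auto simp: strip_def)
        ultimately show ?thesis by auto
      qed
      have strip: "emeasure lborel strip \<le> ennreal (\<delta> / 2 * \<beta>)"
      proof -
        have "emeasure lborel strip \<le> ennreal (2 * (2 * \<eta>) * 2 ^ DIM(real^'n)) * emeasure lborel ?B"
          unfolding strip_def by (rule emeasure_strip_le[OF nu r(1)]) (use eta in simp)
        also have "\<dots> = ennreal (2 * (2 * \<eta>) * 2 ^ ?n * \<beta>)" unfolding Bfin using eta bpos by (subst ennreal_mult) auto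
        also have "\<dots> \<le> ennreal (\<delta> / 2 * \<beta>)"
          using del(2) bpos by (intro ennreal_leI mult_right_mono) (auto simp: mult_ac)
        finally show ?thesis .
      qed
      \<comment> \<open>away from the strip the extension takes the value \<open>\<plusminus>1\<close> on \<open>\<Omega>\<close>\<close>
      have val: "u x = sgn (\<nu> \<bullet> (x - p))" if x: "x \<in> \<Omega>" "x \<in> ?B" "x \<notin> strip" for x
      proof -
        have xp: "norm (x - p) < r" using x(2) by (simp add: dist_norm norm_minus_commute)
        have big: "\<bar>\<nu> \<bullet> (x - p)\<bar> > 2 * \<eta> * r" using x by (simp add: strip_def)
        have "\<eta> * norm (x - p) \<le> \<eta> * r" using xp eta by simp
        then have hh: "\<bar>h x - \<nu> \<bullet> (x - p)\<bar> \<le> \<eta> * r" using ch(1)[OF p(1), of x] by linarith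
        have "d x \<le> dist x p" using dlip[of x p] d0[OF pO] by simp
        then have "d x \<le> r" using xp by (simp add: dist_norm)
        then have "(d x)\<^sup>2 \<le> r * r" unfolding power2_eq_square using dnn[of x] by (intro mult_mono) auto
        then have "\<epsilon> x \<le> c * r * r" unfolding \<epsilon>_def using c by simp
        also have "\<dots> \<le> \<eta> * r" using rb r by (intro mult_right_mono) auto
        finally have e1: "\<epsilon> x \<le> \<eta> * r" .
        have e0: "\<epsilon> x > 0" by (rule epos[OF x(1)])
        have er: "\<eta> * r > 0" using eta r by simp
        show ?thesis
        proof (cases "\<nu> \<bullet> (x - p) > 0")
          case True
          then have "h x \<ge> \<epsilon> x" using hh big e1 by linarith
          then have "h x / \<epsilon> x \<ge> 1" using e0 by simp
          then show ?thesis using True by (simp add: u_def unit_clamp_def)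
        next
          case False
          then have neg: "\<nu> \<bullet> (x - p) < 0" using big er by linarith
          then have "h x \<le> - \<epsilon> x" using hh big e1 by linarith
          then have "h x / \<epsilon> x \<le> - 1" using e0 by (simp add: divide_le_eq)
          then show ?thesis using neg by (simp add: u_def unit_clamp_def)
        qed
      qed
      define Ap where "Ap = {x \<in> ?B. v x \<ge> 1}"
      define Am where "Am = {x \<in> ?B. v x \<le> - 1}"
      have Aps: "Ap \<in> sets borel" "Am \<in> sets borel"
      proof -
        have "{x. v x \<ge> 1} \<in> sets borel" "{x. v x \<le> -1} \<in> sets borel" by measurable
        moreover have "Ap = ?B \<inter> {x. v x \<ge> 1}" "Am = ?B \<inter> {x. v x \<le> -1}" by (auto simp: Ap_def Am_def)
        ultimately show "Ap \<in> sets borel" "Am \<in> sets borel" by auto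
      qed
      \<comment> \<open>each side of the hyperplane fills half of the ball, so \<open>\<Omega>\<close> reaches to the other side\<close>
      have large: "ennreal (\<delta> / 2 * \<beta>) \<le> emeasure lborel X"
        if X: "X \<in> sets borel" "X \<subseteq> ?B" and Y: "Y \<in> sets borel" "measure lborel Y \<le> \<beta> / 2" "Y \<subseteq> ?B"
          and cov: "\<Omega> \<inter> ?B \<subseteq> X \<union> Y \<union> strip \<union> N" for X Y
      proof -
        have fin: "emeasure lborel Z = ennreal (measure lborel Z)" if "Z \<subseteq> ?B" for Z
          using emeasure_mono[OF that, of lborel] Bfin by (intro emeasure_eq_ennreal_measure) (auto simp: top_unique)
        have "ennreal ((1/2 + \<delta>) * \<beta>) \<le> ennreal (measure lebesgue (\<Omega> \<inter> ?B))"
          using dens by (intro ennreal_leI) (simp add: \<beta>_def)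
        also have "\<dots> = emeasure lebesgue (\<Omega> \<inter> ?B)" using oO fin[of "\<Omega> \<inter> ?B"] by simp
        also have "\<dots> \<le> emeasure lebesgue (X \<union> Y \<union> strip \<union> N)"
          by (rule emeasure_mono[OF cov]) (use X Y sm N in auto)
        also have "\<dots> = emeasure lebesgue (X \<union> Y \<union> strip)" by (rule emeasure_Un_null_set) (use X Y sm N in auto)
        also have "\<dots> = emeasure lborel (X \<union> Y \<union> strip)" using X Y sm by simp
        also have "\<dots> \<le> emeasure lborel X + emeasure lborel Y + emeasure lborel strip"
          using X Y sm by (intro order_trans[OF emeasure_subadditive] add_right_mono emeasure_subadditive) auto
        also have "\<dots> \<le> ennreal (measure lborel X) + ennreal (\<beta> / 2) + ennreal (\<delta> / 2 * \<beta>)"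
          using strip fin[OF X(2)] fin[OF Y(3)] Y(2) by (intro add_mono) (auto intro: ennreal_leI)
        also have "\<dots> = ennreal (measure lborel X + \<beta> / 2 + \<delta> / 2 * \<beta>)"
          using bpos del by simp
        finally have "(1/2 + \<delta>) * \<beta> \<le> measure lborel X + \<beta> / 2 + \<delta> / 2 * \<beta>"
          using bpos del by (subst (asm) ennreal_le_iff) auto
        then have "\<delta> / 2 * \<beta> \<le> measure lborel X" by (simp add: algebra_simps)
        then show ?thesis unfolding fin[OF X(2)] by (rule ennreal_leI)
      qed
      have halfm: "{x \<in> ?B. \<nu> \<bullet> (x - p) < 0} \<in> sets borel" "{x \<in> ?B. \<nu> \<bullet> (x - p) > 0} \<in> sets borel"
      proof -
        have "open {x. \<nu> \<bullet> (x - p) < 0}" "open {x. \<nu> \<bullet> (x - p) > 0}" by (intro open_Collect_less continuous_intros)+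
        moreover have "{x \<in> ?B. \<nu> \<bullet> (x - p) < 0} = ?B \<inter> {x. \<nu> \<bullet> (x - p) < 0}" "{x \<in> ?B. \<nu> \<bullet> (x - p) > 0} = ?B \<inter> {x. \<nu> \<bullet> (x - p) > 0}" by auto
        ultimately show "{x \<in> ?B. \<nu> \<bullet> (x - p) < 0} \<in> sets borel" "{x \<in> ?B. \<nu> \<bullet> (x - p) > 0} \<in> sets borel" by auto
      qed
      have vval: "v x = sgn (\<nu> \<bullet> (x - p))" if "x \<in> \<Omega> \<inter> ?B" "x \<notin> strip" "x \<notin> N" for x
        using val[of x] that N(2) by auto
      have nz: "\<nu> \<bullet> (x - p) \<noteq> 0" if "x \<in> ?B" "x \<notin> strip" for x using that eta r by (auto simp: strip_def)
      have L1: "ennreal (\<delta> / 2 * \<beta>) \<le> emeasure lborel Ap"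
      proof (rule large[OF Aps(1) _ halfm(1)])
        show "\<Omega> \<inter> ?B \<subseteq> Ap \<union> {x \<in> ?B. \<nu> \<bullet> (x - p) < 0} \<union> strip \<union> N"
        proof
          fix x assume x: "x \<in> \<Omega> \<inter> ?B"
          show "x \<in> Ap \<union> {x \<in> ?B. \<nu> \<bullet> (x - p) < 0} \<union> strip \<union> N"
          proof (cases "x \<in> strip \<union> N")
            case False
            then have "v x = sgn (\<nu> \<bullet> (x - p))" "\<nu> \<bullet> (x - p) \<noteq> 0" using vval[OF x] nz[of x] x by auto
            then show ?thesis using x by (cases "\<nu> \<bullet> (x - p) > 0") (auto simp: Ap_def)
          qed auto
        qed
      qed (use measure_half_ball_le(1)[of p r \<nu>] in \<open>auto simp: Ap_def \<beta>_def\<close>)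
      have L2: "ennreal (\<delta> / 2 * \<beta>) \<le> emeasure lborel Am"
      proof (rule large[OF Aps(2) _ halfm(2)])
        show "\<Omega> \<inter> ?B \<subseteq> Am \<union> {x \<in> ?B. \<nu> \<bullet> (x - p) > 0} \<union> strip \<union> N"
        proof
          fix x assume x: "x \<in> \<Omega> \<inter> ?B"
          show "x \<in> Am \<union> {x \<in> ?B. \<nu> \<bullet> (x - p) > 0} \<union> strip \<union> N"
          proof (cases "x \<in> strip \<union> N")
            case False
            then have "v x = sgn (\<nu> \<bullet> (x - p))" "\<nu> \<bullet> (x - p) \<noteq> 0" using vval[OF x] nz[of x] x by auto
            then show ?thesis using x by (cases "\<nu> \<bullet> (x - p) > 0") (auto simp: Am_def)
          qed auto
        qed
      qed (use measure_half_ball_le(2)[of p r \<nu>] in \<open>auto simp: Am_def \<beta>_def\<close>)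
      define J where "J = (\<integral>\<^sup>+x. ennreal (norm (g x)) * indicator ?B x \<partial>lborel)"
      have "ennreal (\<delta> / 2 * \<beta>) * ennreal (\<delta> / 2 * \<beta>) \<le> emeasure lborel Am * emeasure lborel Ap"
        by (rule mult_mono[OF L2 L1]) auto
      also have "\<dots> \<le> ennreal (2 * r) * emeasure lborel (ball (0::real^'n) (2 * r)) * J"
        unfolding J_def
        by (rule poincare_two_sets[OF v g weak Aps(2,1)]) (use r in \<open>auto simp: Ap_def Am_def\<close>)
      also have "emeasure lborel (ball (0::real^'n) (2 * r)) = ennreal (2 ^ ?n * \<beta>)"
        using r m by (simp add: emeasure_ball beta power_mult_distrib mult_ac)
      also have "ennreal (2 * r) * ennreal (2 ^ ?n * \<beta>) = ennreal (2 * r * (2 ^ ?n * \<beta>))" using r bpos by (intro ennreal_mult[symmetric]) auto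
      finally have poinc: "ennreal (\<delta> / 2 * \<beta>) * ennreal (\<delta> / 2 * \<beta>) \<le> ennreal (2 * r * (2 ^ ?n * \<beta>)) * J" .
      \<comment> \<open>the factor that turns \<open>(\<delta> \<beta>/2)\<^sup>2\<close> into the premeasure bound for \<open>B(p,5r)\<close>\<close>
      define C' where "C' = unit_ball_vol m * 5 ^ m * r ^ m * 4 / (\<delta>\<^sup>2 * \<beta>\<^sup>2)"
      have C': "C' \<ge> 0" unfolding C'_def using volm r del bpos by simp
      have "hausdorff_premeasure m \<delta>' ((\<lambda>x. x) ` (H \<inter> ball p (5 * r))) \<le> hausdorff_premeasure m \<delta>' (ball p (5 * r))"
        by (rule hausdorff_premeasure_mono) auto
      also have "\<dots> \<le> ennreal (unit_ball_vol m * (10 * r / 2) ^ m)"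
        by (rule hausdorff_premeasure_le_single) (use r rb in auto)
      also have "unit_ball_vol m * (10 * r / 2) ^ m = C' * (\<delta> / 2 * \<beta> * (\<delta> / 2 * \<beta>))"
        unfolding C'_def using del bpos by (simp add: power_mult_distrib power2_eq_square)
      also have "ennreal \<dots> = ennreal C' * (ennreal (\<delta> / 2 * \<beta>) * ennreal (\<delta> / 2 * \<beta>))"
      proof -
        have "ennreal (C' * (z * z)) = ennreal C' * (ennreal z * ennreal z)" if "z \<ge> 0" for z
          using C' that by (simp add: ennreal_mult)
        from this[of "\<delta> / 2 * \<beta>"] show ?thesis using del bpos by simp
      qed
      also have "\<dots> \<le> ennreal C' * (ennreal (2 * r * (2 ^ ?n * \<beta>)) * J)" by (rule mult_left_mono[OF poinc]) simp
      also have "\<dots> = ennreal (C' * (2 * r * (2 ^ ?n * \<beta>))) * J" using C' r bpos by (subst ennreal_mult) (auto simp: mult.assoc)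
      also have "C' * (2 * r * (2 ^ ?n * \<beta>)) = C"
      proof -
        have "C' * (2 * r * (2 ^ ?n * \<beta>)) = unit_ball_vol m * 5 ^ m * 8 * 2 ^ ?n * (r ^ m * r) / (\<delta>\<^sup>2 * \<beta>)"
          unfolding C'_def using del bpos by (simp add: power2_eq_square field_simps)
        also have "\<dots> = C" unfolding C_def beta using r voln del by (simp add: power2_eq_square field_simps)
        finally show ?thesis .
      qed
      also have "ennreal C * J = (\<integral>\<^sup>+x. w x * indicator ?B x \<partial>lborel)"
      proof -
        have gB: "(\<lambda>x. ennreal (norm (g x)) * indicator ?B x) \<in> borel_measurable lborel"
          by (intro borel_measurable_times_ennreal borel_measurable_indicator) simp_all
        show ?thesis unfolding J_def w_def using C
          by (subst nn_integral_cmult[OF gB, symmetric]) (simp add: ennreal_mult mult.assoc)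
      qed
      finally have "hausdorff_premeasure m \<delta>' ((\<lambda>x. x) ` (H \<inter> ball p (5 * r))) \<le> (\<integral>\<^sup>+x. w x * indicator ?B x \<partial>lborel)" .
      moreover have "?B \<subseteq> V j" using b0(2) rb(2) by (meson less_imp_le subset_ball subset_trans)
      ultimately show "\<exists>r. 0 < r \<and> r \<le> 1 \<and> ball p r \<subseteq> V j \<and>
        hausdorff_premeasure m \<delta>' ((\<lambda>x. x) ` (H \<inter> ball p (5 * r))) \<le> (\<integral>\<^sup>+x. w x * indicator (ball p r) x \<partial>lborel)"
        using r rb by blast
    qed
    then show ?thesis using oV[of j] by (simp add: emeasure_density)
  qed

  have "(\<lambda>j. emeasure (density lborel w) (V j)) \<longlonglongrightarrow> emeasure (density lborel w) (\<Inter>j. V j)"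
  proof (rule Lim_emeasure_decseq)
    show "range V \<subseteq> sets (density lborel w)" using oV by auto
    show "decseq V" unfolding decseq_def V_def by (auto elim!: less_le_trans simp: frac_le)
    have "(\<integral>\<^sup>+x. w x \<partial>lborel) < \<infinity>"
    proof -
      have "integrable lborel (\<lambda>x. C * norm (g x))" using g by simp
      then have "(\<integral>\<^sup>+x. ennreal (C * norm (g x)) \<partial>lborel) = ennreal (\<integral>x. C * norm (g x) \<partial>lborel)"
        by (rule nn_integral_eq_integral) (use C in simp)
      then show ?thesis unfolding w_def by (simp only: ennreal_less_top infinity_ennreal_def)
    qed
    moreover have "emeasure (density lborel w) (V j) \<le> (\<integral>\<^sup>+x. w x \<partial>lborel)" for j
      using oV[of j] by (auto simp: emeasure_density indicator_def intro!: nn_integral_mono)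
    ultimately show "emeasure (density lborel w) (V j) \<noteq> \<infinity>" for j by (metis infinity_ennreal_def less_le_trans not_less top.not_eq_extremum)
  qed
  moreover have "emeasure (density lborel w) (\<Inter>j. V j) = 0"
  proof -
    have "(\<Inter>j. V j) \<subseteq> {x. h x = 0}"
    proof
      fix x assume x: "x \<in> (\<Inter>j. V j)"
      show "x \<in> {x. h x = 0}"
      proof (rule ccontr)
        assume "x \<notin> {x. h x = 0}"
        then have "\<bar>h x\<bar> > 0" by simp
        then obtain j where "1 / real (Suc j) < \<bar>h x\<bar>" using nat_approx_posE by blast
        moreover have "\<bar>h x\<bar> < 1 / real (Suc j)" using x by (auto simp: V_def)
        ultimately show False by simp
      qed
    qed
    moreover have "negligible {x. h x = 0}"
    proof (rule negligible_zeros_of_increasing_along[OF hc, of \<nu>])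
      show "h x < h (x + t *\<^sub>R \<nu>)" if "t > 0" for x t using ch(2)[of t x] that by simp
    qed
    ultimately have "negligible (\<Inter>j. V j)" by (rule negligible_subset[rotated])
    then have "(\<Inter>j. V j) \<in> null_sets lebesgue" by (simp add: negligible_iff_null_sets)
    moreover have Vb: "(\<Inter>j. V j) \<in> sets lborel" using oV by auto
    ultimately have "(\<Inter>j. V j) \<in> null_sets lborel" by (simp add: null_sets_completion_iff)
    then have "AE x in lborel. x \<notin> (\<Inter>j. V j)" by (rule AE_not_in)
    then have "(\<integral>\<^sup>+x. w x * indicator (\<Inter>j. V j) x \<partial>lborel) = (\<integral>\<^sup>+(x::real^'n). 0 \<partial>lborel)"
      by (intro nn_integral_cong_AE) (auto elim!: eventually_mono simp: indicator_def)
    then show ?thesis using Vb by (simp add: emeasure_density)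
  qed
  ultimately have lim: "(\<lambda>j. emeasure (density lborel w) (V j)) \<longlonglongrightarrow> 0" by simp
  have "hausdorff_premeasure m \<delta>' H = 0" if "\<delta>' > 0" for \<delta>'
  proof -
    have "hausdorff_premeasure m \<delta>' H \<le> 0"
      by (rule LIMSEQ_le_const[OF lim]) (use bound[OF that] in auto)
    then show ?thesis by simp
  qed
  then show ?thesis unfolding H_def[symmetric] hausdorff_measure_eq_0_iff by blast
qed

theorem corollary4p1:
  fixes \<Omega> :: "(real^'n::finite) set"
  assumes "CARD('n) \<ge> 2"
    and "CARD('m::finite) = CARD('n) - 1"
    and "bounded \<Omega>"
    and "W11_extension_domain \<Omega>"
  shows "purely_unrectifiable TYPE('m) {x \<in> frontier \<Omega>. upper_density \<Omega> x > ereal (1/2)}"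
  unfolding purely_unrectifiable_def
proof (intro allI impI)
  fix f :: "real^'m \<Rightarrow> real^'n"
  assume "\<exists>L. L-lipschitz_on UNIV f"
  then obtain L where L: "L-lipschitz_on UNIV f" by blast
  have card: "CARD('n) = Suc CARD('m)" "CARD('m) < DIM(real^'n)" using assms(1,2) by auto
  define H where "H \<delta> = {x \<in> frontier \<Omega>. upper_density \<Omega> x > ereal (1/2 + \<delta>)}" for \<delta>
  have null: "hausdorff_measure CARD('m) (H \<delta> \<inter> range f) = 0" if del: "\<delta> > 0" for \<delta>
  proof -
    define \<eta> where "\<eta> = min (1/2) (\<delta> / (8 * 2 ^ CARD('n)))"
    have eta: "\<eta> > 0" "\<eta> \<le> 1/2" using del by (auto simp: \<eta>_def)
    have "\<eta> \<le> \<delta> / (8 * 2 ^ CARD('n))" by (simp add: \<eta>_def)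
    then have eta2: "8 * 2 ^ CARD('n) * \<eta> \<le> \<delta>" by (simp add: le_divide_eq mult_ac)
    obtain I :: "((real^'n) \<times> nat \<times> (real^'m)) set" and \<nu> K Z where
      I: "countable I" "range f \<subseteq> Z \<union> (\<Union>i\<in>I. K i)" "hausdorff_measure CARD('m) Z = 0"
      "\<And>i. i \<in> I \<Longrightarrow> norm (\<nu> i) = 1 \<and> cone_flat \<eta> (\<nu> i) (K i)"
      using lipschitz_range_decomposition[OF L card(2) eta(1)] by metis
    have "hausdorff_measure CARD('m) (\<Union>i\<in>I. K i \<inter> H \<delta>) = 0"
    proof (rule hausdorff_null_UN[OF I(1)])
      fix i assume "i \<in> I"
      then have "norm (\<nu> i) = 1" "cone_flat \<eta> (\<nu> i) (K i)" using I(4) by auto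
      then show "hausdorff_measure CARD('m) (K i \<inter> H \<delta>) = 0"
        unfolding H_def by (rule hausdorff_null_dense_points_on_cone_flat[OF assms(4,3) card(1) _ _ eta del eta2])
    qed
    then have "hausdorff_measure CARD('m) (\<Union>b\<in>UNIV. if b then Z else (\<Union>i\<in>I. K i \<inter> H \<delta>)) = 0"
      using I(3) by (intro hausdorff_null_UN) auto
    moreover have "H \<delta> \<inter> range f \<subseteq> (\<Union>b\<in>UNIV. if b then Z else (\<Union>i\<in>I. K i \<inter> H \<delta>))"
      using I(2) by (auto simp: UNIV_bool)
    ultimately show ?thesis by (rule hausdorff_null_mono)
  qed
  have "hausdorff_measure CARD('m) (\<Union>j::nat. H (1 / Suc j) \<inter> range f) = 0"
    by (rule hausdorff_null_UN) (use null in auto)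
  moreover have "{x \<in> frontier \<Omega>. upper_density \<Omega> x > ereal (1/2)} \<inter> range f \<subseteq> (\<Union>j::nat. H (1 / Suc j) \<inter> range f)"
  proof
    fix x assume x: "x \<in> {x \<in> frontier \<Omega>. upper_density \<Omega> x > ereal (1/2)} \<inter> range f"
    then obtain q where q: "ereal (1/2) < ereal q" "ereal q < upper_density \<Omega> x" using ereal_dense2[of "ereal (1/2)" "upper_density \<Omega> x"] by auto
    then have "q - 1/2 > 0" by simp
    then obtain j where "1 / real (Suc j) < q - 1/2" using nat_approx_posE by blast
    then have "ereal (1/2 + 1 / Suc j) < ereal q" by simp
    then have "ereal (1/2 + 1 / Suc j) < upper_density \<Omega> x" using q(2) by (rule less_trans)
    then have "x \<in> H (1 / Suc j)" using x unfolding H_def by simp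
    then show "x \<in> (\<Union>j::nat. H (1 / Suc j) \<inter> range f)" using x by blast
  qed
  ultimately show "hausdorff_measure CARD('m) ({x \<in> frontier \<Omega>. upper_density \<Omega> x > ereal (1/2)} \<inter> range f) = 0"
    by (rule hausdorff_null_mono)
qed

end
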